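(* Let $k,l\in\mathbb{N}$ and $\varepsilon>0$. For $g$ large, $$\sum_{D\in\mathcal{H}_{2g+1}}\big|\mathcal{L}^{(l)}(q^{-1/2},\chi_D)\big|^{k}\ll_{k,l,\varepsilon}q^{2g+1}g^{\frac12k(k+1)+lk+\varepsilon},$$ $$\sum_{D\in\mathcal{H}_{2g+2}}\big|\mathcal{L}^{(l)}(q^{-1/2},\chi_D)\big|^{k}\ll_{k,l,\varepsilon}q^{2g+2}g^{\frac12k(k+1)+lk+\varepsilon},$$ where $\mathcal{L}^{(l)}(u,\chi_D)$ denotes the $l$-th derivative of $\mathcal{L}(u,\chi_D)$ with respect to $u$.
   Context: $\mathbb{F}_q$ is a fixed finite field of odd cardinality $q$ (implied constants may depend on $q$). $\mathcal{H}_n$ is the set of monic square-free polynomials of degree $n$ in $\mathbb{F}_q[t]$. For monic irreducible $P\in\mathbb{F}_q[t]$, $\left(\frac{f}{P}\right)$ is $0$ if $P\mid f$, $1$ if $P\nmid f$ and $f$ is a square mod $P$, and $-1$ otherwise. For $D$ monic square-free, $\chi_D(f)=\left(\frac{D}{f}\right)$ for monic $f$, extended multiplicatively in $f$ from the symbols $\left(\frac{D}{P}\right)$. The $L$-function is $$\mathcal{L}(u,\chi_D)=\sum_{f\ \mathrm{monic}}\chi_D(f)u^{\deg f}=\prod_{P}\big(1-\chi_D(P)u^{\deg P}\big)^{-1},\qquad |u|<1/q$$ (sum over all monic $f\in\mathbb{F}_q[t]$, including $f=1$; product over monic irreducibles). For $\deg D\ge1$ it is a polynomial in $u$ of degree at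 most $\deg D-1$, hence defined for all $u\in\mathbb{C}$. *)

theory Defs
  imports "HOL-Analysis.Analysis" "HOL-Computational_Algebra.Computational_Algebra"
    "HOL-Number_Theory.Cong" "HOL-Library.Landau_Symbols"
begin

definition monic_polys :: "nat \<Rightarrow> 'a::field poly set" where
  "monic_polys n = {f. lead_coeff f = 1 \<and> degree f = n}"

definition monic_squarefree_polys :: "nat \<Rightarrow> 'a::field poly set" where
  "monic_squarefree_polys n = {D. lead_coeff D = 1 \<and> squarefree D \<and> degree D = n}"

text \<open>The quadratic residue symbol \<open>(f/P)\<close>, meant for monic irreducible \<open>P\<close>.\<close>

definition poly_legendre :: "'a::field poly \<Rightarrow> 'a poly \<Rightarrow> int" where
  "poly_legendre f P =
     (if P dvd f then 0 else if \<exists>h. [h ^ 2 = f] (mod P) then 1 else -1)"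

text \<open>
  \<open>\<chi>\<^sub>D(f) = (D/f)\<close>, the completely multiplicative extension in \<open>f\<close> of the symbols \<open>(D/P)\<close>.
  It is only meant for monic \<open>f\<close>; over a finite field the product is then finite.
  The exponent is the multiplicity of \<open>P\<close> in \<open>f\<close>, spelled out because the library's
  \<open>multiplicity\<close> on polynomials needs a coefficient sort with gcd operations.
\<close>

definition quad_char :: "'a::field poly \<Rightarrow> 'a poly \<Rightarrow> int" where
  "quad_char D f =
     (\<Prod>P | lead_coeff P = 1 \<and> irreducible P \<and> P dvd f.
        poly_legendre D P ^ Max {n. P ^ n dvd f})"

text \<open>
  The sum over all monic \<open>f\<close>, ordered by degree, i.e. as a power series in \<open>u\<close>.
  For \<open>|u| < 1/q\<close> this is the unordered sum over all monic \<open>f\<close> (lemma \<open>has_sum_quad_L\<close> below).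
  For \<open>D\<close> monic square-free of degree at least 1 almost all coefficients
  vanish, so the same formula also gives the value of the polynomial at every complex \<open>u\<close>.
\<close>

definition quad_L :: "'a::finite_field poly \<Rightarrow> complex \<Rightarrow> complex" where
  "quad_L D u = (\<Sum>n. (\<Sum>f\<in>monic_polys n. of_int (quad_char D f)) * u ^ n)"

lemma monic_polys_finite_card:
  shows "finite (monic_polys n :: 'a::finite_field poly set)"
    and "card (monic_polys n :: 'a poly set) \<le> CARD('a) ^ n"
proof -
  let ?r = "\<lambda>f::'a poly. restrict (coeff f) {..<n}"
  have inj: "inj_on ?r (monic_polys n)"
  proof (rule inj_onI, rule poly_eqI)
    fix f g :: "'a poly" and i
    assume A: "f \<in> monic_polys n" "g \<in> monic_polys n" "?r f = ?r g"
    consider "i < n" | "i = n" | "i > n" by linarith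
    then show "coeff f i = coeff g i"
    proof cases
      case 1 then show ?thesis using fun_cong[OF A(3), of i] by simp
    next
      case 2 then show ?thesis using A by (auto simp: monic_polys_def)
    next
      case 3 then show ?thesis using A by (auto simp: monic_polys_def coeff_eq_0)
    qed
  qed
  have sub: "?r ` monic_polys n \<subseteq> PiE {..<n} (\<lambda>_. UNIV)" by (auto split: if_splits)
  have fin: "finite (PiE {..<n} (\<lambda>_. UNIV :: 'a set))" by (intro finite_PiE) auto
  show "finite (monic_polys n :: 'a poly set)"
    by (rule finite_imageD[OF finite_subset[OF sub fin] inj])
  show "card (monic_polys n :: 'a poly set) \<le> CARD('a) ^ n"
    using card_inj_on_le[OF inj sub fin] by (simp add: card_PiE)
qed

lemma abs_poly_legendre_le_1: "\<bar>poly_legendre f P\<bar> \<le> 1"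
  by (simp add: poly_legendre_def)

lemma abs_quad_char_le_1: "\<bar>quad_char D f\<bar> \<le> 1"
  unfolding quad_char_def abs_prod
  by (rule prod_le_1) (auto simp: power_abs intro!: power_le_one abs_poly_legendre_le_1)

lemma has_sum_quad_L:
  fixes D :: "'a::finite_field poly"
  assumes u: "norm u < 1 / real CARD('a)"
  shows "((\<lambda>f. of_int (quad_char D f) * u ^ degree f) has_sum quad_L D u) {f. lead_coeff f = 1}"
proof -
  let ?q = "real CARD('a)"
  let ?t = "\<lambda>f::'a poly. of_int (quad_char D f) * u ^ degree f :: complex"
  define x where "x = ?q * norm u"
  have q: "?q > 0" by simp
  have x: "0 \<le> x" "x < 1" using u q by (auto simp: x_def field_simps)
  have inner: "(\<Sum>f\<in>monic_polys n. norm (?t f)) \<le> x ^ n" for n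
  proof -
    have "(\<Sum>f\<in>monic_polys n. norm (?t f)) \<le> (\<Sum>f\<in>(monic_polys n :: 'a poly set). norm u ^ n)"
    proof (rule sum_mono)
      fix f :: "'a poly" assume f: "f \<in> monic_polys n"
      have "norm (of_int (quad_char D f) :: complex) \<le> 1"
        using abs_quad_char_le_1[of D f] by (simp add: norm_of_int)
      then show "norm (?t f) \<le> norm u ^ n"
        using f by (simp add: monic_polys_def norm_mult norm_power mult_left_le_one_le)
    qed
    also have "\<dots> = real (card (monic_polys n :: 'a poly set)) * norm u ^ n" by simp
    also have "\<dots> \<le> real (CARD('a) ^ n) * norm u ^ n"
      by (intro mult_right_mono of_nat_mono monic_polys_finite_card) auto
    finally show ?thesis by (simp add: x_def power_mult_distrib)
  qed
  have un: "{f::'a poly. lead_coeff f = 1} = snd ` (SIGMA n:UNIV. monic_polys n)"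
    by (force simp: monic_polys_def)
  have inj: "inj_on snd (SIGMA n:UNIV. (monic_polys n :: 'a poly set))"
    by (auto simp: inj_on_def monic_polys_def)
  have abs: "(\<lambda>f. norm (?t f)) summable_on {f. lead_coeff f = 1}"
  proof (rule nonneg_bdd_above_summable_on)
    show "bdd_above (sum (\<lambda>f. norm (?t f)) ` {F. F \<subseteq> {f. lead_coeff f = 1} \<and> finite F})"
    proof (rule bdd_aboveI)
      fix y assume "y \<in> sum (\<lambda>f. norm (?t f)) ` {F. F \<subseteq> {f. lead_coeff f = 1} \<and> finite F}"
      then obtain F where F: "F \<subseteq> {f. lead_coeff f = 1}" "finite F" "y = (\<Sum>f\<in>F. norm (?t f))" by auto
      let ?N = "degree ` F"
      have sub: "F \<subseteq> (\<Union>n\<in>?N. monic_polys n)" using F(1) by (auto simp: monic_polys_def)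
      have "y \<le> (\<Sum>f\<in>(\<Union>n\<in>?N. monic_polys n). norm (?t f))"
        unfolding F(3) using F(2) sub by (intro sum_mono2) (auto simp: monic_polys_finite_card)
      also have "\<dots> = (\<Sum>n\<in>?N. \<Sum>f\<in>monic_polys n. norm (?t f))"
        by (rule sum.UNION_disjoint) (use F(2) monic_polys_finite_card in \<open>auto simp: monic_polys_def\<close>)
      also have "\<dots> \<le> (\<Sum>n\<in>?N. x ^ n)" by (intro sum_mono inner)
      also have "\<dots> \<le> (\<Sum>n. x ^ n)"
        using F(2) x by (intro sum_le_suminf summable_geometric) auto
      finally show "y \<le> (\<Sum>n. x ^ n)" .
    qed
  qed auto
  then have "?t summable_on {f. lead_coeff f = 1}" by (rule abs_summable_summable)
  then obtain s where s: "(?t has_sum s) {f. lead_coeff f = 1}" by (auto simp: summable_on_def)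
  then have "((?t \<circ> snd) has_sum s) (SIGMA n:UNIV. monic_polys n)"
    using has_sum_reindex[OF inj, of ?t s] un by simp
  then have "((\<lambda>n. \<Sum>f\<in>monic_polys n. ?t f) has_sum s) UNIV"
    by (rule has_sum_SigmaD) (simp add: o_def has_sum_finite monic_polys_finite_card)
  then have "(\<lambda>n. \<Sum>f\<in>monic_polys n. ?t f) sums s" by (rule has_sum_imp_sums)
  moreover have "(\<Sum>f\<in>monic_polys n. ?t f) = (\<Sum>f\<in>monic_polys n. of_int (quad_char D f)) * u ^ n" for n
    unfolding sum_distrib_right by (rule sum.cong) (auto simp: monic_polys_def)
  ultimately have "s = quad_L D u" unfolding quad_L_def by (simp add: sums_iff)
  with s show ?thesis by simp
qed

end

theory Submission
  imports "HOL-Algebra.Algebraic_Closure_Type" "HOL-Real_Asymp.Real_Asymp" Defs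
begin

text \<open>
  Reciprocity makes \<open>L(u, \<chi>\<^sub>D)\<close> a polynomial, and Stepanov's method, run over the even-degree extensions of
  the constant field, where the number of elements is a square \<open>l\<^sup>2\<close> and the vanishing conditions are
  the \<open>l\<close>-th power of a polynomial identity solvable by the pigeonhole principle, gives the Riemann
  hypothesis for it. As all inverse zeros have modulus at most \<open>\<surd>q\<close>, a Fejer-type majorant of
  \<open>ln \<bar>1 - z\<bar>\<close> bounds \<open>\<bar>L(u, \<chi>\<^sub>D)\<bar>\<close> for \<open>\<bar>u\<bar> \<le> 1 / \<surd>q\<close> by the exponential of \<open>n / N\<close>, where \<open>n = degree D\<close>,
  plus a sum over the primes of degree at most \<open>N\<close>. Summed over all monic \<open>D\<close> of degree \<open>n\<close>,
  a product of symbols \<open>(D/P)\<close> of total degree at most \<open>n\<close> has sum exactly zero unless every \<open>P\<close>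
  occurs an even number of times, so the even moments of such prime sums are at most Gaussian.
  The squares of primes contribute the power \<open>n^(k / 2)\<close> and the variance \<open>ln n\<close> of the prime sum
  the power \<open>n^(k^2 / 2)\<close>. For derivatives, average over a circle of radius \<open>1 / n\<close>
  around \<open>1 / \<surd>q\<close>; points outside the disc are reflected into it at the cost of a bounded factor.
\<close>

section \<open>The Frobenius map and finite subfields of the algebraic closure\<close>

text \<open>Orthogonality is exact only up to total degree \<open>n\<close>, so a prime sum of
  length \<open>N\<close> has controlled moments only up to order about \<open>n / N\<close>. The
  majorant loses a factor \<open>exp (k * n / N)\<close>; keeping it below a small power of
  \<open>n\<close> forces \<open>N\<close> to be a large multiple of \<open>n / ln n\<close>, and
  this leaves too few moments for an exponential moment of the whole sum. Hence the cut at a smaller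
  \<open>z\<close>, also of order \<open>n / ln n\<close>: up to \<open>z\<close> enough moments are
  available, and beyond \<open>z\<close> the variance is bounded, so that the rest exceeds
  \<open>\<eta> * ln n\<close> only on a set whose relative size is below any chosen power of
  \<open>n\<close>. On the exceptional sets a crude bound \<open>n^B\<close> for the moment of order
  \<open>2 * k\<close> takes over; \<open>B\<close> may be large, because the exceptional sets are
  made small in terms of it. The two losses of size \<open>\<eta> * ln n\<close> are the source of
  the \<epsilon>. Orthogonality is a statement about all monic \<open>D\<close>, whereas the
  L-function is bounded for square-free \<open>D\<close>. The passage between the two is by
  positivity, which is why even moments and even Taylor polynomials appear.\<close>

lemma CARD_ge_2: "CARD('a::finite_field) \<ge> 2"
proof -
  have "card {0, 1 :: 'a} \<le> CARD('a)" by (intro card_mono) auto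
  then show ?thesis by simp
qed

text \<open>The polynomial \<open>(1 + X)^q - X^q - 1\<close> has degree below \<open>q\<close> and
  vanishes at all \<open>q\<close> field elements, hence it is zero. This gives the additivity of
  the \<open>q\<close>-th power without writing \<open>q\<close> as a power of the
  characteristic.\<close>

lemma binomial_CARD_eq_0:
  assumes "0 < k" "k < CARD('a::finite_field)"
  shows "of_nat (CARD('a) choose k) = (0::'a)"
proof -
  let ?q = "CARD('a)"
  define p :: "'a poly" where "p = [:1, 1:] ^ ?q - monom 1 ?q - 1"
  have c: "coeff p i = of_nat (?q choose i) - (if i = ?q then 1 else 0) - (if i = 0 then 1 else 0)" for i
    unfolding p_def by (cases "i \<le> ?q") (auto simp: coeff_linear_poly_power coeff_eq_0 degree_power_eq binomial_eq_0)
  have deg: "coeff p i = 0" if "i \<ge> ?q" for i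
    using that CARD_ge_2[where 'a='a] by (auto simp: c binomial_eq_0)
  have "poly p a = 0" for a
    by (simp add: p_def poly_monom finite_field_power_card_eq_same)
  then have U: "{x. poly p x = 0} = UNIV" by auto
  have "p = 0"
  proof (rule ccontr)
    assume p: "p \<noteq> 0"
    then have "degree p < ?q"
      using deg[of "degree p"] leading_coeff_0_iff not_le by blast
    moreover have "?q \<le> degree p"
      using card_poly_roots_bound[OF p] U by simp
    ultimately show False by simp
  qed
  then show ?thesis using c[of k] assms by simp
qed

lemma power_add_of_binomial_eq_0:
  fixes x y :: "'b::comm_ring_1"
  assumes "n > 0" and "\<And>k. 0 < k \<Longrightarrow> k < n \<Longrightarrow> of_nat (n choose k) = (0::'b)"
  shows "(x + y) ^ n = x ^ n + y ^ n"
proof -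
  have "(x + y) ^ n = (\<Sum>k\<le>n. of_nat (n choose k) * x ^ k * y ^ (n - k))"
    by (rule binomial_ring)
  also have "\<dots> = (\<Sum>k\<in>{0,n}. of_nat (n choose k) * x ^ k * y ^ (n - k))"
    using assms by (intro sum.mono_neutral_right) (auto simp: le_less)
  finally show ?thesis using assms(1) by (simp add: add.commute)
qed

lemma frobenius_poly_add:
  fixes f g :: "'a::finite_field poly"
  shows "(f + g) ^ (CARD('a) ^ n) = f ^ (CARD('a) ^ n) + g ^ (CARD('a) ^ n)"
proof (induction n)
  case (Suc n)
  have "(f + g) ^ CARD('a) = f ^ CARD('a) + g ^ CARD('a)" for f g :: "'a poly"
    by (rule power_add_of_binomial_eq_0) (use binomial_CARD_eq_0[where 'a='a] in \<open>auto simp: of_nat_poly\<close>)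
  with Suc show ?case by (simp add: power_mult power_Suc2 del: power_Suc)
qed simp

lemma frobenius_add:
  fixes x y :: "'a::finite_field alg_closure"
  shows "(x + y) ^ (CARD('a) ^ n) = x ^ (CARD('a) ^ n) + y ^ (CARD('a) ^ n)"
proof (induction n)
  case (Suc n)
  have b: "of_nat (CARD('a) choose k) = (0 :: 'a alg_closure)" if "0 < k" "k < CARD('a)" for k
    using binomial_CARD_eq_0[OF that] by (metis to_ac_0 to_ac_of_nat)
  have "(x + y) ^ CARD('a) = x ^ CARD('a) + y ^ CARD('a)" for x y :: "'a alg_closure"
    by (rule power_add_of_binomial_eq_0) (use b in auto)
  with Suc show ?case by (simp add: power_mult power_Suc2 del: power_Suc)
qed simp

lemma frobenius_minus:
  fixes x :: "'a::finite_field alg_closure"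
  shows "(- x) ^ (CARD('a) ^ n) = - (x ^ (CARD('a) ^ n))"
  using frobenius_add[of x "- x" n] by (metis add.right_inverse add_eq_0_iff finite_UNIV
      zero_power zero_less_power zero_less_card_finite)

lemma frobenius_diff:
  fixes x y :: "'a::finite_field alg_closure"
  shows "(x - y) ^ (CARD('a) ^ n) = x ^ (CARD('a) ^ n) - y ^ (CARD('a) ^ n)"
  using frobenius_add[of x "- y" n] by (simp add: frobenius_minus)

lemma frobenius_sum:
  fixes f :: "'i \<Rightarrow> 'a::finite_field alg_closure"
  shows "(\<Sum>i\<in>A. f i) ^ (CARD('a) ^ n) = (\<Sum>i\<in>A. f i ^ (CARD('a) ^ n))"
  by (induction A rule: infinite_finite_induct) (auto simp: frobenius_add)

lemma frobenius_poly_minus: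
  fixes f :: "'a::finite_field poly"
  shows "(- f) ^ (CARD('a) ^ n) = - (f ^ (CARD('a) ^ n))"
  using frobenius_poly_add[of f "- f" n] by (metis add.right_inverse add_eq_0_iff
      zero_power zero_less_power zero_less_card_finite)

lemma frobenius_poly_diff:
  fixes f g :: "'a::finite_field poly"
  shows "(f - g) ^ (CARD('a) ^ n) = f ^ (CARD('a) ^ n) - g ^ (CARD('a) ^ n)"
  using frobenius_poly_add[of f "- g" n] by (simp add: frobenius_poly_minus)

lemma frobenius_inj:
  fixes x y :: "'a::finite_field alg_closure"
  assumes "x ^ (CARD('a) ^ n) = y ^ (CARD('a) ^ n)"
  shows "x = y"
  using frobenius_diff[of x y n] assms by simp

text \<open>Congruences modulo an irreducible polynomial are replaced throughout by equalities of
  values at one of its roots, so that no quotient ring has to be built.\<close>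

definition ev :: "'a::field poly \<Rightarrow> 'a alg_closure \<Rightarrow> 'a alg_closure" where
  "ev f x = poly (map_poly to_ac f) x"

lemma ev_pCons [simp]: "ev (pCons c f) x = to_ac c + x * ev f x"
  by (simp add: ev_def map_poly_pCons)

lemma ev_0 [simp]: "ev 0 x = 0"
  by (simp add: ev_def)

lemma ev_1 [simp]: "ev 1 x = 1"
  by (simp add: ev_def)

lemma ev_add [simp]: "ev (f + g) x = ev f x + ev g x"
  by (induction f g rule: poly_induct2) (auto simp: algebra_simps)

lemma ev_smult [simp]: "ev (smult c f) x = to_ac c * ev f x"
  by (induction f) (auto simp: algebra_simps)

lemma ev_minus [simp]: "ev (- f) x = - ev f x"
  using ev_smult[of "-1" f x] by simp

lemma ev_diff [simp]: "ev (f - g) x = ev f x - ev g x"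
  using ev_add[of f "- g" x] by simp

lemma ev_mult [simp]: "ev (f * g) x = ev f x * ev g x"
  by (induction f) (auto simp: algebra_simps)

lemma ev_power [simp]: "ev (f ^ n) x = ev f x ^ n"
  by (induction n) auto

lemma ev_sum: "ev (\<Sum>i\<in>A. f i) x = (\<Sum>i\<in>A. ev (f i) x)"
  by (induction A rule: infinite_finite_induct) auto

lemma ev_monom [simp]: "ev (monom c n) x = to_ac c * x ^ n"
  by (simp add: ev_def map_poly_monom poly_monom)

lemma ev_frobenius:
  fixes f :: "'a::finite_field poly"
  shows "ev f x ^ (CARD('a) ^ n) = ev f (x ^ (CARD('a) ^ n))"
proof (induction f)
  case (pCons c f)
  have "to_ac c ^ (CARD('a) ^ n) = to_ac c"
    by (metis finite_field_power_card_power_eq_same to_ac_power)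
  then show ?case using pCons by (simp add: frobenius_add power_mult_distrib)
qed (simp add: zero_power)

lemma card_ev_roots:
  assumes "f \<noteq> (0::'a::field poly)"
  shows "finite {x. ev f x = 0}" "card {x. ev f x = 0} \<le> degree f"
proof -
  have nz: "map_poly to_ac f \<noteq> 0" using assms by (simp add: map_poly_eq_0_iff)
  show "finite {x. ev f x = 0}" unfolding ev_def using nz by (rule poly_roots_finite)
  show "card {x. ev f x = 0} \<le> degree f"
    unfolding ev_def using card_poly_roots_bound[OF nz] degree_map_poly[of to_ac f] by simp
qed

lemma ev_root_exists:
  assumes "degree (f::'a::field poly) > 0"
  obtains x where "ev f x = 0"
proof -
  have "degree (map_poly to_ac f) = degree f" by (rule degree_map_poly) simp
  then have "degree (map_poly to_ac f) > 0" using assms by simp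
  then show ?thesis using alg_closed_imp_poly_has_root that unfolding ev_def by blast
qed

text \<open>For \<open>n > 0\<close> this is the field with \<open>CARD('a) ^ n\<close> elements,
  realised inside one algebraic closure; for \<open>n = 0\<close> it is the whole closure.\<close>

definition fixed_field :: "nat \<Rightarrow> 'a::finite_field alg_closure set" where
  "fixed_field n = {x. x ^ (CARD('a) ^ n) = x}"

text \<open>The polynomial \<open>X^Q - X\<close> splits into linear factors over the closure, and
  its derivative is \<open>-1\<close>, so no root is repeated.\<close>

lemma card_fixed_field:
  assumes "n > 0"
  shows "finite (fixed_field n :: 'a::finite_field alg_closure set)"
    and "card (fixed_field n :: 'a alg_closure set) = CARD('a) ^ n"
proof -
  let ?Q = "CARD('a) ^ n"
  have Q: "?Q > 1" using CARD_ge_2[where 'a='a] assms by (intro one_less_power) auto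
  define p :: "'a alg_closure poly" where "p = monom 1 ?Q - monom 1 1"
  have deg: "degree p = ?Q"
    unfolding p_def diff_conv_add_uminus using Q
    by (subst degree_add_eq_left) (auto simp: degree_monom_eq)
  then have nz: "p \<noteq> 0" using Q by auto
  have roots: "{x. poly p x = 0} = (fixed_field n :: 'a alg_closure set)"
    by (auto simp: p_def fixed_field_def poly_monom)
  show "finite (fixed_field n :: 'a alg_closure set)"
    using poly_roots_finite[OF nz] roots by simp
  obtain A where A: "size A = ?Q" "p = smult (lead_coeff p) (\<Prod>x\<in>#A. [:- x, 1:])"
    using alg_closed_imp_factorization[OF nz] deg by auto
  have "of_nat (CARD('a)) = (0::'a alg_closure)"
    using binomial_CARD_eq_0[where 'a='a and k=1] CARD_ge_2[where 'a='a]
    by (metis binomial_1 less_one less_le_trans numeral_2_eq_2 lessI to_ac_0 to_ac_of_nat One_nat_def)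
  then have "of_nat ?Q = (0::'a alg_closure)" using assms by (simp add: zero_power)
  then have d: "pderiv p = - 1"
    using assms by (simp add: p_def pderiv_diff pderiv_monom monom_0 one_pCons zero_power)
  have cnt: "count A x \<le> 1" for x
  proof (rule ccontr)
    assume "\<not> count A x \<le> 1"
    then have x: "x \<in># A" "x \<in># A - {#x#}" by (auto simp: not_le in_diff_count simp flip: count_greater_zero_iff)
    then obtain B where B: "A = add_mset x (add_mset x B)" by (metis insert_DiffM)
    define l r where "l = [:- x, 1:]" and "r = smult (lead_coeff p) (\<Prod>x\<in>#B. [:- x, 1:])"
    have "p = l * (l * r)"
      by (subst A(2)) (simp add: B l_def r_def)
    moreover have "poly l x = 0" by (simp add: l_def)
    then have "poly (pderiv (l * (l * r))) x = 0" by (simp add: pderiv_mult)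
    ultimately show False using d by simp
  qed
  have "A = mset_set (set_mset A)"
  proof (rule multiset_eqI)
    fix x show "count A x = count (mset_set (set_mset A)) x"
      using cnt[of x] by (cases "x \<in># A") (auto simp: not_in_iff intro!: le_antisym simp flip: count_greater_zero_iff)
  qed
  then have "card (set_mset A) = ?Q" using A(1) by (metis size_mset_set)
  moreover have "set_mset A = fixed_field n"
  proof -
    have "poly p x = 0 \<longleftrightarrow> x \<in># A" for x
      by (subst A(2)) (use nz in \<open>auto simp: poly_prod_mset prod_mset_zero_iff\<close>)
    then show ?thesis using roots by auto
  qed
  ultimately show "card (fixed_field n :: 'a alg_closure set) = ?Q" by simp
qed

lemma fixed_field_1: "fixed_field 1 = range (to_ac :: 'a::finite_field \<Rightarrow> _)"
proof (rule card_subset_eq [symmetric])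
  show "range to_ac \<subseteq> (fixed_field 1 :: 'a alg_closure set)"
    by (auto simp: fixed_field_def finite_field_power_card_eq_same simp flip: to_ac_power)
  show "card (range (to_ac :: 'a \<Rightarrow> _)) = card (fixed_field 1 :: 'a alg_closure set)"
    by (simp add: card_fixed_field card_image inj_to_ac)
qed (simp add: card_fixed_field)

lemma fixed_field_ev: "x \<in> fixed_field n \<Longrightarrow> ev f x \<in> fixed_field n"
  by (simp add: fixed_field_def ev_frobenius)

text \<open>The condition is on coefficients because \<open>degree f < n\<close> would exclude the
  zero polynomial when \<open>n = 0\<close>. In this form the set is closed under differences and
  has exactly \<open>CARD('a) ^ n\<close> elements.\<close>

definition polys_below :: "nat \<Rightarrow> 'a::zero poly set" where
  "polys_below n = {f. \<forall>i\<ge>n. coeff f i = 0}"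

lemma card_polys_below:
  shows "finite (polys_below n :: 'a::finite_field poly set)"
    and "card (polys_below n :: 'a poly set) = CARD('a) ^ n"
proof -
  let ?P = "PiE {..<n} (\<lambda>_. UNIV :: 'a set)"
  have c: "coeff (Abs_poly (\<lambda>i. if i < n then g i else 0)) = (\<lambda>i. if i < n then g i else (0::'a))" for g
    by (rule Abs_poly_inverse) (auto intro!: exI[of _ n] simp: MOST_nat)
  have "bij_betw (\<lambda>f. restrict (coeff f) {..<n}) (polys_below n :: 'a poly set) ?P"
  proof (rule bij_betwI[where g = "\<lambda>g. Abs_poly (\<lambda>i. if i < n then g i else 0)"])
    show "(\<lambda>g. Abs_poly (\<lambda>i. if i < n then g i else 0)) \<in> ?P \<rightarrow> polys_below n"
      by (auto simp: polys_below_def c)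
    show "Abs_poly (\<lambda>i. if i < n then restrict (coeff x) {..<n} i else 0) = x"
      if "x \<in> polys_below n" for x :: "'a poly"
      using that by (intro poly_eqI) (auto simp: polys_below_def c)
    show "restrict (coeff (Abs_poly (\<lambda>i. if i < n then y i else 0))) {..<n} = y" if "y \<in> ?P" for y
      using that by (auto simp: c PiE_def extensional_def restrict_def)
  qed (auto simp: polys_below_def)
  moreover have "finite ?P" by (intro finite_PiE) auto
  ultimately show "finite (polys_below n :: 'a poly set)" "card (polys_below n :: 'a poly set) = CARD('a) ^ n"
    using bij_betw_finite bij_betw_same_card by (blast, fastforce simp: card_PiE)
qed

lemma polys_below_iff_degree: "f \<in> polys_below n \<longleftrightarrow> f = 0 \<or> degree f < n"
  unfolding polys_below_def using leading_coeff_0_iff[of f] by (force simp: coeff_eq_0 not_le[symmetric])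

lemma card_monic_polys:
  "card (monic_polys n :: 'a::finite_field poly set) = CARD('a) ^ n"
proof -
  have "bij_betw (\<lambda>f. f + monom 1 n) (polys_below n) (monic_polys n :: 'a poly set)"
  proof (rule bij_betwI[where g = "\<lambda>f. f - monom 1 n"])
    show "(\<lambda>f. f + monom 1 n) \<in> polys_below n \<rightarrow> (monic_polys n :: 'a poly set)"
    proof
      fix f :: "'a poly" assume f: "f \<in> polys_below n"
      have "degree (f + monom 1 n) = n"
      proof (rule antisym)
        show "degree (f + monom 1 n) \<le> n"
          using f by (intro degree_le) (auto simp: polys_below_def)
        show "n \<le> degree (f + monom 1 n)"
          using f by (intro le_degree) (auto simp: polys_below_def)
      qed
      then show "f + monom 1 n \<in> monic_polys n"
        using f by (auto simp: monic_polys_def polys_below_def)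
    qed
    show "(\<lambda>f. f - monom 1 n) \<in> (monic_polys n :: 'a poly set) \<rightarrow> polys_below n"
      by (auto simp: monic_polys_def polys_below_def coeff_eq_0)
  qed auto
  then show ?thesis using bij_betw_same_card card_polys_below(2) by metis
qed

section \<open>Roots of irreducible polynomials\<close>

text \<open>The polynomial \<open>m\<close> of least degree vanishing at \<open>x\<close> divides
  every polynomial that vanishes there; an irreducible one among these is associated to
  \<open>m\<close>.\<close>

lemma irreducible_dvd_if_common_root:
  fixes P g :: "'a::field poly"
  assumes irr: "irreducible P" and P: "ev P x = 0" and g: "ev g x = 0"
  shows "P dvd g"
proof -
  have P0: "P \<noteq> 0" using irr by auto
  define m where "m = arg_min degree (\<lambda>f. f \<noteq> 0 \<and> ev f x = 0)"
  have m: "m \<noteq> 0" "ev m x = 0" and min: "\<And>f. f \<noteq> 0 \<Longrightarrow> ev f x = 0 \<Longrightarrow> degree m \<le> degree f"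
    unfolding m_def using arg_min_nat_lemma[of "\<lambda>f. f \<noteq> 0 \<and> ev f x = 0" P degree] P P0 by auto
  have dvd: "m dvd f" if "ev f x = 0" for f
  proof -
    have "ev f x = ev (f div m * m + f mod m) x" by simp
    then have "ev (f mod m) x = 0" using that m(2) by (simp only: ev_add ev_mult) simp
    then have "f mod m = 0" using min[of "f mod m"] degree_mod_less[OF m(1), of f] by force
    then show ?thesis by (simp add: dvd_eq_mod_eq_0)
  qed
  obtain c where c: "P = m * c" using dvd[OF P] by auto
  have "\<not> is_unit m"
  proof
    assume "is_unit m"
    then have "degree m = 0" using m(1) by (simp add: is_unit_iff_degree)
    then obtain a where "m = [:a:]" by (rule degree_eq_zeroE)
    then show False using m by simp
  qed
  then have "is_unit c" using irr c irreducibleD by blast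
  then have "P dvd m" using c by simp
  then show ?thesis using dvd[OF g] dvd_trans by blast
qed

definition monic_irreducible :: "'a::field poly \<Rightarrow> bool" where
  "monic_irreducible P \<longleftrightarrow> lead_coeff P = 1 \<and> irreducible P"

lemma monic_irreducible_degree_pos: "monic_irreducible P \<Longrightarrow> degree P > 0"
  using is_unit_iff_degree[of P] unfolding monic_irreducible_def irreducible_def by auto

definition root_of :: "'a::field poly \<Rightarrow> 'a alg_closure" where
  "root_of P = (SOME x. ev P x = 0)"

lemma ev_root_of: "degree P > 0 \<Longrightarrow> ev P (root_of P) = 0"
  unfolding root_of_def by (rule someI_ex) (use ev_root_exists in blast)

lemma monic_irreducible_dvd_iff:
  assumes "monic_irreducible P" "ev P x = 0"
  shows "P dvd g \<longleftrightarrow> ev g x = 0"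
  using assms irreducible_dvd_if_common_root[of P x g] by (auto simp: monic_irreducible_def dvd_def)

lemma monic_irreducible_dvd_iff_root_of:
  assumes "monic_irreducible P"
  shows "P dvd g \<longleftrightarrow> ev g (root_of P) = 0"
  using monic_irreducible_dvd_iff assms ev_root_of monic_irreducible_degree_pos by blast

lemma map_poly_frobenius_mult:
  fixes f g :: "'a::finite_field alg_closure poly"
  defines "\<phi> \<equiv> map_poly (\<lambda>x. x ^ CARD('a))"
  shows "\<phi> (f * g) = \<phi> f * \<phi> g"
  using frobenius_sum[where n = 1]
  by (intro poly_eqI) (simp add: \<phi>_def coeff_map_poly coeff_mult power_mult_distrib zero_power frobenius_sum[where n = 1, simplified])

lemma map_poly_frobenius_prod:
  fixes f :: "'i \<Rightarrow> 'a::finite_field alg_closure poly"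
  defines "\<phi> \<equiv> map_poly (\<lambda>x. x ^ CARD('a))"
  shows "\<phi> (\<Prod>i\<in>A. f i) = (\<Prod>i\<in>A. \<phi> (f i))"
proof (induction A rule: infinite_finite_induct)
  case (insert x F)
  then show ?case by (simp add: \<phi>_def map_poly_frobenius_mult)
qed (simp_all add: \<phi>_def)

lemma lead_coeff_linear_prod:
  fixes a :: "'i \<Rightarrow> 'b::idom"
  shows "lead_coeff (\<Prod>i\<in>A. [:a i, 1:]) = 1" and "degree (\<Prod>i\<in>A. [:a i, 1:]) = card A"
proof -
  show l: "lead_coeff (\<Prod>i\<in>A. [:a i, 1:]) = 1" by (simp add: lead_coeff_prod)
  show "degree (\<Prod>i\<in>A. [:a i, 1:]) = card A"
    by (subst degree_prod_eq_sum_degree) auto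
qed

lemma monic_dvd_imp_eq:
  fixes f g :: "'a::field poly"
  assumes "f dvd g" "lead_coeff f = 1" "lead_coeff g = 1" "degree g \<le> degree f"
  shows "f = g"
proof -
  obtain c where c: "g = f * c" using assms by auto
  have nz: "f \<noteq> 0" "c \<noteq> 0" using assms c by auto
  then have "degree c = 0" using assms(4) c by (simp add: degree_mult_eq)
  moreover have "lead_coeff c = 1" using assms c by (simp add: lead_coeff_mult)
  ultimately have "c = 1" using degree_0_id[of c] by (metis of_nat_1 one_pCons)
  then show ?thesis using c by simp
qed

text \<open>The product over one Frobenius orbit has coefficients in the base field, so it is \<open>P\<close>.\<close>

lemma monic_irreducible_conjugates:
  fixes P :: "'a::finite_field poly"
  assumes P: "monic_irreducible P" and x: "ev P x = 0"
  shows "inj_on (\<lambda>i. x ^ (CARD('a) ^ i)) {..<degree P}"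
    and "ev P y = (\<Prod>i<degree P. y - x ^ (CARD('a) ^ i))"
    and "x \<in> fixed_field n \<longleftrightarrow> degree P dvd n"
proof -
  let ?q = "CARD('a)"
  define O' where "O' i = x ^ (?q ^ i)" for i
  have P0: "P \<noteq> 0" using P by (auto simp: monic_irreducible_def)
  have root: "ev P (O' i) = 0" for i
    using ev_frobenius[of P x i] x by (simp add: O'_def zero_power)
  have O'_add: "O' (i + j) = O' j ^ (?q ^ i)" for i j
    unfolding O'_def power_mult[symmetric] power_add by (simp only: mult.commute)
  \<comment> \<open>Injectivity of the Frobenius map makes the orbit purely periodic: a repetition
    anywhere is a return to \<open>x\<close> itself.\<close>
  have period: "x \<in> fixed_field k" if "O' i = O' (i + k)" for i k
  proof -
    have "x ^ (?q ^ i) = O' k ^ (?q ^ i)" using that unfolding O'_add by (simp only: O'_def[of i])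
    then have "x = O' k" by (rule frobenius_inj)
    then show ?thesis unfolding O'_def fixed_field_def by simp
  qed
  have "range O' \<subseteq> {y. ev P y = 0}" using root by auto
  then have "finite (range O')" using card_ev_roots(1)[OF P0] finite_subset by blast
  then have "\<not> inj O'" using finite_imageD infinite_UNIV_nat by blast
  then obtain i j where "O' i = O' j" "i < j" by (metis linorder_injI)
  then have "x \<in> fixed_field (j - i) \<and> j - i > 0" using period[of i "j - i"] by simp
  then have ex: "\<exists>k. x \<in> fixed_field k \<and> k > 0" by blast
  define e where "e = (LEAST k. x \<in> fixed_field k \<and> k > 0)"
  have e: "x \<in> fixed_field e" "e > 0" using LeastI_ex[OF ex] by (auto simp: e_def)
  have least: "k = 0" if "x \<in> fixed_field k" "k < e" for k
    using not_less_Least[of k "\<lambda>k. x \<in> fixed_field k \<and> k > 0"] that by (auto simp: e_def)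
  have inj: "inj_on O' {..<e}"
  proof (rule linorder_inj_onI)
    fix i j assume ij: "i < j" "i \<in> {..<e}" "j \<in> {..<e}"
    show "O' i \<noteq> O' j"
      using period[of i "j - i"] least[of "j - i"] ij less_imp_diff_less[of j e i] by auto
  qed auto
  define M where "M = (\<Prod>i<e. [:- O' i, 1:])"
  have "map_poly (\<lambda>x. x ^ ?q) [:- O' i, 1:] = [:- O' (Suc i), 1:]" for i
    using frobenius_minus[of "O' i" 1] O'_add[of 1 i] by (simp add: map_poly_pCons zero_power)
  then have "map_poly (\<lambda>x. x ^ ?q) M = (\<Prod>i<e. [:- O' (Suc i), 1:])"
    unfolding M_def by (subst map_poly_frobenius_prod) simp
  also have "\<dots> = M"
  proof -
    define G where "G i = [:- O' i, 1:]" for i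
    have "O' e = O' 0" using e(1) by (simp add: O'_def fixed_field_def)
    then have Ge: "G e = G 0" by (simp add: G_def)
    have "G 0 * (\<Prod>i<e. G (Suc i)) = (\<Prod>i<Suc e. G i)" by (simp only: prod.lessThan_Suc_shift)
    also have "\<dots> = G 0 * (\<Prod>i<e. G i)" by (simp add: Ge mult.commute)
    moreover have "G 0 \<noteq> 0" by (simp add: G_def)
    ultimately have "(\<Prod>i<e. G (Suc i)) = (\<Prod>i<e. G i)" by (metis mult_left_cancel)
    then show ?thesis by (simp only: G_def M_def)
  qed
  finally have Mfix: "coeff M i ^ ?q = coeff M i" for i
    using coeff_map_poly[of "\<lambda>x. x ^ ?q" M i] by (simp add: zero_power)
  have "coeff M i \<in> range to_ac" for i
    unfolding fixed_field_1[symmetric] using Mfix by (simp add: fixed_field_def)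
  define m where "m = map_poly of_ac M"
  have M: "M = map_poly to_ac m"
    by (rule poly_eqI) (simp add: m_def coeff_map_poly to_ac_of_ac[OF \<open>coeff M _ \<in> range to_ac\<close>])
  have ev_m: "ev m y = (\<Prod>i<e. y - O' i)" for y
    by (simp add: ev_def M[symmetric] M_def poly_prod)
  have "degree M = degree m" unfolding M by (rule degree_map_poly) simp
  then have deg_m: "degree m = e" using lead_coeff_linear_prod(2)[of "\<lambda>i. - O' i" "{..<e}"] by (simp add: M_def)
  have "to_ac (lead_coeff m) = lead_coeff M"
    using \<open>degree M = degree m\<close> by (simp add: M coeff_map_poly)
  then have lc_m: "lead_coeff m = 1" using lead_coeff_linear_prod(1)[of "\<lambda>i. - O' i" "{..<e}"]
    by (simp add: M_def)
  have "ev m x = 0" unfolding ev_m using e(2) by (auto simp: O'_def intro!: bexI[of _ 0])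
  then have "P dvd m" using monic_irreducible_dvd_iff[OF P x] by simp
  moreover have "e \<le> degree P"
  proof -
    have "e = card (O' ` {..<e})" using inj by (simp add: card_image)
    also have "\<dots> \<le> card {y. ev P y = 0}" using root card_ev_roots(1)[OF P0] by (intro card_mono) auto
    finally show ?thesis using card_ev_roots(2)[OF P0] by simp
  qed
  ultimately have "P = m" using P lc_m deg_m by (intro monic_dvd_imp_eq) (auto simp: monic_irreducible_def)
  then have deg: "degree P = e" using deg_m by simp
  show "inj_on (\<lambda>i. x ^ (CARD('a) ^ i)) {..<degree P}" using inj by (simp add: deg inj_on_def O'_def)
  show "ev P y = (\<Prod>i<degree P. y - x ^ (CARD('a) ^ i))"
    using ev_m[of y] \<open>P = m\<close> by (simp add: deg_m O'_def)
  have mult: "O' (e * k) = x" for k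
  proof (induction k)
    case (Suc k)
    then show ?case using O'_add[of e "e * k"] e(1) by (simp add: fixed_field_def)
  qed (simp add: O'_def)
  have "x \<in> fixed_field n \<longleftrightarrow> x \<in> fixed_field (n mod e)"
  proof -
    have "O' n = O' (n mod e + e * (n div e))" by simp
    also have "\<dots> = O' (n mod e)" unfolding O'_add mult by (simp add: O'_def)
    finally show ?thesis by (simp add: fixed_field_def O'_def)
  qed
  also have "\<dots> \<longleftrightarrow> n mod e = 0"
    using least[of "n mod e"] e(2) by (auto simp: fixed_field_def)
  finally show "x \<in> fixed_field n \<longleftrightarrow> degree P dvd n" by (simp add: deg dvd_eq_mod_eq_0)
qed

lemma monic_irreducible_roots:
  fixes P :: "'a::finite_field poly"
  assumes P: "monic_irreducible P"
  shows "card {x. ev P x = 0} = degree P"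
    and "ev P y = (\<Prod>x\<in>{x. ev P x = 0}. y - x)"
proof -
  let ?f = "\<lambda>i. root_of P ^ (CARD('a) ^ i)"
  have r: "ev P (root_of P) = 0" using P ev_root_of monic_irreducible_degree_pos by blast
  note c = monic_irreducible_conjugates[OF P r]
  have "{x. ev P x = 0} = ?f ` {..<degree P}"
    unfolding c(2) by auto
  then have b: "bij_betw ?f {..<degree P} {x. ev P x = 0}" using c(1) by (simp add: bij_betw_def)
  show "card {x. ev P x = 0} = degree P" using bij_betw_same_card[OF b] by simp
  show "ev P y = (\<Prod>x\<in>{x. ev P x = 0}. y - x)"
    using prod.reindex_bij_betw[OF b, of "\<lambda>x. y - x"] c(2)[of y] by simp
qed

lemma exists_monic_irreducible:
  fixes x :: "'a::field alg_closure"
  obtains P :: "'a poly" where "monic_irreducible P" "ev P x = 0"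
proof -
  obtain p :: "'a poly" where p: "p \<noteq> 0" "ev p x = 0"
    using alg_closure_algebraic[of x] by (auto simp: ev_def)
  define m where "m = arg_min degree (\<lambda>f. f \<noteq> 0 \<and> ev f x = 0)"
  have m: "m \<noteq> 0" "ev m x = 0" and min: "\<And>f. f \<noteq> 0 \<Longrightarrow> ev f x = 0 \<Longrightarrow> degree m \<le> degree f"
    unfolding m_def using arg_min_nat_lemma[of "\<lambda>f. f \<noteq> 0 \<and> ev f x = 0" p degree] p by auto
  define P where "P = smult (inverse (lead_coeff m)) m"
  have P: "P \<noteq> 0" "ev P x = 0" "degree P = degree m" "lead_coeff P = 1" using m by (auto simp: P_def)
  have "irreducible P"
  proof (rule irreducibleI)
    show "\<not> is_unit P"
    proof
      assume "is_unit P"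
      then have "degree P = 0" using P(1) by (simp add: is_unit_iff_degree)
      then obtain a where "P = [:a:]" by (rule degree_eq_zeroE)
      then show False using P by simp
    qed
    fix a b assume ab: "P = a * b"
    then have nz: "a \<noteq> 0" "b \<noteq> 0" using P by auto
    have "ev a x = 0 \<or> ev b x = 0" using P ab by simp
    then have "degree P \<le> degree a \<or> degree P \<le> degree b" using min nz P(3) by auto
    moreover have "degree P = degree a + degree b" using ab nz by (simp add: degree_mult_eq)
    ultimately have "degree b = 0 \<or> degree a = 0" by auto
    then show "is_unit a \<or> is_unit b" using nz by (auto simp: is_unit_iff_degree)
  qed (use P in auto)
  then have "monic_irreducible P" using P by (simp add: monic_irreducible_def)
  moreover have "ev P x = 0" using P by simp
  ultimately show ?thesis using that by blast
qed

lemma monic_irreducible_unique: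
  assumes "monic_irreducible P" "monic_irreducible Q" "ev P x = 0" "ev Q x = 0"
  shows "P = Q"
proof -
  have "P dvd Q" "Q dvd P" using assms monic_irreducible_dvd_iff by blast+
  then show ?thesis using assms
    by (intro monic_dvd_imp_eq) (auto simp: monic_irreducible_def intro!: dvd_imp_degree_le)
qed

lemma monic_irreducible_mult_dvd_iff:
  assumes "monic_irreducible P"
  shows "P dvd f * g \<longleftrightarrow> P dvd f \<or> P dvd g"
  using monic_irreducible_dvd_iff_root_of[OF assms] by simp

lemma monic_irreducible_dvd_monic_irreducible:
  assumes "monic_irreducible P" "monic_irreducible Q" "P dvd Q"
  shows "P = Q"
  using assms monic_irreducible_unique monic_irreducible_dvd_iff_root_of ev_root_of monic_irreducible_degree_pos
  by metis

text \<open>Residues of degree below \<open>degree P\<close> take distinct values at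
  \<open>x\<close>, all of them in the field with \<open>CARD('a) ^ degree P\<close> elements, and
  there are just as many of them. This identifies the residue field of \<open>P\<close>.\<close>

lemma fixed_field_eq_range_ev:
  fixes P :: "'a::finite_field poly"
  assumes P: "monic_irreducible P" and r: "ev P x = 0"
  shows "fixed_field (degree P) = range (\<lambda>g. ev g x)"
proof -
  let ?ev = "\<lambda>g. ev g x" and ?d = "degree P"
  have d: "?d > 0" using P by (rule monic_irreducible_degree_pos)
  have inj: "inj_on ?ev (polys_below ?d)"
  proof (rule inj_onI)
    fix f g :: "'a poly" assume fg: "f \<in> polys_below ?d" "g \<in> polys_below ?d" "?ev f = ?ev g"
    then have "P dvd f - g" using monic_irreducible_dvd_iff[OF P r] by simp
    moreover have "f - g \<in> polys_below ?d" using fg by (auto simp: polys_below_def)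
    ultimately show "f = g" using dvd_imp_degree_le[of P "f - g"] by (fastforce simp: polys_below_iff_degree)
  qed
  have mem: "?ev g \<in> fixed_field ?d" for g
    by (rule fixed_field_ev) (simp add: monic_irreducible_conjugates(3)[OF P r])
  have "?ev ` polys_below ?d = fixed_field ?d"
    using mem by (intro card_subset_eq) (auto simp: card_fixed_field[OF d] card_image[OF inj] card_polys_below)
  then have "fixed_field ?d \<subseteq> range ?ev" by blast
  then show ?thesis using mem by blast
qed

section \<open>Quadratic symbols and reciprocity\<close>

lemma minus_one_neq_one_alg_closure:
  assumes "odd CARD('a::finite_field)"
  shows "(1 :: 'a alg_closure) \<noteq> - 1"
proof
  assume "(1 :: 'a alg_closure) = - 1"
  then have two: "(2 :: 'a alg_closure) = 0"
    by (metis add.right_inverse one_add_one)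
  have "of_nat (CARD('a)) = (0::'a)"
    using binomial_CARD_eq_0[where 'a='a and k=1] CARD_ge_2[where 'a='a] by simp
  then have "of_nat (CARD('a)) = (0::'a alg_closure)" by (metis to_ac_0 to_ac_of_nat)
  moreover obtain m where "CARD('a) = 2 * m + 1" using assms by (elim oddE)
  ultimately show False using two by simp
qed

text \<open>Identities between symbols are proved in the algebraic closure, where Euler's criterion
  and products over roots live. Odd characteristic keeps the values \<open>-1\<close>,
  \<open>0\<close>, \<open>1\<close> apart there, so they can be carried back to the
  integers.\<close>

lemma of_int_sign_inj:
  assumes "odd CARD('a::finite_field)" "\<bar>a\<bar> \<le> 1" "\<bar>b\<bar> \<le> 1" "(of_int a :: 'a alg_closure) = of_int b"
  shows "a = b"
proof -
  have "a \<in> {-1, 0, 1}" "b \<in> {-1, 0, 1}" using assms(2,3) by auto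
  then show ?thesis using assms(4) minus_one_neq_one_alg_closure[OF assms(1)] by auto
qed

text \<open>A square root \<open>z\<close> of \<open>y = ev D x\<close> always exists in the
  closure, and \<open>z ^ Q = z * y ^ e\<close> with \<open>e = (Q - 1) / 2\<close>. Hence
  \<open>z\<close> lies in the residue field exactly when \<open>y ^ e = 1\<close>, for nonzero
  \<open>y\<close>.\<close>

theorem euler_criterion:
  fixes P :: "'a::finite_field poly"
  assumes q: "odd CARD('a)" and P: "monic_irreducible P" and x: "ev P x = 0"
  shows "of_int (poly_legendre D P) = ev D x ^ ((CARD('a) ^ degree P - 1) div 2)"
proof -
  let ?Q = "CARD('a) ^ degree P" and ?y = "ev D x"
  define e where "e = (?Q - 1) div 2"
  have d: "degree P > 0" using P by (rule monic_irreducible_degree_pos)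
  have Q1: "?Q > 1" using CARD_ge_2[where 'a='a] d by (intro one_less_power) auto
  have "odd ?Q" using q by simp
  then have Qe: "?Q = Suc (2 * e)" using Q1 unfolding e_def by (elim oddE) simp
  then have e: "e > 0" using Q1 by linarith
  note F = fixed_field_eq_range_ev[OF P x]
  have pw: "z ^ (2 * e) = 1" if "z \<in> fixed_field (degree P)" "z \<noteq> 0" for z :: "'a alg_closure"
  proof -
    have "z * z ^ (2 * e) = z * 1" using that(1) by (simp only: fixed_field_def Qe mem_Collect_eq power_Suc mult_1_right)
    then show ?thesis using that(2) by simp
  qed
  have "?y \<in> fixed_field (degree P)" unfolding F by blast
  have "of_int (poly_legendre D P) = ?y ^ e"
  proof (cases "?y = 0")
    case True
    then show ?thesis using e monic_irreducible_dvd_iff[OF P x] by (simp add: poly_legendre_def zero_power)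
  next
    case False
    then have ndvd: "\<not> P dvd D" using monic_irreducible_dvd_iff[OF P x] by simp
    have "(\<exists>h. [h ^ 2 = D] (mod P)) \<longleftrightarrow> (\<exists>h. ev h x ^ 2 = ?y)"
      by (simp add: cong_iff_dvd_diff monic_irreducible_dvd_iff[OF P x])
    also have "\<dots> \<longleftrightarrow> (\<exists>z\<in>fixed_field (degree P). z ^ 2 = ?y)" unfolding F by auto
    also have "\<dots> \<longleftrightarrow> ?y ^ e = 1"
    proof
      assume "\<exists>z\<in>fixed_field (degree P). z ^ 2 = ?y"
      then obtain z where z: "z \<in> fixed_field (degree P)" "z ^ 2 = ?y" by blast
      then have "z \<noteq> 0" using False by auto
      then show "?y ^ e = 1" using pw[OF z(1)] z(2) by (simp add: power_mult)
    next
      assume y: "?y ^ e = 1"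
      obtain z where z: "z ^ 2 = ?y" using nth_root_exists[of 2 ?y] by auto
      have "z ^ ?Q = z * (z ^ 2) ^ e" by (simp only: Qe power_Suc power_mult)
      then have "z \<in> fixed_field (degree P)" using y z by (simp only: fixed_field_def mem_Collect_eq) simp
      then show "\<exists>z\<in>fixed_field (degree P). z ^ 2 = ?y" using z by blast
    qed
    finally have iff: "(\<exists>h. [h ^ 2 = D] (mod P)) \<longleftrightarrow> ?y ^ e = 1" .
    have "(?y ^ e) ^ 2 = 1" using pw[OF \<open>?y \<in> _\<close> False] by (simp add: mult.commute flip: power_mult)
    then have "?y ^ e = 1 \<or> ?y ^ e = - 1" by (simp add: power2_eq_1_iff)
    then show ?thesis using iff ndvd by (auto simp: poly_legendre_def)
  qed
  then show ?thesis by (simp only: e_def)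
qed

lemma poly_legendre_mult:
  fixes P :: "'a::finite_field poly"
  assumes q: "odd CARD('a)" and P: "monic_irreducible P"
  shows "poly_legendre (f * g) P = poly_legendre f P * poly_legendre g P"
proof (rule of_int_sign_inj[OF q])
  have r: "ev P (root_of P) = 0" using P ev_root_of monic_irreducible_degree_pos by blast
  show "of_int (poly_legendre (f * g) P) = (of_int (poly_legendre f P * poly_legendre g P) :: 'a alg_closure)"
    by (simp add: euler_criterion[OF q P r] power_mult_distrib)
  show "\<bar>poly_legendre f P * poly_legendre g P\<bar> \<le> 1"
    using abs_poly_legendre_le_1[of f P] abs_poly_legendre_le_1[of g P] by (simp add: abs_mult mult_le_one)
qed (rule abs_poly_legendre_le_1)

lemma poly_legendre_cong:
  fixes P :: "'a::finite_field poly"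
  assumes q: "odd CARD('a)" and P: "monic_irreducible P" and "P dvd f - g"
  shows "poly_legendre f P = poly_legendre g P"
proof (rule of_int_sign_inj[OF q])
  have r: "ev P (root_of P) = 0" using P ev_root_of monic_irreducible_degree_pos by blast
  then have "ev f (root_of P) = ev g (root_of P)" using monic_irreducible_dvd_iff[OF P r] assms(3) by simp
  then show "of_int (poly_legendre f P) = (of_int (poly_legendre g P) :: 'a alg_closure)"
    by (simp add: euler_criterion[OF q P r])
qed (rule abs_poly_legendre_le_1)+

lemma poly_legendre_1:
  fixes P :: "'a::finite_field poly"
  assumes P: "monic_irreducible P"
  shows "poly_legendre 1 P = 1"
proof -
  have "\<not> P dvd 1" using P by (auto simp: monic_irreducible_def irreducible_def)
  moreover have "\<exists>h. [h ^ 2 = 1] (mod P)" by (rule exI[of _ 1]) simp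
  ultimately show ?thesis by (simp add: poly_legendre_def)
qed

lemma poly_legendre_prod:
  fixes P :: "'a::finite_field poly"
  assumes q: "odd CARD('a)" and P: "monic_irreducible P"
  shows "poly_legendre (\<Prod>i\<in>A. f i) P = (\<Prod>i\<in>A. poly_legendre (f i) P)"
  by (induction A rule: infinite_finite_induct) (auto simp: poly_legendre_1[OF P] poly_legendre_mult[OF q P])

text \<open>The exponent of Euler's criterion factors as \<open>(q - 1) / 2\<close> times
  \<open>1 + q + ... + q^(d - 1)\<close>, and raising to the second factor is the norm, the product
  over all conjugates. This form of the symbol is what becomes symmetric in the two
  polynomials.\<close>

lemma poly_legendre_eq_norm:
  fixes P :: "'a::finite_field poly"
  assumes q: "odd CARD('a)" and P: "monic_irreducible P"
  shows "of_int (poly_legendre D P) = (\<Prod>z\<in>{z. ev P z = 0}. ev D z) ^ ((CARD('a) - 1) div 2)"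
proof -
  let ?q = "CARD('a)" and ?d = "degree P" and ?x = "root_of P"
  have r: "ev P (root_of P) = 0" using P ev_root_of monic_irreducible_degree_pos by blast
  note c = monic_irreducible_conjugates[OF P r]
  have "{x. ev P x = 0} = (\<lambda>i. ?x ^ (?q ^ i)) ` {..<?d}"
    unfolding c(2) by auto
  then have b: "bij_betw (\<lambda>i. ?x ^ (?q ^ i)) {..<?d} {x. ev P x = 0}" using c(1) by (simp add: bij_betw_def)
  have "(\<Prod>z\<in>{z. ev P z = 0}. ev D z) = (\<Prod>i<?d. ev D ?x ^ (?q ^ i))"
    using prod.reindex_bij_betw[OF b, of "ev D"] by (simp add: ev_frobenius)
  also have "\<dots> = ev D ?x ^ (\<Sum>i<?d. ?q ^ i)" by (simp add: power_sum)
  finally have *: "(\<Prod>z\<in>{z. ev P z = 0}. ev D z) ^ ((?q - 1) div 2) = ev D ?x ^ ((\<Sum>i<?d. ?q ^ i) * ((?q - 1) div 2))"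
    by (simp add: power_mult)
  have "(\<Sum>i<?d. ?q ^ i) * (?q - 1) = ?q ^ ?d - 1"
  proof -
    have "(\<Sum>i<?d. int ?q ^ i) * (int ?q - 1) = int ?q ^ ?d - 1"
      using power_diff_1_eq[of "int ?q" ?d] by (simp add: mult.commute)
    then have "int ((\<Sum>i<?d. ?q ^ i) * (?q - 1)) = int (?q ^ ?d - 1)"
      using CARD_ge_2[where 'a='a] by (simp add: of_nat_diff)
    then show ?thesis by (simp only: of_nat_eq_iff)
  qed
  moreover have "?q - 1 = 2 * ((?q - 1) div 2)" using q by simp
  ultimately have "(\<Sum>i<?d. ?q ^ i) * ((?q - 1) div 2) = (?q ^ ?d - 1) div 2"
    by (metis div_mult_swap even_diff_nat dvd_triv_left)
  then show ?thesis using euler_criterion[OF q P r, of D] * by simp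
qed

definition recip_sign :: "nat \<Rightarrow> nat \<Rightarrow> nat \<Rightarrow> int" where
  "recip_sign q a b = (-1) ^ ((q - 1) div 2 * (a * b))"

text \<open>Both symbols are the power with exponent \<open>(q - 1) / 2\<close> of a resultant, the
  product of the differences \<open>z - w\<close> over all pairs of roots. Exchanging the
  polynomials changes the sign of each of the \<open>degree P * degree Q\<close> factors.\<close>

theorem quadratic_reciprocity_poly:
  fixes P Q :: "'a::finite_field poly"
  assumes q: "odd CARD('a)" and P: "monic_irreducible P" and Q: "monic_irreducible Q"
  shows "poly_legendre P Q = recip_sign CARD('a) (degree P) (degree Q) * poly_legendre Q P"
proof (rule of_int_sign_inj[OF q])
  let ?RP = "{z. ev P z = 0}" and ?RQ = "{z. ev Q z = 0}"
  let ?h = "(CARD('a) - 1) div 2"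
  have nz: "P \<noteq> 0" "Q \<noteq> 0" using P Q by (auto simp: monic_irreducible_def)
  note fin = card_ev_roots(1)[OF nz(1)] card_ev_roots(1)[OF nz(2)]
  have "(\<Prod>z\<in>?RQ. ev P z) = (\<Prod>z\<in>?RQ. \<Prod>w\<in>?RP. z - w)"
    by (intro prod.cong refl monic_irreducible_roots(2)[OF P])
  also have "\<dots> = (\<Prod>w\<in>?RP. \<Prod>z\<in>?RQ. z - w)" by (rule prod.swap)
  also have "\<dots> = (\<Prod>w\<in>?RP. \<Prod>z\<in>?RQ. - 1 * (w - z))" by simp
  also have "\<dots> = (\<Prod>w\<in>?RP. (- 1) ^ card ?RQ * (\<Prod>z\<in>?RQ. w - z))"
    by (simp only: prod.distrib prod_constant)
  also have "\<dots> = (- 1) ^ (card ?RP * card ?RQ) * (\<Prod>w\<in>?RP. \<Prod>z\<in>?RQ. w - z)"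
    by (simp add: prod.distrib mult.commute flip: power_mult)
  also have "(\<Prod>w\<in>?RP. \<Prod>z\<in>?RQ. w - z) = (\<Prod>w\<in>?RP. ev Q w)"
    by (intro prod.cong refl monic_irreducible_roots(2)[OF Q, symmetric])
  finally have "(\<Prod>z\<in>?RQ. ev P z) ^ ?h = (- 1) ^ (?h * (degree P * degree Q)) * (\<Prod>w\<in>?RP. ev Q w) ^ ?h"
    by (simp add: power_mult_distrib monic_irreducible_roots(1)[OF P] monic_irreducible_roots(1)[OF Q] mult.commute flip: power_mult)
  then show "of_int (poly_legendre P Q) =
      (of_int (recip_sign CARD('a) (degree P) (degree Q) * poly_legendre Q P) :: 'a alg_closure)"
    by (simp add: poly_legendre_eq_norm[OF q P] poly_legendre_eq_norm[OF q Q] recip_sign_def)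
  show "\<bar>recip_sign CARD('a) (degree P) (degree Q) * poly_legendre Q P\<bar> \<le> 1"
    using abs_poly_legendre_le_1[of Q P] by (simp add: abs_mult recip_sign_def power_abs)
qed (rule abs_poly_legendre_le_1)

section \<open>Factorization and multiplicativity\<close>

definition monic_primes :: "'a::field poly \<Rightarrow> 'a poly set" where
  "monic_primes f = {P. monic_irreducible P \<and> P dvd f}"

definition pval :: "'a::field poly \<Rightarrow> 'a poly \<Rightarrow> nat" where
  "pval P f = Max {n. P ^ n dvd f}"

lemma finite_monic_primes:
  assumes "f \<noteq> (0::'a::finite_field poly)"
  shows "finite (monic_primes f)"
proof (rule finite_subset)
  show "monic_primes f \<subseteq> (\<Union>n\<le>degree f. monic_polys n)"
    using assms by (auto simp: monic_primes_def monic_irreducible_def monic_polys_def dvd_imp_degree_le)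
qed (simp add: monic_polys_finite_card)

lemma power_dvd_iff_le_pval:
  fixes f :: "'a::field poly"
  assumes P: "monic_irreducible P" and f: "f \<noteq> 0"
  shows "P ^ n dvd f \<longleftrightarrow> n \<le> pval P f"
proof -
  have d: "degree P > 0" using P by (rule monic_irreducible_degree_pos)
  have P0: "P \<noteq> 0" using d by auto
  have sub: "{n. P ^ n dvd f} \<subseteq> {..degree f}"
  proof safe
    fix n assume "P ^ n dvd f"
    then have "n * degree P \<le> degree f" using dvd_imp_degree_le[of "P ^ n" f] f P0 by (simp add: degree_power_eq)
    moreover have "n \<le> n * degree P" using d by simp
    ultimately show "n \<le> degree f" by linarith
  qed
  then have fin: "finite {n. P ^ n dvd f}" using finite_subset by blast
  have "0 \<in> {n. P ^ n dvd f}" by simp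
  then have "pval P f \<in> {n. P ^ n dvd f}" unfolding pval_def using fin Max_in by blast
  then have "P ^ pval P f dvd f" by simp
  then show ?thesis using Max_ge[OF fin, of n] dvd_trans[OF le_imp_power_dvd, of n "pval P f" P f]
    unfolding pval_def[symmetric] by auto
qed

lemma pvalI:
  assumes "monic_irreducible P" "f \<noteq> 0" "\<And>n. P ^ n dvd f \<longleftrightarrow> n \<le> m"
  shows "pval P f = m"
  using power_dvd_iff_le_pval[OF assms(1,2)] assms(3) by (metis order_antisym order_refl)

lemma pval_mult_same:
  assumes P: "monic_irreducible P" and f: "f \<noteq> 0"
  shows "pval P (P * f) = Suc (pval P f)"
proof (rule pvalI[OF P])
  have P0: "P \<noteq> 0" using P by (auto simp: monic_irreducible_def)
  then show "P * f \<noteq> 0" using f by simp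
  show "P ^ n dvd P * f \<longleftrightarrow> n \<le> Suc (pval P f)" for n
    using power_dvd_iff_le_pval[OF P f] P0 by (cases n) auto
qed

lemma pval_mult_other:
  assumes P: "monic_irreducible P" and Q: "monic_irreducible Q" and ne: "P \<noteq> Q" and f: "f \<noteq> 0"
  shows "pval P (Q * f) = pval P f"
proof (rule pvalI[OF P])
  have P0: "P \<noteq> 0" using P by (auto simp: monic_irreducible_def)
  have "\<not> P dvd Q" using monic_irreducible_dvd_monic_irreducible[OF P Q] ne by blast
  then have step: "P dvd Q * g \<longleftrightarrow> P dvd g" for g using monic_irreducible_mult_dvd_iff[OF P] by blast
  show "Q * f \<noteq> 0" using f Q by (auto simp: monic_irreducible_def)
  have "P ^ n dvd Q * f \<longleftrightarrow> P ^ n dvd f" for n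
  proof (induction n arbitrary: f)
    case (Suc n)
    show ?case
    proof
      assume A: "P ^ Suc n dvd Q * f"
      then have "P dvd Q * f" by (meson dvd_power dvd_trans zero_less_Suc)
      then obtain g where g: "f = P * g" using step by (auto elim: dvdE)
      have "P * P ^ n dvd P * (Q * g)" using A by (simp add: g mult.left_commute)
      then have "P ^ n dvd Q * g" using P0 by simp
      then show "P ^ Suc n dvd f" using Suc.IH P0 by (simp add: g)
    qed auto
  qed simp
  then show "P ^ n dvd Q * f \<longleftrightarrow> n \<le> pval P f" for n
    using power_dvd_iff_le_pval[OF P f] by simp
qed

lemma pval_eq_0:
  assumes "monic_irreducible P" "f \<noteq> 0" "\<not> P dvd f"
  shows "pval P f = 0"
  using power_dvd_iff_le_pval[OF assms(1,2), of 1] assms(3) by simp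

lemma monic_poly_induct [consumes 1, case_names one mult]:
  fixes f :: "'a::field poly"
  assumes "lead_coeff f = 1"
    and "Pr 1"
    and "\<And>Q g. monic_irreducible Q \<Longrightarrow> lead_coeff g = 1 \<Longrightarrow> Q * g dvd f \<Longrightarrow> Pr g \<Longrightarrow> Pr (Q * g)"
  shows "Pr f"
proof -
  have main: "Pr h" if "lead_coeff h = 1" "h dvd f" for h
    using that
  proof (induction "degree h" arbitrary: h rule: less_induct)
    case less
    show ?case
    proof (cases "degree h = 0")
      case True
      then have "h = 1" using less.prems degree_0_id[of h] by (metis of_nat_1 one_pCons)
      then show ?thesis using assms(2) by simp
    next
      case False
      then obtain x where x: "ev h x = 0" using ev_root_exists[of h] by auto
      obtain Q :: "'a poly" where Q: "monic_irreducible Q" "ev Q x = 0" by (rule exists_monic_irreducible)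
      then have "Q dvd h" using monic_irreducible_dvd_iff x by blast
      then obtain g where g: "h = Q * g" by auto
      have lc: "lead_coeff g = 1" using less.prems(1) Q(1) by (simp add: g lead_coeff_mult monic_irreducible_def)
      have nz: "Q \<noteq> 0" "g \<noteq> 0" using less.prems(1) g by auto
      have "degree g < degree h" using monic_irreducible_degree_pos[OF Q(1)] by (simp add: g degree_mult_eq nz)
      moreover have "g dvd f" using less.prems(2) g by (metis dvd_mult_right)
      ultimately have "Pr g" using less.hyps lc by blast
      then show ?thesis using assms(3)[OF Q(1) lc] less.prems(2) g by simp
    qed
  qed
  show ?thesis by (rule main[OF assms(1) dvd_refl])
qed

lemma monic_primes_1: "monic_primes (1::'a::field poly) = {}"
  by (auto simp: monic_primes_def monic_irreducible_def irreducible_def)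

lemma monic_primes_mult:
  assumes "monic_irreducible Q"
  shows "monic_primes (Q * f) = insert Q (monic_primes f)"
  using assms monic_irreducible_dvd_monic_irreducible[OF _ assms]
  by (auto simp: monic_primes_def monic_irreducible_mult_dvd_iff)

lemma quad_char_altdef:
  "quad_char D f = (\<Prod>P\<in>monic_primes f. poly_legendre D P ^ pval P f)"
  by (simp add: quad_char_def monic_primes_def monic_irreducible_def pval_def conj_assoc)

lemma prod_pval_mult:
  fixes F :: "'a::finite_field poly \<Rightarrow> 'c::comm_monoid_mult"
  assumes Q: "monic_irreducible Q" and f: "f \<noteq> 0"
  shows "(\<Prod>P\<in>monic_primes (Q * f). F P ^ pval P (Q * f)) = F Q * (\<Prod>P\<in>monic_primes f. F P ^ pval P f)"
proof -
  let ?S = "monic_primes f - {Q}"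
  note fin = finite_monic_primes[OF f]
  have "(\<Prod>P\<in>monic_primes (Q * f). F P ^ pval P (Q * f)) = F Q ^ pval Q (Q * f) * (\<Prod>P\<in>?S. F P ^ pval P (Q * f))"
    using fin by (simp add: monic_primes_mult[OF Q] prod.insert_remove)
  also have "\<dots> = F Q * (F Q ^ pval Q f * (\<Prod>P\<in>?S. F P ^ pval P f))"
  proof -
    have "(\<Prod>P\<in>?S. F P ^ pval P (Q * f)) = (\<Prod>P\<in>?S. F P ^ pval P f)"
      by (intro prod.cong refl) (auto simp: monic_primes_def pval_mult_other[OF _ Q _ f])
    then show ?thesis by (simp add: pval_mult_same[OF Q f] mult.assoc)
  qed
  also have "F Q ^ pval Q f * (\<Prod>P\<in>?S. F P ^ pval P f) = (\<Prod>P\<in>monic_primes f. F P ^ pval P f)"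
  proof (cases "Q \<in> monic_primes f")
    case True
    then show ?thesis using fin by (simp add: prod.remove)
  next
    case False
    then show ?thesis using pval_eq_0[OF Q f] Q by (simp add: monic_primes_def)
  qed
  finally show ?thesis .
qed

lemma quad_char_1: "quad_char D (1::'a::finite_field poly) = 1"
  by (simp add: quad_char_altdef monic_primes_1)

lemma quad_char_mult_prime:
  fixes f :: "'a::finite_field poly"
  assumes "monic_irreducible Q" "f \<noteq> 0"
  shows "quad_char D (Q * f) = poly_legendre D Q * quad_char D f"
  unfolding quad_char_altdef using prod_pval_mult[OF assms, of "poly_legendre D"] by simp

lemma quad_char_mult_prime_power:
  fixes f :: "'a::finite_field poly"
  assumes "monic_irreducible Q" "f \<noteq> 0"
  shows "quad_char D (Q ^ k * f) = poly_legendre D Q ^ k * quad_char D f"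
proof (induction k)
  case (Suc k)
  have "Q ^ k * f \<noteq> 0" using assms by (auto simp: monic_irreducible_def)
  then show ?case using Suc quad_char_mult_prime[OF assms(1), of "Q ^ k * f" D] by (simp add: mult.assoc)
qed simp

lemma monic_poly_eq_prod:
  fixes f :: "'a::finite_field poly"
  assumes "lead_coeff f = 1"
  shows "f = (\<Prod>P\<in>monic_primes f. P ^ pval P f)"
  using assms
proof (induction f rule: monic_poly_induct)
  case (mult Q g)
  then have "g \<noteq> 0" by auto
  then show ?case using prod_pval_mult[OF mult(1), of g "\<lambda>P. P"] mult by simp
qed (simp add: monic_primes_1)

lemma degree_monic_poly_eq_sum:
  fixes f :: "'a::finite_field poly"
  assumes "lead_coeff f = 1"
  shows "degree f = (\<Sum>P\<in>monic_primes f. pval P f * degree P)"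
proof -
  have nz: "P \<noteq> 0" if "P \<in> monic_primes f" for P using that by (auto simp: monic_primes_def monic_irreducible_def)
  have "degree f = degree (\<Prod>P\<in>monic_primes f. P ^ pval P f)"
    by (rule arg_cong[OF monic_poly_eq_prod[OF assms]])
  also have "\<dots> = (\<Sum>P\<in>monic_primes f. pval P f * degree P)"
    using nz by (subst degree_prod_eq_sum_degree) (auto simp: degree_power_eq)
  finally show ?thesis .
qed

lemma monic_squarefree_eq_prod:
  fixes D :: "'a::finite_field poly"
  assumes "lead_coeff D = 1" "squarefree D"
  shows "D = \<Prod>(monic_primes D)" "degree D = (\<Sum>P\<in>monic_primes D. degree P)"
proof -
  have D: "D \<noteq> 0" using assms by auto
  have one: "pval P D = 1" if "P \<in> monic_primes D" for P
  proof (rule antisym)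
    have P: "monic_irreducible P" "P dvd D" using that by (auto simp: monic_primes_def)
    show "1 \<le> pval P D" using power_dvd_iff_le_pval[OF P(1) D, of 1] P(2) by simp
    have "\<not> P ^ 2 dvd D" using assms(2) P(1) by (auto simp: squarefree_def monic_irreducible_def irreducible_def)
    then show "pval P D \<le> 1" using power_dvd_iff_le_pval[OF P(1) D, of 2] by simp
  qed
  have "(\<Prod>P\<in>monic_primes D. P ^ pval P D) = \<Prod>(monic_primes D)"
    using one by (intro prod.cong) simp_all
  then show "D = \<Prod>(monic_primes D)" by (rule trans[OF monic_poly_eq_prod[OF assms(1)]])
  show "degree D = (\<Sum>P\<in>monic_primes D. degree P)" using degree_monic_poly_eq_sum[OF assms(1)] one by simp
qed

text \<open>This turns the symbol with \<open>D\<close> on top into a character in \<open>f\<close>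
  that is periodic modulo \<open>D\<close>, so that its sum over all \<open>f\<close> of one degree
  falls under orthogonality.\<close>

lemma quad_char_reciprocity:
  fixes D f :: "'a::finite_field poly"
  assumes q: "odd CARD('a)" and D: "lead_coeff D = 1" "squarefree D" and f: "lead_coeff f = 1"
  shows "quad_char D f = recip_sign CARD('a) (degree D) (degree f) * (\<Prod>P\<in>monic_primes D. poly_legendre f P)"
  using f
proof (induction f rule: monic_poly_induct)
  case one
  have "(\<Prod>P\<in>monic_primes D. poly_legendre 1 P) = 1"
    by (rule prod.neutral) (auto simp: monic_primes_def poly_legendre_1)
  then show ?case by (simp add: quad_char_1 recip_sign_def)
next
  case (mult Q g)
  have g: "g \<noteq> 0" "Q \<noteq> 0" using mult by (auto simp: monic_irreducible_def)
  let ?s = "recip_sign CARD('a)"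
  have "poly_legendre D Q = (\<Prod>P\<in>monic_primes D. poly_legendre P Q)"
    unfolding poly_legendre_prod[OF q mult(1), symmetric]
    by (rule arg_cong[OF monic_squarefree_eq_prod(1)[OF D]])
  also have "\<dots> = (\<Prod>P\<in>monic_primes D. ?s (degree P) (degree Q) * poly_legendre Q P)"
    by (intro prod.cong refl quadratic_reciprocity_poly[OF q _ mult(1)]) (simp add: monic_primes_def)
  also have "\<dots> = (\<Prod>P\<in>monic_primes D. ?s (degree P) (degree Q)) * (\<Prod>P\<in>monic_primes D. poly_legendre Q P)"
    by (rule prod.distrib)
  also have "(\<Prod>P\<in>monic_primes D. ?s (degree P) (degree Q)) = ?s (degree D) (degree Q)"
    unfolding recip_sign_def monic_squarefree_eq_prod(2)[OF D]
    by (simp add: power_sum[symmetric] sum_distrib_left sum_distrib_right)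
  finally have leg: "poly_legendre D Q = ?s (degree D) (degree Q) * (\<Prod>P\<in>monic_primes D. poly_legendre Q P)" .
  have "quad_char D (Q * g) = (?s (degree D) (degree Q) * ?s (degree D) (degree g)) *
      ((\<Prod>P\<in>monic_primes D. poly_legendre Q P) * (\<Prod>P\<in>monic_primes D. poly_legendre g P))"
    by (simp add: quad_char_mult_prime[OF mult(1) g(1)] leg mult.IH mult_ac)
  also have "?s (degree D) (degree Q) * ?s (degree D) (degree g) = ?s (degree D) (degree (Q * g))"
    using g by (simp add: recip_sign_def degree_mult_eq distrib_left flip: power_add)
  also have "(\<Prod>P\<in>monic_primes D. poly_legendre Q P) * (\<Prod>P\<in>monic_primes D. poly_legendre g P)
      = (\<Prod>P\<in>monic_primes D. poly_legendre (Q * g) P)"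
    unfolding prod.distrib[symmetric]
    by (intro prod.cong refl poly_legendre_mult[OF q, symmetric]) (simp add: monic_primes_def)
  finally show ?case .
qed

section \<open>Orthogonality\<close>

text \<open>By division with remainder, monic polynomials of degree \<open>n \<ge> degree f\<close>
  are spread exactly evenly over the residues modulo \<open>f\<close>. This absence of an error term
  is what makes all later moment computations exact.\<close>

lemma sum_monic_polys_residues:
  fixes f :: "'a::finite_field poly" and \<psi> :: "'a poly \<Rightarrow> 'c::comm_semiring_1"
  assumes f: "lead_coeff f = 1" and n: "degree f \<le> n"
    and per: "\<And>a h. \<psi> (h * f + a) = \<psi> a"
  shows "(\<Sum>D\<in>monic_polys n. \<psi> D) = of_nat (CARD('a) ^ (n - degree f)) * (\<Sum>r\<in>polys_below (degree f). \<psi> r)"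
proof -
  let ?d = "degree f"
  have f0: "f \<noteq> 0" using f by auto
  have deg0: "degree (h * f + r) = degree h + ?d \<and> lead_coeff (h * f + r) = lead_coeff h"
    if "h \<noteq> 0" "r \<in> polys_below ?d" for h r
  proof -
    have "r = 0 \<or> degree r < degree (h * f)" using that f0 by (auto simp: polys_below_iff_degree degree_mult_eq)
    then have "degree (h * f + r) = degree (h * f)" by (auto simp: degree_add_eq_left)
    moreover from this have "coeff r (degree (h * f)) = 0"
      using \<open>r = 0 \<or> _\<close> by (auto simp: coeff_eq_0)
    ultimately show ?thesis using that f0 f by (simp add: degree_mult_eq lead_coeff_mult[symmetric] flip: degree_mult_eq)
       (simp add: degree_mult_eq coeff_mult_degree_sum)
  qed
  have deg: "degree (h * f + r) = degree h + ?d" "coeff (h * f + r) (degree h + ?d) = lead_coeff h"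
    if "h \<noteq> 0" "r \<in> polys_below ?d" for h r
    using deg0[OF that] by (auto simp del: coeff_add)
  have "bij_betw (\<lambda>(h, r). h * f + r) (monic_polys (n - ?d) \<times> polys_below ?d) (monic_polys n)"
  proof (rule bij_betwI[where g = "\<lambda>D. (D div f, D mod f)"])
    show "(\<lambda>(h, r). h * f + r) \<in> monic_polys (n - ?d) \<times> polys_below ?d \<rightarrow> monic_polys n"
    proof
      fix x assume "x \<in> (monic_polys (n - ?d) \<times> polys_below ?d :: ('a poly \<times> 'a poly) set)"
      then obtain h r where x: "x = (h, r)" "h \<in> monic_polys (n - ?d)" "r \<in> polys_below ?d" by auto
      then have "h \<noteq> 0" by (auto simp: monic_polys_def)
      then show "(\<lambda>(h, r). h * f + r) x \<in> monic_polys n"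
        using deg[of h r] x n by (auto simp: monic_polys_def simp del: coeff_add)
    qed
    show "(\<lambda>D. (D div f, D mod f)) \<in> monic_polys n \<rightarrow> monic_polys (n - ?d) \<times> polys_below ?d"
    proof
      fix D :: "'a poly" assume D: "D \<in> monic_polys n"
      have r: "D mod f \<in> polys_below ?d" using degree_mod_less[OF f0, of D] by (auto simp: polys_below_iff_degree)
      have D0: "D \<noteq> 0" using D by (auto simp: monic_polys_def)
      have h: "D div f \<noteq> 0"
      proof
        assume "D div f = 0"
        then have "D mod f = D" using div_mult_mod_eq[of D f] by simp
        then show False using r D n D0 by (auto simp: polys_below_iff_degree monic_polys_def)
      qed
      have "degree D = degree (D div f) + ?d" "lead_coeff D = lead_coeff (D div f)"
        using deg[OF h r] by (simp_all del: coeff_add)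
      then show "(D div f, D mod f) \<in> monic_polys (n - ?d) \<times> polys_below ?d"
        using D r by (auto simp: monic_polys_def)
    qed
    show "(\<lambda>D. (D div f, D mod f)) ((\<lambda>(h, r). h * f + r) x) = x"
      if "x \<in> monic_polys (n - ?d) \<times> polys_below ?d" for x
    proof -
      obtain h r where x: "x = (h, r)" "r \<in> polys_below ?d" using \<open>x \<in> _\<close> by auto
      then have "r div f = 0" "r mod f = r" by (auto simp: polys_below_iff_degree div_poly_less mod_poly_less)
      then show ?thesis using x f0 by simp
    qed
  qed auto
  note bij = this
  have "(\<Sum>D\<in>monic_polys n. \<psi> D) = (\<Sum>x\<in>monic_polys (n - ?d) \<times> polys_below ?d. \<psi> ((\<lambda>(h, r). h * f + r) x))"
    by (rule sum.reindex_bij_betw[OF bij, symmetric])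
  also have "\<dots> = (\<Sum>(h :: 'a poly, r)\<in>monic_polys (n - ?d) \<times> polys_below ?d. \<psi> r)"
    by (intro sum.cong refl) (auto simp: per)
  also have "\<dots> = (\<Sum>h\<in>(monic_polys (n - ?d) :: 'a poly set). \<Sum>r\<in>polys_below ?d. \<psi> r)"
    by (rule sum.cartesian_product[symmetric])
  also have "\<dots> = of_nat (CARD('a) ^ (n - ?d)) * (\<Sum>r\<in>polys_below ?d. \<psi> r)"
    by (simp add: card_monic_polys)
  finally show ?thesis .
qed

text \<open>Multiplication by \<open>E\<close> permutes the residues modulo \<open>f\<close> and
  changes the sign of every value of the character.\<close>

lemma char_sum_residues_eq_0:
  fixes f E :: "'a::finite_field poly" and \<psi> :: "'a poly \<Rightarrow> int"
  assumes f: "lead_coeff f = 1"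
    and per: "\<And>a h. \<psi> (h * f + a) = \<psi> a"
    and mult: "\<And>a b. \<psi> (a * b) = \<psi> a * \<psi> b"
    and E: "\<psi> E = - 1" "\<And>s. f dvd E * s \<Longrightarrow> f dvd s"
  shows "(\<Sum>r\<in>polys_below (degree f). \<psi> r) = 0"
proof -
  let ?B = "polys_below (degree f) :: 'a poly set"
  have f0: "f \<noteq> 0" using f by auto
  let ?g = "\<lambda>r. (E * r) mod f"
  have img: "?g ` ?B \<subseteq> ?B" using degree_mod_less[OF f0] by (auto simp: polys_below_iff_degree)
  have inj: "inj_on ?g ?B"
  proof (rule inj_onI)
    fix r s assume rs: "r \<in> ?B" "s \<in> ?B" "?g r = ?g s"
    then have "f dvd E * r - E * s" by (simp add: mod_eq_dvd_iff)
    then have "f dvd r - s" using E(2)[of "r - s"] by (simp add: right_diff_distrib)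
    moreover have "r - s \<in> ?B" using rs by (auto simp: polys_below_def)
    ultimately show "r = s" using dvd_imp_degree_le[of f "r - s"] by (fastforce simp: polys_below_iff_degree)
  qed
  have "bij_betw ?g ?B ?B"
    unfolding bij_betw_def using inj endo_inj_surj[OF card_polys_below(1) img inj] by blast
  then have "(\<Sum>r\<in>?B. \<psi> r) = (\<Sum>r\<in>?B. \<psi> (?g r))" by (rule sum.reindex_bij_betw[symmetric])
  also have "\<dots> = (\<Sum>r\<in>?B. - \<psi> r)"
  proof (rule sum.cong[OF refl])
    fix r
    have "\<psi> (?g r) = \<psi> (E * r)" using per[of "(E * r) div f" "?g r"] by simp
    then show "\<psi> (?g r) = - \<psi> r" by (simp add: mult E(1))
  qed
  finally show ?thesis by (simp add: sum_negf)
qed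

lemma monic_irreducible_nonzero: "monic_irreducible P \<Longrightarrow> P \<noteq> 0"
  by (auto simp: monic_irreducible_def)

text \<open>Otherwise all \<open>2 * e\<close> nonzero elements of the residue field would be roots
  of \<open>X^e - 1\<close>.\<close>

lemma legendre_nonresidue_exists:
  fixes P :: "'a::finite_field poly"
  assumes q: "odd CARD('a)" and P: "monic_irreducible P"
  obtains c where "poly_legendre c P = - 1"
proof (rule ccontr)
  assume "\<not> thesis"
  then have no: "poly_legendre c P \<noteq> - 1" for c using that by blast
  define x e where "x = root_of P" and "e = (CARD('a) ^ degree P - 1) div 2"
  have d: "degree P > 0" using P by (rule monic_irreducible_degree_pos)
  have x: "ev P x = 0" unfolding x_def using d by (rule ev_root_of)
  have "CARD('a) ^ degree P > 1" using CARD_ge_2[where 'a='a] d by (intro one_less_power) auto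
  moreover obtain m where "CARD('a) ^ degree P = 2 * m + 1" using q by (meson even_power oddE)
  ultimately have Q: "CARD('a) ^ degree P = Suc (2 * e)" "e > 0" unfolding e_def by simp_all
  define p :: "'a alg_closure poly" where "p = monom 1 e + (- 1)"
  have deg: "degree p = e" unfolding p_def using Q(2)
    by (subst degree_add_eq_left) (auto simp: degree_monom_eq)
  have p0: "p \<noteq> 0" using deg Q(2) by auto
  have "fixed_field (degree P) - {0 :: 'a alg_closure} \<subseteq> {z. poly p z = 0}"
  proof
    fix z :: "'a alg_closure" assume z: "z \<in> fixed_field (degree P) - {0}"
    then obtain c where c: "z = ev c x" unfolding fixed_field_eq_range_ev[OF P x] by auto
    have "\<not> P dvd c" using monic_irreducible_dvd_iff[OF P x] c z by auto
    then have "poly_legendre c P = 1" using no[of c] by (auto simp: poly_legendre_def split: if_splits)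
    then have "z ^ e = 1" using euler_criterion[OF q P x, of c] c by (simp add: e_def)
    then show "z \<in> {z. poly p z = 0}" by (simp add: p_def poly_monom)
  qed
  then have "card (fixed_field (degree P) - {0 :: 'a alg_closure}) \<le> card {z. poly p z = 0}"
    by (intro card_mono poly_roots_finite[OF p0])
  also have "\<dots> \<le> e" using card_poly_roots_bound[OF p0] deg by simp
  finally show False using card_fixed_field[OF d, where 'a='a] Q
    by (simp add: card_Diff_singleton_if fixed_field_def zero_power)
qed

section \<open>Inverses modulo irreducibles and cancellation of an odd multiplicity\<close>

lemma monic_irreducible_inverse_exists:
  fixes P :: "'a::finite_field poly"
  assumes P: "monic_irreducible P" and F: "\<not> P dvd F"
  obtains a where "P dvd a * F - 1"
proof -
  define x where "x = root_of P"
  have x: "ev P x = 0" unfolding x_def using P ev_root_of monic_irreducible_degree_pos by blast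
  have nz: "ev F x \<noteq> 0" using F monic_irreducible_dvd_iff[OF P x] by simp
  have "ev F x \<in> fixed_field (degree P)" unfolding fixed_field_eq_range_ev[OF P x] by simp
  then have "inverse (ev F x) \<in> fixed_field (degree P)" by (simp add: fixed_field_def power_inverse)
  then obtain a where "ev a x = inverse (ev F x)" unfolding fixed_field_eq_range_ev[OF P x] by auto
  then have "P dvd a * F - 1" using monic_irreducible_dvd_iff[OF P x] nz by simp
  then show ?thesis using that by blast
qed

lemma monic_irreducible_dvd_prod_iff:
  assumes "monic_irreducible P" "finite S"
  shows "P dvd (\<Prod>i\<in>S. f i) \<longleftrightarrow> (\<exists>i\<in>S. P dvd f i)"
  using assms(2)
proof (induction S rule: finite_induct)
  case empty
  then show ?case using assms(1) by (auto simp: monic_irreducible_def irreducible_def)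
qed (auto simp: monic_irreducible_mult_dvd_iff[OF assms(1)])

lemma prod_monic_irreducible_dvd:
  assumes "finite S" "\<And>P. P \<in> S \<Longrightarrow> monic_irreducible P \<and> P dvd g"
  shows "\<Prod>S dvd g"
  using assms
proof (induction S rule: finite_induct)
  case (insert P S)
  then obtain h where h: "g = \<Prod>S * h" by (auto elim!: dvdE)
  have P: "monic_irreducible P" "P dvd g" using insert.prems by auto
  have "\<not> P dvd \<Prod>S"
  proof
    assume "P dvd \<Prod>S"
    then obtain Q where "Q \<in> S" "P dvd Q" using monic_irreducible_dvd_prod_iff[OF P(1) insert.hyps(1), of "\<lambda>x. x"] by auto
    then show False using insert monic_irreducible_dvd_monic_irreducible[OF P(1)] by blast
  qed
  then have "P dvd h" using P h monic_irreducible_mult_dvd_iff[OF P(1)] by auto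
  then have "P * \<Prod>S dvd h * \<Prod>S" by (intro mult_dvd_mono) auto
  then show ?case using insert h by (simp add: mult.commute)
qed simp

lemma prod_list_map_eq_prod_count:
  fixes F :: "'b \<Rightarrow> 'c::comm_monoid_mult"
  assumes "finite S" "set xs \<subseteq> S"
  shows "(\<Prod>x\<leftarrow>xs. F x) = (\<Prod>x\<in>S. F x ^ count_list xs x)"
  using assms(2)
proof (induction xs)
  case (Cons y xs)
  have "(\<Prod>x\<in>S. F x ^ count_list (y # xs) x) = (\<Prod>x\<in>S. (if x = y then F x else 1) * F x ^ count_list xs x)"
    by (intro prod.cong) auto
  also have "\<dots> = F y * (\<Prod>x\<in>S. F x ^ count_list xs x)"
    using Cons.prems assms(1) by (simp add: prod.distrib)
  finally show ?case using Cons by simp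
qed simp

text \<open>The product depends only on \<open>D\<close> modulo the product \<open>f\<close> of the
  distinct entries, and it is multiplicative in \<open>D\<close>. An odd multiplicity of
  \<open>P0\<close> leaves room for a multiplier of character value \<open>-1\<close>: a nonresidue
  modulo \<open>P0\<close> that is \<open>1\<close> modulo the other entries.\<close>

theorem sum_prod_legendre_eq_0:
  fixes xs :: "'a::finite_field poly list"
  assumes q: "odd CARD('a)" and xs: "\<And>P. P \<in> set xs \<Longrightarrow> monic_irreducible P"
    and n: "(\<Sum>P\<leftarrow>xs. degree P) \<le> n" and P0: "odd (count_list xs P0)"
  shows "(\<Sum>D\<in>monic_polys n. \<Prod>P\<leftarrow>xs. poly_legendre D P) = 0"
proof -
  define S f where "S = set xs" and "f = \<Prod>S"
  define \<psi> where "\<psi> D = (\<Prod>P\<in>S. poly_legendre D P ^ count_list xs P)" for D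
  have \<psi>: "(\<Prod>P\<leftarrow>xs. poly_legendre D P) = \<psi> D" for D
    unfolding \<psi>_def by (rule prod_list_map_eq_prod_count) (auto simp: S_def)
  have fin: "finite S" by (simp add: S_def)
  have S: "monic_irreducible P" if "P \<in> S" for P using that xs by (simp add: S_def)
  have P0S: "P0 \<in> S" using P0 by (metis S_def count_list_0_iff even_zero)
  note irr0 = S[OF P0S]
  have lc: "lead_coeff f = 1"
    unfolding f_def lead_coeff_prod using S by (intro prod.neutral) (auto simp: monic_irreducible_def)
  have "degree f = (\<Sum>P\<in>S. degree P)"
    unfolding f_def using S by (intro degree_prod_eq_sum_degree) (simp add: monic_irreducible_nonzero)
  also have "\<dots> \<le> (\<Sum>P\<in>S. count_list xs P * degree P)"
  proof (rule sum_mono)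
    fix P assume "P \<in> S"
    then have "count_list xs P \<ge> 1" unfolding S_def by (metis count_list_0_iff less_one not_le)
    then show "degree P \<le> count_list xs P * degree P" by simp
  qed
  also have "\<dots> = (\<Sum>P\<leftarrow>xs. degree P)" by (simp add: S_def sum_list_map_eq_sum_count)
  finally have deg: "degree f \<le> n" using n by simp
  have per: "\<psi> (h * f + a) = \<psi> a" for a h
    unfolding \<psi>_def
  proof (intro prod.cong refl arg_cong[where f = "\<lambda>x. x ^ _"])
    fix P assume P: "P \<in> S"
    then have "P dvd f" unfolding f_def using fin dvd_prodI[of S P "\<lambda>x. x"] by simp
    then show "poly_legendre (h * f + a) P = poly_legendre a P"
      by (intro poly_legendre_cong[OF q S[OF P]]) simp
  qed
  have mult: "\<psi> (a * b) = \<psi> a * \<psi> b" for a b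
    unfolding \<psi>_def prod.distrib[symmetric]
    by (intro prod.cong refl) (simp add: poly_legendre_mult[OF q S] power_mult_distrib)
  obtain c where c: "poly_legendre c P0 = - 1" using legendre_nonresidue_exists[OF q irr0] by blast
  define F where "F = \<Prod>(S - {P0})"
  have ndvd: "\<not> P0 dvd F"
    unfolding F_def using monic_irreducible_dvd_prod_iff[OF irr0, of "S - {P0}" "\<lambda>x. x"] fin
      monic_irreducible_dvd_monic_irreducible[OF irr0 S] by auto
  obtain a where a: "P0 dvd a * F - 1" using monic_irreducible_inverse_exists[OF irr0 ndvd] by blast
  \<comment> \<open>Chinese remaindering made explicit: \<open>F\<close> vanishes modulo the other
    entries, and \<open>a * F\<close> is \<open>1\<close> modulo \<open>P0\<close>, so
    \<open>E\<close> is \<open>1\<close> there and \<open>c\<close> here.\<close>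
  define E where "E = 1 + a * F * (c - 1)"
  have E1: "poly_legendre E P = 1" if "P \<in> S" "P \<noteq> P0" for P
  proof -
    have "P dvd F" unfolding F_def using that fin dvd_prodI[of "S - {P0}" P "\<lambda>x. x"] by simp
    then have "P dvd E - 1" by (simp add: E_def)
    then show ?thesis using poly_legendre_cong[OF q S[OF that(1)], of E 1] poly_legendre_1[OF S[OF that(1)]] by simp
  qed
  have E0: "poly_legendre E P0 = - 1"
  proof -
    have "E - c = (a * F - 1) * (c - 1)" by (simp add: E_def algebra_simps)
    then have "P0 dvd E - c" using a by simp
    then show ?thesis using poly_legendre_cong[OF q irr0, of E c] c by simp
  qed
  have "\<psi> E = poly_legendre E P0 ^ count_list xs P0 * (\<Prod>P\<in>S - {P0}. poly_legendre E P ^ count_list xs P)"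
    unfolding \<psi>_def using fin P0S by (rule prod.remove)
  also have "(\<Prod>P\<in>S - {P0}. poly_legendre E P ^ count_list xs P) = 1"
    by (rule prod.neutral) (simp add: E1)
  finally have E: "\<psi> E = - 1" using P0 by (simp add: E0)
  have Ef: "f dvd s" if "f dvd E * s" for s
    unfolding f_def
  proof (rule prod_monic_irreducible_dvd[OF fin])
    fix P assume P: "P \<in> S"
    have "poly_legendre E P \<noteq> 0" using E0 E1[OF P] by (cases "P = P0") auto
    then have "\<not> P dvd E" by (auto simp: poly_legendre_def)
    moreover have "P dvd E * s" using that dvd_trans[OF dvd_prodI[OF fin P, of "\<lambda>x. x"]] unfolding f_def by simp
    ultimately show "monic_irreducible P \<and> P dvd s" using S[OF P] monic_irreducible_mult_dvd_iff by blast
  qed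
  have "(\<Sum>r\<in>polys_below (degree f). \<psi> r) = 0"
    by (rule char_sum_residues_eq_0[OF lc per mult E Ef])
  then show ?thesis unfolding \<psi> using sum_monic_polys_residues[OF lc deg, of \<psi>] per by simp
qed

section \<open>The L-function as a polynomial\<close>

definition L_coeff :: "'a::field poly \<Rightarrow> nat \<Rightarrow> int" where
  "L_coeff D n = (\<Sum>f\<in>monic_polys n. quad_char D f)"

text \<open>By reciprocity the coefficient is, up to sign, the sum over \<open>f\<close> of the
  product of the symbols \<open>(f/P)\<close> over the primes of \<open>D\<close>. Each of them
  occurs once, hence oddly often, and their total degree is \<open>degree D \<le> n\<close>; so
  orthogonality applies with \<open>f\<close> as the summation variable.\<close>

lemma L_coeff_eq_0:
  fixes D :: "'a::finite_field poly"
  assumes q: "odd CARD('a)" and D: "lead_coeff D = 1" "squarefree D" "degree D \<ge> 1" and n: "n \<ge> degree D"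
  shows "L_coeff D n = 0"
proof -
  have D0: "D \<noteq> 0" using D by auto
  obtain xs where xs: "set xs = monic_primes D" "distinct xs"
    using finite_distinct_list[OF finite_monic_primes[OF D0]] by blast
  have "monic_primes D \<noteq> {}" using monic_squarefree_eq_prod(2)[OF D(1,2)] D(3) by auto
  then obtain P0 where P0: "P0 \<in> set xs" using xs by auto
  have cnt: "count_list xs P0 = 1" using xs(2) P0 by (induction xs) (auto simp: count_list_0_iff)
  have deg: "(\<Sum>P\<leftarrow>xs. degree P) \<le> n"
    using monic_squarefree_eq_prod(2)[OF D(1,2)] n xs by (simp add: sum_list_distinct_conv_sum_set)
  have "L_coeff D n = (\<Sum>f\<in>monic_polys n. recip_sign CARD('a) (degree D) n * (\<Prod>P\<leftarrow>xs. poly_legendre f P))"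
    unfolding L_coeff_def
  proof (rule sum.cong[OF refl])
    fix f :: "'a poly" assume f: "f \<in> monic_polys n"
    have "(\<Prod>P\<leftarrow>xs. poly_legendre f P) = (\<Prod>P\<in>monic_primes D. poly_legendre f P)"
      using xs by (metis prod.distinct_set_conv_list)
    moreover have "lead_coeff f = 1" "degree f = n" using f by (auto simp: monic_polys_def)
    ultimately show "quad_char D f = recip_sign CARD('a) (degree D) n * (\<Prod>P\<leftarrow>xs. poly_legendre f P)"
      using quad_char_reciprocity[OF q D(1,2), of f] by simp
  qed
  also have "\<dots> = 0"
    unfolding sum_distrib_left[symmetric]
    by (subst sum_prod_legendre_eq_0[OF q _ deg, of P0]) (use xs cnt in \<open>auto simp: monic_primes_def\<close>)
  finally show ?thesis .
qed

lemma L_coeff_0: "L_coeff (D :: 'a::finite_field poly) 0 = 1"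
proof -
  have "(monic_polys 0 :: 'a poly set) = {1}"
    by (auto simp: monic_polys_def elim!: degree_eq_zeroE)
  then show ?thesis by (simp add: L_coeff_def quad_char_1)
qed

definition L_poly :: "'a::finite_field poly \<Rightarrow> complex poly" where
  "L_poly D = (\<Sum>n<degree D. monom (of_int (L_coeff D n)) n)"

lemma coeff_L_poly:
  fixes D :: "'a::finite_field poly"
  assumes q: "odd CARD('a)" and D: "lead_coeff D = 1" "squarefree D" "degree D \<ge> 1"
  shows "coeff (L_poly D) n = of_int (L_coeff D n)"
proof -
  have "coeff (L_poly D) n = (\<Sum>i<degree D. if i = n then of_int (L_coeff D i) else 0)"
    by (simp add: L_poly_def coeff_sum)
  also have "\<dots> = (if n < degree D then of_int (L_coeff D n) else 0)" by simp
  finally show ?thesis using L_coeff_eq_0[OF q D, of n] by simp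
qed

lemma degree_L_poly: "degree D \<ge> 1 \<Longrightarrow> degree (L_poly D) < degree D"
  unfolding L_poly_def by (rule degree_sum_less) (auto intro: le_less_trans[OF degree_monom_le])

lemma poly_L_poly_0:
  fixes D :: "'a::finite_field poly"
  assumes "odd CARD('a)" "lead_coeff D = 1" "squarefree D" "degree D \<ge> 1"
  shows "poly (L_poly D) 0 = 1"
  using coeff_L_poly[OF assms, of 0] by (simp add: poly_0_coeff_0 L_coeff_0)

lemma quad_L_eq_poly:
  fixes D :: "'a::finite_field poly"
  assumes q: "odd CARD('a)" and D: "lead_coeff D = 1" "squarefree D" "degree D \<ge> 1"
  shows "quad_L D = poly (L_poly D)"
proof
  fix u
  have "quad_L D u = (\<Sum>n. of_int (L_coeff D n) * u ^ n)"
    unfolding quad_L_def L_coeff_def by simp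
  also have "\<dots> = (\<Sum>n<degree D. of_int (L_coeff D n) * u ^ n)"
    by (rule suminf_finite) (use L_coeff_eq_0[OF q D] in auto)
  also have "\<dots> = poly (L_poly D) u" by (simp add: L_poly_def poly_sum poly_monom)
  finally show "quad_L D u = poly (L_poly D) u" .
qed

section \<open>The logarithmic derivative\<close>

definition prime_powers :: "nat \<Rightarrow> ('a::field poly \<times> nat) set" where
  "prime_powers n = {(P, k). monic_irreducible P \<and> k \<ge> 1 \<and> k * degree P = n}"

text \<open>The twisted von Mangoldt sum in degree \<open>n\<close>, that is, the coefficient of
  \<open>u ^ n\<close> in \<open>u * L' / L\<close>.\<close>

definition Lam :: "'a::field poly \<Rightarrow> nat \<Rightarrow> int" where
  "Lam D n = (\<Sum>(P, k)\<in>prime_powers n. int (degree P) * poly_legendre D P ^ k)"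

lemma finite_prime_powers: "finite (prime_powers n :: ('a::finite_field poly \<times> nat) set)"
proof (rule finite_subset)
  show "(prime_powers n :: ('a poly \<times> nat) set) \<subseteq> (\<Union>m\<le>n. monic_polys m) \<times> {..n}"
  proof safe
    fix P :: "'a poly" and k assume "(P, k) \<in> prime_powers n"
    then have P: "monic_irreducible P" "k \<ge> 1" "k * degree P = n" by (auto simp: prime_powers_def)
    then have "degree P \<le> n" "k \<le> n" using monic_irreducible_degree_pos[of P] by auto
    then show "P \<in> (\<Union>m\<le>n. monic_polys m)" "k \<le> n"
      using P(1) by (auto simp: monic_polys_def monic_irreducible_def)
  qed
qed (simp add: monic_polys_finite_card)

lemma disjoint_prime_powers: "m \<noteq> n \<Longrightarrow> prime_powers m \<inter> prime_powers n = {}"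
  by (auto simp: prime_powers_def)

lemma degree_eq_sum_prime_powers:
  fixes f :: "'a::finite_field poly"
  assumes f: "f \<in> monic_polys n"
  shows "degree f = (\<Sum>(P, k)\<in>(\<Union>m\<in>{1..n}. prime_powers m). if P ^ k dvd f then degree P else 0)"
proof -
  let ?I = "\<Union>m\<in>{1..n}. prime_powers m :: ('a poly \<times> nat) set"
  have f': "lead_coeff f = 1" "degree f = n" using f by (auto simp: monic_polys_def)
  then have f0: "f \<noteq> 0" by auto
  have eq: "{x \<in> ?I. fst x ^ snd x dvd f} = (SIGMA P:monic_primes f. {1..pval P f})"
  proof safe
    fix P k m assume A: "(P, k) \<in> (prime_powers m :: ('a poly \<times> nat) set)" "fst (P, k) ^ snd (P, k) dvd f"
    then have P: "monic_irreducible P" "k \<ge> 1" "P ^ k dvd f" by (auto simp: prime_powers_def)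
    then have "P dvd f" using dvd_power[of k P] by (meson dvd_trans less_le_trans zero_less_one)
    then show "P \<in> monic_primes f" using P by (simp add: monic_primes_def)
    show "k \<in> {1..pval P f}" using P power_dvd_iff_le_pval[OF P(1) f0] by simp
  next
    fix P k assume A: "P \<in> monic_primes f" "k \<in> {1..pval P f}"
    then have P: "monic_irreducible P" by (simp add: monic_primes_def)
    have dvd: "P ^ k dvd f" using A power_dvd_iff_le_pval[OF P f0] by simp
    then show "fst (P, k) ^ snd (P, k) dvd f" by simp
    have "k * degree P \<le> n" using dvd_imp_degree_le[OF dvd f0] P f' by (simp add: degree_power_eq monic_irreducible_nonzero)
    moreover have "k * degree P \<ge> 1" using A monic_irreducible_degree_pos[OF P] by simp
    ultimately have "k * degree P \<in> {1..n}" by simp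
    moreover have "(P, k) \<in> prime_powers (k * degree P)" using P A by (simp add: prime_powers_def)
    ultimately show "(P, k) \<in> ?I" by blast
  qed
  have "(\<Sum>(P, k)\<in>?I. if P ^ k dvd f then degree P else 0) = (\<Sum>x\<in>{x \<in> ?I. fst x ^ snd x dvd f}. degree (fst x))"
    using finite_prime_powers by (subst sum.inter_filter) (auto simp: case_prod_beta)
  also have "\<dots> = (\<Sum>P\<in>monic_primes f. \<Sum>k\<in>{1..pval P f}. degree P)"
    unfolding eq using finite_monic_primes[OF f0] by (subst sum.Sigma) (auto simp: case_prod_beta)
  also have "\<dots> = degree f" using degree_monic_poly_eq_sum[OF f'(1)] by simp
  finally show ?thesis by simp
qed

lemma sum_quad_char_multiples:
  fixes P :: "'a::finite_field poly"
  assumes P: "monic_irreducible P" and n: "k * degree P \<le> n"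
  shows "(\<Sum>f\<in>{f \<in> monic_polys n. P ^ k dvd f}. quad_char D f) = poly_legendre D P ^ k * L_coeff D (n - k * degree P)"
proof -
  have P0: "P ^ k \<noteq> 0" "degree (P ^ k) = k * degree P"
    using P by (auto simp: monic_irreducible_nonzero degree_power_eq)
  have lcP: "lead_coeff (P ^ k) = 1" using P unfolding lead_coeff_power monic_irreducible_def by simp
  have bij: "bij_betw (\<lambda>g. P ^ k * g) (monic_polys (n - k * degree P)) {f \<in> monic_polys n. P ^ k dvd f}"
  proof (rule bij_betw_imageI)
    show "inj_on (\<lambda>g. P ^ k * g) (monic_polys (n - k * degree P))" using P0 by (auto intro: inj_onI)
    show "(\<lambda>g. P ^ k * g) ` monic_polys (n - k * degree P) = {f \<in> monic_polys n. P ^ k dvd f}"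
    proof safe
      fix g :: "'a poly" assume g: "g \<in> monic_polys (n - k * degree P)"
      then have "g \<noteq> 0" by (auto simp: monic_polys_def)
      then have "degree (P ^ k * g) = n"
        using g P0 n by (auto simp: monic_polys_def degree_mult_eq)
      moreover have "lead_coeff (P ^ k * g) = 1"
        unfolding lead_coeff_mult lcP using g by (auto simp: monic_polys_def)
      ultimately show "P ^ k * g \<in> monic_polys n" by (simp add: monic_polys_def)
    next
      fix f assume f: "f \<in> monic_polys n" "P ^ k dvd f"
      then obtain g where g: "f = P ^ k * g" by auto
      have f': "lead_coeff f = 1" "degree f = n" using f by (auto simp: monic_polys_def)
      then have "g \<noteq> 0" using g by auto
      then have "degree g = n - k * degree P" using f'(2) P0 by (simp add: g degree_mult_eq)
      moreover have "lead_coeff g = 1" using f'(1) unfolding g lead_coeff_mult lcP by simp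
      ultimately have "g \<in> monic_polys (n - k * degree P)" by (simp add: monic_polys_def)
      then show "f \<in> (\<lambda>g. P ^ k * g) ` monic_polys (n - k * degree P)" using g by blast
    qed auto
  qed
  have "(\<Sum>f\<in>{f \<in> monic_polys n. P ^ k dvd f}. quad_char D f) =
      (\<Sum>g\<in>monic_polys (n - k * degree P). quad_char D (P ^ k * g))"
    by (rule sum.reindex_bij_betw[OF bij, symmetric])
  also have "\<dots> = (\<Sum>g\<in>monic_polys (n - k * degree P). poly_legendre D P ^ k * quad_char D g)"
    by (intro sum.cong refl quad_char_mult_prime_power[OF P]) (auto simp: monic_polys_def)
  finally show ?thesis by (simp add: L_coeff_def sum_distrib_left)
qed

text \<open>The degree of \<open>f\<close> is the sum of \<open>degree P\<close> over all prime
  powers dividing \<open>f\<close>. Inserting this as a weight and exchanging the sums gives the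
  identity \<open>u * L' = L * (\<Sum>m. Lam D m * u ^ m)\<close>, coefficient by
  coefficient.\<close>

theorem L_coeff_recurrence:
  fixes D :: "'a::finite_field poly"
  shows "int n * L_coeff D n = (\<Sum>m\<in>{1..n}. Lam D m * L_coeff D (n - m))"
proof -
  let ?I = "\<Union>m\<in>{1..n}. prime_powers m :: ('a poly \<times> nat) set"
  have "int n * L_coeff D n = (\<Sum>f\<in>monic_polys n. int (degree f) * quad_char D f)"
    unfolding L_coeff_def sum_distrib_left by (rule sum.cong) (auto simp: monic_polys_def)
  also have "\<dots> = (\<Sum>f\<in>monic_polys n. \<Sum>(P, k)\<in>?I. if P ^ k dvd f then int (degree P) * quad_char D f else 0)"
  proof (rule sum.cong[OF refl])
    fix f :: "'a poly" assume f: "f \<in> monic_polys n"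
    show "int (degree f) * quad_char D f = (\<Sum>(P, k)\<in>?I. if P ^ k dvd f then int (degree P) * quad_char D f else 0)"
      unfolding degree_eq_sum_prime_powers[OF f] of_nat_sum sum_distrib_right
      by (intro sum.cong) (auto split: if_splits)
  qed
  also have "\<dots> = (\<Sum>(P, k)\<in>?I. \<Sum>f\<in>monic_polys n. if P ^ k dvd f then int (degree P) * quad_char D f else 0)"
    by (subst sum.swap) (simp add: case_prod_beta)
  also have "\<dots> = (\<Sum>(P, k)\<in>?I. int (degree P) * poly_legendre D P ^ k * L_coeff D (n - k * degree P))"
  proof (intro sum.cong refl, safe)
    fix P :: "'a poly" and k m assume A: "m \<in> {1..n}" "(P, k) \<in> prime_powers m"
    then have P: "monic_irreducible P" "k * degree P \<le> n" by (auto simp: prime_powers_def)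
    have "(\<Sum>f\<in>monic_polys n. if P ^ k dvd f then int (degree P) * quad_char D f else 0)
        = int (degree P) * (\<Sum>f\<in>{f \<in> monic_polys n. P ^ k dvd f}. quad_char D f)"
      by (simp add: sum.inter_filter monic_polys_finite_card sum_distrib_left if_distrib cong: if_cong)
    then show "(\<Sum>f\<in>monic_polys n. if P ^ k dvd f then int (degree P) * quad_char D f else 0)
        = int (degree P) * poly_legendre D P ^ k * L_coeff D (n - k * degree P)"
      unfolding sum_quad_char_multiples[OF P] by simp
  qed
  also have "\<dots> = (\<Sum>m\<in>{1..n}. \<Sum>(P, k)\<in>prime_powers m. int (degree P) * poly_legendre D P ^ k * L_coeff D (n - k * degree P))"
    by (rule sum.UNION_disjoint) (auto simp: finite_prime_powers disjoint_prime_powers)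
  also have "\<dots> = (\<Sum>m\<in>{1..n}. Lam D m * L_coeff D (n - m))"
    unfolding Lam_def sum_distrib_right by (intro sum.cong refl) (auto simp: prime_powers_def)
  finally show ?thesis .
qed

lemma fps_of_poly_deriv_linear_prod:
  fixes A :: "complex multiset"
  defines "p \<equiv> (\<Prod>\<alpha>\<in>#A. [:1, - \<alpha>:])"
  shows "fps_of_poly (pderiv p) = - fps_of_poly p * (\<Sum>\<alpha>\<in>#A. Abs_fps (\<lambda>n. \<alpha> ^ Suc n))"
  unfolding p_def
proof (induction A)
  case (add \<alpha> A)
  let ?p = "\<Prod>\<alpha>\<in>#A. [:1, - \<alpha>:]" and ?S = "\<Sum>\<alpha>\<in>#A. Abs_fps (\<lambda>n. \<alpha> ^ Suc n)"
  have geo: "fps_of_poly [:1, - \<alpha>:] * Abs_fps (\<lambda>n. \<alpha> ^ Suc n) = fps_const \<alpha>"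
  proof (rule fps_ext)
    fix n
    have "fps_of_poly [:1, - \<alpha>:] * Abs_fps (\<lambda>n. \<alpha> ^ Suc n) =
        Abs_fps (\<lambda>n. \<alpha> ^ Suc n) - fps_const \<alpha> * (fps_X * Abs_fps (\<lambda>n. \<alpha> ^ Suc n))"
      by (simp add: fps_of_poly_pCons algebra_simps flip: fps_const_neg)
    then show "fps_nth (fps_of_poly [:1, - \<alpha>:] * Abs_fps (\<lambda>n. \<alpha> ^ Suc n)) n = fps_nth (fps_const \<alpha>) n"
      by (cases n) simp_all
  qed
  have "pderiv ([:1, - \<alpha>:] * ?p) = [:1, - \<alpha>:] * pderiv ?p + [:- \<alpha>:] * ?p"
    by (simp only: pderiv_mult) (simp add: pderiv_pCons mult.commute)
  then have "fps_of_poly (pderiv ([:1, - \<alpha>:] * ?p)) =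
      fps_of_poly [:1, - \<alpha>:] * fps_of_poly (pderiv ?p) - fps_const \<alpha> * fps_of_poly ?p"
    by (simp only: fps_of_poly_add fps_of_poly_mult) (simp add: fps_of_poly_const)
  also have "\<dots> = - (fps_of_poly [:1, - \<alpha>:] * fps_of_poly ?p) * ?S -
      fps_of_poly [:1, - \<alpha>:] * Abs_fps (\<lambda>n. \<alpha> ^ Suc n) * fps_of_poly ?p"
    unfolding add geo by (simp add: mult_ac)
  also have "\<dots> = - (fps_of_poly ([:1, - \<alpha>:] * ?p)) * (Abs_fps (\<lambda>n. \<alpha> ^ Suc n) + ?S)"
    unfolding fps_of_poly_mult by (simp only: algebra_simps) simp
  finally show ?case by simp
qed simp

text \<open>\<open>A\<close> is the multiset of inverse zeros; the constant term \<open>1\<close>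
  excludes zero as a root and normalises the product. The formula for \<open>Lam\<close> compares
  the logarithmic derivative obtained from the recurrence with the one obtained from the linear
  factors.\<close>

lemma L_poly_factorization:
  fixes D :: "'a::finite_field poly"
  assumes q: "odd CARD('a)" and D: "lead_coeff D = 1" "squarefree D" "degree D \<ge> 1"
  obtains A :: "complex multiset" where "size A < degree D" "L_poly D = (\<Prod>\<alpha>\<in>#A. [:1, - \<alpha>:])"
    "\<And>n. n > 0 \<Longrightarrow> of_int (Lam D n) = - (\<Sum>\<alpha>\<in>#A. \<alpha> ^ n)"
proof -
  let ?p = "L_poly D"
  have p0: "poly ?p 0 = 1" by (rule poly_L_poly_0[OF q D])
  then have nz: "?p \<noteq> 0" by auto
  obtain B c where B: "size B = degree ?p" "?p = smult c (\<Prod>x\<in>#B. [:- x, 1:])"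
    using alg_closed_imp_factorization[OF nz] by blast
  define A where "A = image_mset inverse B"
  have B0: "x \<noteq> 0" if "x \<in># B" for x
  proof
    assume "x = 0"
    then have "poly (\<Prod>x\<in>#B. [:- x, 1:]) 0 = 0"
      using that by (force simp: poly_prod_mset prod_mset_zero_iff)
    then show False using p0 B(2) by simp
  qed
  have "(\<Prod>x\<in>#B. [:- x, 1:]) = smult (\<Prod>x\<in>#B. - x) (\<Prod>x\<in>#B. [:1, - inverse x:])" if "\<And>x. x \<in># B \<Longrightarrow> x \<noteq> 0" for B :: "complex multiset"
    using that
  proof (induction B)
    case (add x B)
    then have "[:- x, 1:] = smult (- x) [:1, - inverse x:]" by simp
    then show ?case using add by (simp only: image_mset_add_mset prod_mset.add_mset mult_smult_left mult_smult_right smult_smult) (simp add: mult_ac)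
  qed simp
  from this[OF B0] have p: "?p = smult (c * (\<Prod>x\<in>#B. - x)) (\<Prod>\<alpha>\<in>#A. [:1, - \<alpha>:])"
    using B(2) by (simp add: A_def image_mset.compositionality comp_def)
  have "poly (\<Prod>\<alpha>\<in>#A. [:1, - \<alpha>:]) 0 = 1" by (simp add: poly_prod_mset)
  then have "c * (\<Prod>x\<in>#B. - x) = 1" using p0 unfolding p by simp
  then have pA: "?p = (\<Prod>\<alpha>\<in>#A. [:1, - \<alpha>:])" using p by simp
  have sz: "size A < degree D" using B(1) degree_L_poly[OF D(3)] by (simp add: A_def)
  let ?G = "Abs_fps (\<lambda>n. of_int (Lam D (Suc n))) :: complex fps"
  have "fps_of_poly (pderiv ?p) = fps_of_poly ?p * ?G"
  proof (rule fps_ext)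
    fix n
    have "fps_nth (fps_of_poly (pderiv ?p)) n = of_int (int (Suc n) * L_coeff D (Suc n))"
      by (simp add: coeff_pderiv coeff_L_poly[OF q D])
    also have "int (Suc n) * L_coeff D (Suc n) = (\<Sum>m\<in>{0..n}. Lam D (Suc m) * L_coeff D (n - m))"
      unfolding L_coeff_recurrence by (simp only: One_nat_def sum.shift_bounds_cl_Suc_ivl) simp
    also have "of_int \<dots> = fps_nth (?G * fps_of_poly ?p) n"
      by (simp add: fps_mult_nth coeff_L_poly[OF q D])
    finally show "fps_nth (fps_of_poly (pderiv ?p)) n = fps_nth (fps_of_poly ?p * ?G) n" by (simp add: mult.commute)
  qed
  then have "fps_of_poly ?p * ?G = fps_of_poly ?p * - (\<Sum>\<alpha>\<in>#A. Abs_fps (\<lambda>n. \<alpha> ^ Suc n))"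
    using fps_of_poly_deriv_linear_prod[of A] by (simp add: pA)
  then have G: "?G = - (\<Sum>\<alpha>\<in>#A. Abs_fps (\<lambda>n. \<alpha> ^ Suc n))"
    using nz by (subst (asm) mult_left_cancel) auto
  have nth: "fps_nth (\<Sum>\<alpha>\<in>#A. Abs_fps (\<lambda>n. \<alpha> ^ Suc n)) n = (\<Sum>\<alpha>\<in>#A. \<alpha> ^ Suc n)" for n and A :: "complex multiset"
    by (induction A) auto
  have "of_int (Lam D n) = - (\<Sum>\<alpha>\<in>#A. \<alpha> ^ n)" if "n > 0" for n
  proof -
    obtain m where m: "n = Suc m" using \<open>n > 0\<close> by (cases n) auto
    have "fps_nth ?G m = fps_nth (- (\<Sum>\<alpha>\<in>#A. Abs_fps (\<lambda>n. \<alpha> ^ Suc n))) m" by (simp only: G)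
    then show ?thesis by (simp add: m nth del: power_Suc)
  qed
  then show ?thesis using that[OF sz pA] by blast
qed

section \<open>Point counts over the subfields\<close>

text \<open>The quadratic character of the field with \<open>CARD('a) ^ n\<close> elements. For odd
  \<open>CARD('a)\<close> and \<open>n > 0\<close> the value \<open>0\<close> occurs within this
  field only at \<open>y = 0\<close>.\<close>

definition eta :: "'a::finite_field itself \<Rightarrow> nat \<Rightarrow> 'a alg_closure \<Rightarrow> int" where
  "eta _ n y = (if y ^ ((CARD('a) ^ n - 1) div 2) = 1 then 1
     else if y ^ ((CARD('a) ^ n - 1) div 2) = - 1 then - 1 else 0)"

lemma fixed_field_eq_Union_roots:
  assumes "n > 0"
  shows "(fixed_field n :: 'a::finite_field alg_closure set) = (\<Union>(P, k)\<in>prime_powers n. {x. ev P x = 0})"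
proof (intro equalityI subsetI)
  fix x :: "'a alg_closure" assume x: "x \<in> fixed_field n"
  obtain P :: "'a poly" where P: "monic_irreducible P" "ev P x = 0" by (rule exists_monic_irreducible)
  then obtain k where k: "n = degree P * k" using x monic_irreducible_conjugates(3)[OF P] by auto
  then have "(P, k) \<in> prime_powers n" using P assms by (simp add: prime_powers_def Suc_le_eq mult.commute)
  then show "x \<in> (\<Union>(P, k)\<in>prime_powers n. {x. ev P x = 0})" using P by blast
next
  fix x :: "'a alg_closure" assume "x \<in> (\<Union>(P, k)\<in>prime_powers n. {x. ev P x = 0})"
  then show "x \<in> fixed_field n" using monic_irreducible_conjugates(3) by (fastforce simp: prime_powers_def)
qed

text \<open>The field with \<open>CARD('a) ^ n\<close> elements is the disjoint union of the root
  sets of the monic irreducible \<open>P\<close> with \<open>degree P\<close> dividing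
  \<open>n\<close>, and such a root set has \<open>degree P\<close> elements. So sums over prime
  powers become sums over points.\<close>

lemma sum_fixed_field:
  fixes h :: "'a::finite_field alg_closure \<Rightarrow> 'c::comm_semiring_1"
  assumes n: "n > 0" and h: "\<And>P k x. (P, k) \<in> prime_powers n \<Longrightarrow> ev P x = 0 \<Longrightarrow> h x = H P k"
  shows "(\<Sum>x\<in>fixed_field n. h x) = (\<Sum>(P, k)\<in>prime_powers n. of_nat (degree P) * H P k)"
proof -
  have "(\<Sum>x\<in>fixed_field n. h x) = (\<Sum>z\<in>prime_powers n. \<Sum>x\<in>{x. ev (fst z) x = 0}. h x)"
    unfolding fixed_field_eq_Union_roots[OF n] case_prod_beta
  proof (rule sum.UNION_disjoint)
    show "\<forall>i\<in>(prime_powers n :: ('a poly \<times> nat) set). finite {x. ev (fst i) x = 0}"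
      by (auto intro!: card_ev_roots(1) simp: prime_powers_def dest: monic_irreducible_nonzero)
    show "\<forall>i\<in>(prime_powers n :: ('a poly \<times> nat) set). \<forall>j\<in>prime_powers n. i \<noteq> j \<longrightarrow> {x. ev (fst i) x = 0} \<inter> {x. ev (fst j) x = 0} = {}"
    proof (intro ballI impI)
      fix i j :: "'a poly \<times> nat" assume ij: "i \<in> prime_powers n" "j \<in> prime_powers n" "i \<noteq> j"
      obtain P k R l where e: "i = (P, k)" "j = (R, l)" by (cases i, cases j) auto
      have "P \<noteq> R"
      proof
        assume "P = R"
        then have "k * degree P = l * degree P" "degree P > 0"
          using ij monic_irreducible_degree_pos[of P] unfolding e by (auto simp: prime_powers_def)
        then show False using ij(3) \<open>P = R\<close> by (simp add: e)
      qed
      then show "{x. ev (fst i) x = 0} \<inter> {x. ev (fst j) x = 0} = {}"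
        using ij monic_irreducible_unique[of P R] by (auto simp: e prime_powers_def)
    qed
  qed (rule finite_prime_powers)
  also have "\<dots> = (\<Sum>(P, k)\<in>prime_powers n. of_nat (degree P) * H P k)"
  proof (rule sum.cong[OF refl], clarify)
    fix P :: "'a poly" and k assume Pk: "(P, k) \<in> prime_powers n"
    then have "monic_irreducible P" by (simp add: prime_powers_def)
    then show "(\<Sum>x\<in>{x. ev (fst (P, k)) x = 0}. h x) = of_nat (degree P) * H P k"
      using monic_irreducible_roots(1)[of P] by (subst sum.cong[OF refl, of _ h "\<lambda>_. H P k"]) (auto simp: h[OF Pk])
  qed
  finally show ?thesis .
qed

lemma Lam_eq_sum_eta:
  fixes D :: "'a::finite_field poly"
  assumes q: "odd CARD('a)" and n: "n > 0"
  shows "Lam D n = (\<Sum>x\<in>fixed_field n. eta TYPE('a) n (ev D x))"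
proof -
  have "(\<Sum>x\<in>fixed_field n. eta TYPE('a) n (ev D x)) = (\<Sum>(P, k)\<in>prime_powers n. of_nat (degree P) * poly_legendre D P ^ k)"
  proof (rule sum_fixed_field[OF n])
    fix P :: "'a poly" and k x assume Pk: "(P, k) \<in> prime_powers n" and x: "ev P x = 0"
    then have P: "monic_irreducible P" and k: "k \<ge> 1" "n = degree P * k" by (auto simp: prime_powers_def)
    define Q where "Q = CARD('a) ^ degree P"
    have Qodd: "odd Q" using q by (simp add: Q_def)
    have cancel2: "2 * a = 2 * b * s \<Longrightarrow> a = b * s" for a b s :: nat by simp
    have "2 * ((Q ^ k - 1) div 2) = 2 * ((Q - 1) div 2) * (\<Sum>i<k. Q ^ i)"
    proof -
      have *: "2 * ((Q ^ k - 1) div 2) = Q ^ k - 1" "2 * ((Q - 1) div 2) = Q - 1" using Qodd by simp_all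
      have "(Q - 1) * (\<Sum>i<k. Q ^ i) = Q ^ k - 1"
      proof -
        have "Q > 0" using Qodd by (auto intro: Nat.gr0I)
        then have "int ((Q - 1) * (\<Sum>i<k. Q ^ i)) = int (Q ^ k - 1)"
          using power_diff_1_eq[of "int Q" k] by (simp add: of_nat_diff)
        then show ?thesis by (simp only: of_nat_eq_iff)
      qed
      then show ?thesis unfolding * by (rule sym)
    qed
    then have e: "(CARD('a) ^ n - 1) div 2 = (Q - 1) div 2 * (\<Sum>i<k. Q ^ i)"
      unfolding k(2) power_mult Q_def[symmetric] by (rule cancel2)
    \<comment> \<open>A sum of \<open>k\<close> odd terms has the parity of \<open>k\<close>, so
      raising a value in \<open>{-1, 0, 1}\<close> to this sum is the same as raising it to
      \<open>k\<close>, both exponents being positive.\<close>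
    have "odd (\<Sum>i<k. Q ^ i) \<longleftrightarrow> odd k"
      using Qodd by (induction k) auto
    then have par: "z ^ (\<Sum>i<k. Q ^ i) = z ^ k" if "z \<in> {-1, 0, 1}" "(\<Sum>i<k. Q ^ i) > 0" for z :: int
    proof -
      consider "z = - 1" | "z = 0" | "z = 1" using \<open>z \<in> _\<close> by blast
      then show ?thesis
      proof cases
        case 1
        then show ?thesis using \<open>odd (\<Sum>i<k. Q ^ i) \<longleftrightarrow> odd k\<close> unfolding 1 minus_one_power_iff by simp
      next
        case 2
        then show ?thesis using that(2) k by (simp add: zero_power)
      qed simp
    qed
    have pos: "(\<Sum>i<k. Q ^ i) > 0"
    proof -
      have "Q ^ 0 \<le> (\<Sum>i<k. Q ^ i)" using k by (intro member_le_sum) auto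
      then show ?thesis by simp
    qed
    have mem: "poly_legendre D P \<in> {-1, 0, 1}" using abs_poly_legendre_le_1[of D P] by auto
    have "ev D x ^ ((CARD('a) ^ n - 1) div 2) = of_int (poly_legendre D P) ^ (\<Sum>i<k. Q ^ i)"
      unfolding e using euler_criterion[OF q P x, of D] by (simp add: power_mult Q_def)
    also have "\<dots> = of_int (poly_legendre D P ^ k)" using par[OF mem pos] by (metis of_int_power)
    finally have ev: "ev D x ^ ((CARD('a) ^ n - 1) div 2) = of_int (poly_legendre D P ^ k)" .
    have "\<bar>poly_legendre D P ^ k\<bar> \<le> 1" using abs_poly_legendre_le_1[of D P] by (simp add: power_abs power_le_one)
    moreover have "z \<in> {-1, 0, 1}" if "\<bar>z\<bar> \<le> 1" for z :: int using that by auto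
    ultimately have mem3: "poly_legendre D P ^ k \<in> {-1, 0, 1}" by blast
    have sgn3: "(if (of_int z :: 'a alg_closure) = 1 then 1 else if (of_int z :: 'a alg_closure) = - 1 then - 1 else 0) = z"
      if "z \<in> {-1, 0, 1}" for z :: int
      using that minus_one_neq_one_alg_closure[OF q] minus_one_neq_one_alg_closure[OF q, symmetric]
      by (elim insertE) simp_all
    show "eta TYPE('a) n (ev D x) = poly_legendre D P ^ k"
      unfolding eta_def ev by (rule sgn3[OF mem3])
  qed
  then show ?thesis by (simp add: Lam_def)
qed

lemma sum_degree_prime_powers:
  assumes "n > 0"
  shows "(\<Sum>(P, k)\<in>(prime_powers n :: ('a::finite_field poly \<times> nat) set). degree P) = CARD('a) ^ n"
proof -
  have "(\<Sum>x\<in>(fixed_field n :: 'a alg_closure set). 1) =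
      (\<Sum>(P, k)\<in>(prime_powers n :: ('a poly \<times> nat) set). of_nat (degree P) * 1 :: nat)"
    by (rule sum_fixed_field[OF assms, where H = "\<lambda>_ _. 1"]) simp
  then show ?thesis using card_fixed_field(2)[OF assms, where 'a = 'a] by simp
qed

section \<open>Stepanov's method\<close>

text \<open>Infinite descent at a prime \<open>P\<close> that divides \<open>f\<close> exactly once:
  \<open>P\<close> divides \<open>r\<close>, then \<open>s\<close>, and both can be divided by
  it.\<close>

lemma square_neq_squarefree_times_square:
  fixes f r s :: "'a::field poly"
  assumes f: "squarefree f" "degree f > 0" and rs: "r ^ 2 = f * s ^ 2" and s: "s \<noteq> 0"
  shows False
proof -
  obtain x where x: "ev f x = 0" using ev_root_exists f(2) by blast
  obtain P :: "'a poly" where P: "monic_irreducible P" "ev P x = 0" by (rule exists_monic_irreducible)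
  have P0: "P \<noteq> 0" using P monic_irreducible_nonzero by blast
  have "P dvd f" using monic_irreducible_dvd_iff[OF P] x by simp
  then obtain f' where f': "f = P * f'" by auto
  have "\<not> P dvd f'"
  proof
    assume "P dvd f'"
    then have "P ^ 2 dvd f" unfolding f' power2_eq_square by (rule mult_dvd_mono[OF dvd_refl])
    then show False using f(1) P(1) by (auto simp: squarefree_def monic_irreducible_def irreducible_def)
  qed
  then show False using rs s
  proof (induction "degree s" arbitrary: r s rule: less_induct)
    case less
    note dvd_iff = monic_irreducible_mult_dvd_iff[OF P(1)]
    have "P dvd r * r" using less.prems(2) by (simp add: f' power2_eq_square mult.assoc)
    then obtain r' where r': "r = P * r'" using dvd_iff by (auto elim: dvdE)
    have "P * (P * r' ^ 2) = P * (f' * s ^ 2)" using less.prems(2) by (simp add: r' f' power2_eq_square mult_ac)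
    then have eq: "P * r' ^ 2 = f' * s ^ 2" using P0 by simp
    then have "P dvd f' * (s * s)" by (metis dvd_triv_left power2_eq_square)
    then obtain s' where s': "s = P * s'" using dvd_iff less.prems(1) by (auto elim: dvdE)
    have "P * r' ^ 2 = P * (f * s' ^ 2)" using eq by (simp add: s' f' power2_eq_square mult_ac)
    then have "r' ^ 2 = f * s' ^ 2" using P0 by simp
    moreover have "s' \<noteq> 0" using less.prems(3) s' by auto
    moreover have "degree s' < degree s"
      using \<open>s' \<noteq> 0\<close> P0 monic_irreducible_degree_pos[OF P(1)] by (simp add: s' degree_mult_eq)
    ultimately show False using less.hyps less.prems(1) by blast
  qed
qed

text \<open>The coefficients of \<open>G\<close> are digits in base \<open>X^n\<close>; being
  shorter than the base, they cannot interfere with each other.\<close>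

lemma base_expansion_unique:
  fixes G :: "'a::field poly poly"
  assumes "\<And>i. degree (coeff G i) < n" "poly G (monom 1 n) = 0"
  shows "G = 0"
  using assms
proof (induction G)
  case (pCons c G)
  have c: "degree c < n" using pCons.prems(1)[of 0] by simp
  have eq: "c + monom 1 n * poly G (monom 1 n) = 0" using pCons.prems(2) by simp
  have "poly G (monom 1 n) = 0"
  proof (rule ccontr)
    assume nz: "poly G (monom 1 n) \<noteq> 0"
    have "c = - (monom 1 n * poly G (monom 1 n))" using eq by (simp add: eq_neg_iff_add_eq_0)
    then have "degree c = degree (monom 1 n * poly G (monom 1 n))" by simp
    also have "\<dots> \<ge> n" using nz by (simp add: degree_mult_eq degree_monom_eq)
    finally show False using c by simp
  qed
  moreover have "degree (coeff G i) < n" for i using pCons.prems(1)[of "Suc i"] by simp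
  ultimately have "G = 0" using pCons.IH by blast
  then show ?case using eq pCons.hyps by simp
qed simp

definition coeff_degree_le :: "nat \<Rightarrow> 'a::comm_ring_1 poly poly \<Rightarrow> bool" where
  "coeff_degree_le n G \<longleftrightarrow> (\<forall>i. degree (coeff G i) \<le> n)"

lemma coeff_degree_le_mult:
  assumes "coeff_degree_le a G" "coeff_degree_le b H"
  shows "coeff_degree_le (a + b) (G * H)"
  unfolding coeff_degree_le_def coeff_mult
proof (intro allI degree_sum_le)
  fix i j
  have "degree (coeff G j * coeff H (i - j)) \<le> degree (coeff G j) + degree (coeff H (i - j))"
    by (rule degree_mult_le)
  also have "\<dots> \<le> a + b" using assms by (intro add_mono) (auto simp: coeff_degree_le_def)
  finally show "degree (coeff G j * coeff H (i - j)) \<le> a + b" .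
qed auto

text \<open>The \<open>l\<close>-th power fixes constants, so \<open>f ^ l\<close> is
  \<open>f\<close> evaluated at \<open>X^l\<close>. In base \<open>X^l\<close> its digits are
  constants, and multiplication by it does not lengthen digits.\<close>

lemma frobenius_power_eq_poly:
  fixes f :: "'a::finite_field poly" and n :: nat
  defines "l \<equiv> CARD('a) ^ n"
  shows "f ^ l = poly (map_poly (\<lambda>c. [:c:]) f) (monom 1 l)"
proof (induction f)
  case (pCons c f)
  have "c ^ l = c" unfolding l_def by (rule finite_field_power_card_power_eq_same) simp
  have "pCons c f ^ l = ([:c:] + monom 1 1 * f) ^ l"
    by (simp add: monom_altdef)
  also have "\<dots> = [:c:] ^ l + (monom 1 1 * f) ^ l" unfolding l_def by (rule frobenius_poly_add)
  also have "\<dots> = [:c:] + monom 1 l * f ^ l"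
    using \<open>c ^ l = c\<close> by (simp add: power_mult_distrib monom_power poly_const_pow)
  finally show ?case using pCons by (simp add: map_poly_pCons)
qed (simp add: l_def zero_power)

text \<open>The field under study has \<open>l * l\<close> elements, so the map \<open>x\<close> to
  \<open>x ^ l\<close> is an involution on it. The number \<open>h\<close> is
  \<open>(l + 1) / 2\<close>, chosen so that \<open>f ^ (2 * h) = f * f ^ l\<close>; the lower bound
  on \<open>l\<close> gives \<open>h > m\<close>.\<close>

locale stepanov =
  fixes f :: "'a::finite_field poly" and \<nu> l h m :: nat
  assumes q: "odd CARD('a)" and f: "lead_coeff f = 1" "squarefree f" "degree f = m" "m \<ge> 1"
    and l: "l = CARD('a) ^ \<nu>" "l = 2 * h - 1" "l \<ge> 2 * m + 1"
begin

lemma h: "2 * h = l + 1" "h > m" using l f by auto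

text \<open>If the sum vanished, moving the terms with \<open>f ^ h\<close> to the other side and
  squaring would give \<open>G^2 = f * f^l * H^2\<close> at \<open>Y = X^l\<close>. All digits in
  base \<open>X^l\<close> are short enough for this to hold as an identity in a free variable
  \<open>Y\<close>, and its leading coefficients say \<open>r^2 = f * s^2\<close>, which is
  impossible for square-free \<open>f\<close> of positive degree.\<close>

lemma auxiliary_nonzero:
  fixes r s :: "nat \<Rightarrow> 'a poly"
  assumes r: "\<And>j. r j \<in> polys_below h" and s: "\<And>j. s j \<in> polys_below (h - m)"
    and nz: "\<exists>j<J. r j \<noteq> 0 \<or> s j \<noteq> 0"
  shows "(\<Sum>j<J. (r j + s j * f ^ h) * monom 1 (j * l)) \<noteq> 0"
proof
  assume W: "(\<Sum>j<J. (r j + s j * f ^ h) * monom 1 (j * l)) = 0"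
  define Y where "Y = (monom 1 l :: 'a poly)"
  define G H F where "G = (\<Sum>j<J. monom (r j) j)" and "H = (\<Sum>j<J. monom (s j) j)"
    and "F = map_poly (\<lambda>c. [:c:]) f"
  have coeffs: "coeff G i = (if i < J then r i else 0)" "coeff H i = (if i < J then s i else 0)" for i
    by (simp_all add: G_def H_def coeff_sum)
  have Yj: "monom 1 (j * l) = Y ^ j" for j by (simp add: Y_def monom_power mult.commute)
  have "poly G Y + f ^ h * poly H Y = 0"
    using W by (simp add: G_def H_def poly_sum poly_monom Yj sum_distrib_left sum.distrib distrib_left mult_ac)
  then have "poly G Y = - (f ^ h * poly H Y)" by (simp add: eq_neg_iff_add_eq_0)
  then have "poly G Y ^ 2 = f ^ (2 * h) * poly H Y ^ 2" by (simp add: power_mult_distrib mult.commute flip: power_mult)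
  also have "f ^ (2 * h) = f * poly F Y" unfolding h F_def Y_def l(1) by (simp add: frobenius_power_eq_poly)
  finally have zero: "poly (G ^ 2 - [:f:] * F * H ^ 2) (monom 1 l) = 0" by (simp add: Y_def)
  \<comment> \<open>The limits \<open>h\<close> and \<open>h - m\<close> on the degrees of
    \<open>r\<close> and \<open>s\<close> are made for this point: the digits have degrees at most
    \<open>2 * (h - 1) = l - 1\<close> and \<open>m + 2 * (h - m - 1) = l - 1 - m\<close>.\<close>
  have small: "degree (coeff (G ^ 2 - [:f:] * F * H ^ 2) i) < l" for i
  proof -
    have "coeff_degree_le (h - 1) G"
      unfolding coeff_degree_le_def
    proof
      fix i show "degree (coeff G i) \<le> h - 1" using r[of i] h by (auto simp: coeffs polys_below_iff_degree)
    qed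
    moreover have "coeff_degree_le (h - m - 1) H"
      unfolding coeff_degree_le_def
    proof
      fix i show "degree (coeff H i) \<le> h - m - 1" using s[of i] h by (auto simp: coeffs polys_below_iff_degree)
    qed
    ultimately have GH: "coeff_degree_le (h - 1 + (h - 1)) (G ^ 2)" "coeff_degree_le (h - m - 1 + (h - m - 1)) (H ^ 2)"
      unfolding power2_eq_square by (auto intro: coeff_degree_le_mult)
    have "coeff_degree_le m [:f:]" "coeff_degree_le 0 F"
      using f by (auto simp: coeff_degree_le_def F_def coeff_map_poly coeff_pCons split: nat.split)
    then have "coeff_degree_le (m + 0 + (h - m - 1 + (h - m - 1))) ([:f:] * F * H ^ 2)"
      using GH(2) by (intro coeff_degree_le_mult)
    then have "degree (coeff ([:f:] * F * H ^ 2) i) \<le> m + 0 + (h - m - 1 + (h - m - 1))"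
      by (simp only: coeff_degree_le_def)
    then have "degree (coeff ([:f:] * F * H ^ 2) i) < l" using h by linarith
    moreover have "degree (coeff (G ^ 2) i) \<le> h - 1 + (h - 1)"
      using GH(1) by (simp only: coeff_degree_le_def)
    then have "degree (coeff (G ^ 2) i) < l" using h by linarith
    ultimately show ?thesis unfolding coeff_diff by (rule degree_diff_less[rotated])
  qed
  have "G ^ 2 - [:f:] * F * H ^ 2 = 0" by (rule base_expansion_unique[OF small zero])
  then have eq: "G ^ 2 = [:f:] * F * H ^ 2" by simp
  have H0: "H \<noteq> 0"
  proof
    assume "H = 0"
    then have "G = 0" using eq by simp
    then show False using nz coeffs \<open>H = 0\<close> by (metis coeff_0)
  qed
  have "degree F = degree f" unfolding F_def by (rule degree_map_poly) simp
  then have "lead_coeff F = 1" using f(1) by (simp add: F_def coeff_map_poly one_pCons)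
  then have "lead_coeff ([:f:] * F * H ^ 2) = f * lead_coeff H ^ 2"
    by (simp only: lead_coeff_mult lead_coeff_power lead_coeff_pCons if_True) simp
  then have "lead_coeff G ^ 2 = f * lead_coeff H ^ 2"
    by (simp only: eq[symmetric] lead_coeff_power)
  then show False using square_neq_squarefree_times_square[of f "lead_coeff G" "lead_coeff H"] f H0 by simp
qed

text \<open>
  The polynomials \<open>r\<^sub>j\<close>, \<open>s\<^sub>j\<close> come from the pigeonhole principle: there are more of them than
  possible values of the left-hand side.
\<close>

lemma auxiliary_exists:
  fixes a :: 'a and J :: nat
  assumes J: "J = h + m"
  obtains r s :: "nat \<Rightarrow> 'a poly"
  where "\<And>j. r j \<in> polys_below h" "\<And>j. s j \<in> polys_below (h - m)" "\<exists>j<J. r j \<noteq> 0 \<or> s j \<noteq> 0"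
    "(\<Sum>j<J. (r j ^ l + smult a (s j ^ l * f ^ h)) * monom 1 j) = 0"
proof -
  define \<Omega> where "\<Omega> = PiE {..<J} (\<lambda>_. (polys_below h :: 'a poly set) \<times> (polys_below (h - m) :: 'a poly set))"
  define T where "T w = (\<Sum>j<J. (fst (w j) ^ l + smult a (snd (w j) ^ l * f ^ h)) * monom 1 j)" for w :: "nat \<Rightarrow> 'a poly \<times> 'a poly"
  let ?N = "l * (h - 1) + J"
  have l0: "l > 0" using l f by simp
  have card\<Omega>: "card \<Omega> = CARD('a) ^ (J * (2 * h - m))"
  proof -
    have "h + (h - m) = 2 * h - m" using h by simp
    then show ?thesis
      by (simp add: \<Omega>_def card_PiE card_polys_below card_cartesian_product mult.commute[of J] power_mult flip: power_add)
  qed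
  have img: "T ` \<Omega> \<subseteq> polys_below ?N"
  proof
    fix t assume "t \<in> T ` \<Omega>"
    then obtain w where w: "w \<in> \<Omega>" "t = T w" by blast
    have tm: "(fst (w j) ^ l + smult a (snd (w j) ^ l * f ^ h)) * monom 1 j \<in> polys_below ?N" if j: "j < J" for j
    proof -
      have rs: "fst (w j) \<in> polys_below h" "snd (w j) \<in> polys_below (h - m)"
        using w(1) j unfolding \<Omega>_def by (auto simp: PiE_def Pi_def mem_Times_iff)
      have "degree (fst (w j) ^ l) \<le> l * (h - 1)"
      proof (cases "fst (w j) = 0")
        case False
        then have "degree (fst (w j)) \<le> h - 1" using rs(1) by (auto simp: polys_below_iff_degree)
        then show ?thesis using False by (simp add: degree_power_eq)
      qed (use l0 in \<open>simp add: zero_power\<close>)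
      moreover have "degree (smult a (snd (w j) ^ l * f ^ h)) \<le> l * (h - 1)"
      proof (cases "snd (w j) = 0")
        case False
        then have "degree (snd (w j)) \<le> h - m - 1" using rs(2) by (auto simp: polys_below_iff_degree)
        then have "degree (snd (w j) ^ l) \<le> l * (h - m - 1)" using False by (simp add: degree_power_eq)
        moreover have "degree (f ^ h) \<le> l * m"
          using f h by (subst degree_power_eq) (auto simp: mult.commute)
        moreover have "l * (h - m - 1) + l * m = l * (h - 1)" using h by (simp flip: distrib_left)
        ultimately have "degree (snd (w j) ^ l * f ^ h) \<le> l * (h - 1)"
          using degree_mult_le[of "snd (w j) ^ l" "f ^ h"] by linarith
        then show ?thesis using degree_smult_le le_trans by blast
      qed (use l0 in \<open>simp add: zero_power\<close>)
      ultimately have "degree (fst (w j) ^ l + smult a (snd (w j) ^ l * f ^ h)) \<le> l * (h - 1)"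
        by (rule degree_add_le)
      then have "degree ((fst (w j) ^ l + smult a (snd (w j) ^ l * f ^ h)) * monom 1 j) \<le> l * (h - 1) + j"
        by (intro order.trans[OF degree_mult_le] add_mono degree_monom_le)
      then show ?thesis using j by (auto simp: polys_below_iff_degree)
    qed
    show "t \<in> polys_below ?N"
      unfolding w(2) T_def using tm by (auto simp: polys_below_def coeff_sum intro!: sum.neutral)
  qed
  \<comment> \<open>With \<open>J = h + m\<close> the number of free coefficients exceeds the number
    of conditions by \<open>m * (h - m) + 2 * h - 1 - m\<close>, which is positive as
    \<open>h > m\<close>. It matters that \<open>J\<close> is close to \<open>h\<close>: the final
    count is about \<open>J * l\<close>, half of the field.\<close>
  have "?N < J * (2 * h - m)"
  proof -
    obtain k where k: "h = Suc (m + k)" using h(2) less_imp_Suc_add by blast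
    then have "l = 2 * m + 2 * k + 1" using h(1) by simp
    then show ?thesis using l(3) unfolding J k by (simp add: algebra_simps)
  qed
  then have "CARD('a) ^ ?N < CARD('a) ^ (J * (2 * h - m))"
    using CARD_ge_2[where 'a='a] by (intro power_strict_increasing) auto
  then have "\<not> inj_on T \<Omega>"
    using card_inj_on_le[OF _ img card_polys_below(1)] by (auto simp: card\<Omega> card_polys_below)
  then obtain v w where vw: "v \<in> \<Omega>" "w \<in> \<Omega>" "v \<noteq> w" "T v = T w" by (auto simp: inj_on_def)
  have mem: "fst (u j) \<in> polys_below h" "snd (u j) \<in> polys_below (h - m)" if "u \<in> \<Omega>" "j < J" for u j
    using that unfolding \<Omega>_def by (auto simp: PiE_def Pi_def mem_Times_iff)
  define r s where "r j = (if j < J then fst (v j) - fst (w j) else 0)"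
    and "s j = (if j < J then snd (v j) - snd (w j) else 0)" for j
  show ?thesis
  proof (rule that)
    show "r j \<in> polys_below h" "s j \<in> polys_below (h - m)" for j
      using mem[OF vw(1), of j] mem[OF vw(2), of j] by (auto simp: r_def s_def polys_below_def)
    obtain j where "v j \<noteq> w j" using vw(3) by auto
    moreover have "j < J" using calculation vw(1,2) unfolding \<Omega>_def by (metis PiE_arb lessThan_iff)
    ultimately show "\<exists>j<J. r j \<noteq> 0 \<or> s j \<noteq> 0" by (auto simp: r_def s_def prod_eq_iff)
    \<comment> \<open>\<open>l\<close> is a power of \<open>CARD('a)\<close>, so \<open>T\<close> is
      additive and a collision of two values becomes a nontrivial zero.\<close>
    have "(\<Sum>j<J. (r j ^ l + smult a (s j ^ l * f ^ h)) * monom 1 j) = T v - T w"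
      unfolding T_def sum_subtractf[symmetric]
      by (intro sum.cong refl) (simp add: r_def s_def l(1) frobenius_poly_diff algebra_simps smult_diff_right)
    then show "(\<Sum>j<J. (r j ^ l + smult a (s j ^ l * f ^ h)) * monom 1 j) = 0" using vw(4) by simp
  qed
qed

text \<open>Where \<open>f\<close> raised to half the group order takes the value \<open>a\<close>,
  this identity gives \<open>f ^ (h * l) = a * f ^ h\<close>: the \<open>l\<close>-th power of
  \<open>f ^ h\<close> is again a multiple of \<open>f ^ h\<close>.\<close>

lemma half_card: "(CARD('a) ^ (2 * \<nu>) - 1) div 2 + h = h * l" "CARD('a) ^ (2 * \<nu>) = l * l"
proof -
  show *: "CARD('a) ^ (2 * \<nu>) = l * l" by (simp add: l(1) mult_2 power_add)
  have "h > 0" using h by simp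
  then obtain k where "h = Suc k" by (cases h) auto
  then show "(CARD('a) ^ (2 * \<nu>) - 1) div 2 + h = h * l"
    unfolding * l(2) by (simp add: algebra_simps)
qed

text \<open>Every point of the set is a root of the nonzero polynomial \<open>W\<close>, because the
  \<open>l\<close>-th power of \<open>W\<close> there equals the value of the polynomial that was
  arranged to vanish identically. The degree of \<open>W\<close> is half of \<open>l * l\<close> up
  to a multiple of \<open>l\<close>.\<close>

lemma card_le:
  assumes nu: "\<nu> > 0"
  shows "2 * card {x \<in> fixed_field (2 * \<nu>). ev f x ^ ((CARD('a) ^ (2 * \<nu>) - 1) div 2) = to_ac a}
    \<le> l * l + (4 * m + 3) * l"
proof -
  define J where "J = h + m"
  let ?S = "{x \<in> fixed_field (2 * \<nu>). ev f x ^ ((CARD('a) ^ (2 * \<nu>) - 1) div 2) = to_ac a}"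
  obtain r s :: "nat \<Rightarrow> 'a poly" where rs: "\<And>j. r j \<in> polys_below h" "\<And>j. s j \<in> polys_below (h - m)"
    "\<exists>j<J. r j \<noteq> 0 \<or> s j \<noteq> 0" "(\<Sum>j<J. (r j ^ l + smult a (s j ^ l * f ^ h)) * monom 1 j) = 0"
    using auxiliary_exists[OF J_def, of a] by blast
  define W where "W = (\<Sum>j<J. (r j + s j * f ^ h) * monom 1 (j * l))"
  have W0: "W \<noteq> 0" unfolding W_def by (rule auxiliary_nonzero[OF rs(1,2,3)])
  have "ev W x = 0" if x: "x \<in> ?S" for x
  proof -
    have xl: "x ^ (l * l) = x" and fx: "ev f x ^ ((CARD('a) ^ (2 * \<nu>) - 1) div 2) = to_ac a"
      using x half_card(2) by (auto simp: fixed_field_def)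
    have fhl: "ev f x ^ (h * l) = to_ac a * ev f x ^ h"
      unfolding half_card(1)[symmetric] power_add fx ..
    have "ev W x ^ l = (\<Sum>j<J. ((ev (r j) x + ev (s j) x * ev f x ^ h) * x ^ (j * l)) ^ l)"
      unfolding W_def ev_sum l(1) frobenius_sum by simp
    also have "\<dots> = (\<Sum>j<J. (ev (r j) x ^ l + ev (s j) x ^ l * (to_ac a * ev f x ^ h)) * x ^ j)"
    proof (intro sum.cong refl)
      fix j
      \<comment> \<open>The large exponents \<open>j * l\<close> collapse to \<open>j\<close> on the
        field with \<open>l * l\<close> elements; this is how a polynomial of large degree is tested
        by a low-degree identity.\<close>
      have "(x ^ (j * l)) ^ l = (x ^ (l * l)) ^ j" by (simp add: mult_ac flip: power_mult)
      then show "((ev (r j) x + ev (s j) x * ev f x ^ h) * x ^ (j * l)) ^ l =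
          (ev (r j) x ^ l + ev (s j) x ^ l * (to_ac a * ev f x ^ h)) * x ^ j"
        using fhl frobenius_add[of "ev (r j) x" "ev (s j) x * ev f x ^ h" \<nu>]
        by (simp add: power_mult_distrib xl l(1)[symmetric] flip: power_mult)
    qed
    also have "\<dots> = ev (\<Sum>j<J. (r j ^ l + smult a (s j ^ l * f ^ h)) * monom 1 j) x"
      by (simp add: ev_sum mult_ac)
    also have "\<dots> = 0" unfolding rs(4) by simp
    finally show ?thesis using l f by simp
  qed
  then have "?S \<subseteq> {x. ev W x = 0}" by blast
  then have "card ?S \<le> card {x. ev W x = 0}" by (intro card_mono card_ev_roots(1)[OF W0])
  also have "\<dots> \<le> degree W" by (rule card_ev_roots(2)[OF W0])
  also have "degree W \<le> (m + 1) * h + J * l"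
    unfolding W_def
  proof (intro degree_sum_le)
    fix j assume "j \<in> {..<J}"
    have "degree (r j) \<le> (m + 1) * h" using rs(1)[of j] by (auto simp: polys_below_iff_degree)
    moreover have "degree (s j * f ^ h) \<le> (m + 1) * h"
    proof -
      have "degree (s j) \<le> h" using rs(2)[of j] by (auto simp: polys_below_iff_degree)
      moreover have "degree (f ^ h) \<le> m * h" using degree_power_le[of f h] f by simp
      ultimately show ?thesis using degree_mult_le[of "s j" "f ^ h"] by simp
    qed
    ultimately have "degree (r j + s j * f ^ h) \<le> (m + 1) * h" by (rule degree_add_le)
    moreover have "degree (monom (1::'a) (j * l)) \<le> J * l"
      using \<open>j \<in> _\<close> by (intro order.trans[OF degree_monom_le]) simp
    ultimately show "degree ((r j + s j * f ^ h) * monom 1 (j * l)) \<le> (m + 1) * h + J * l"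
      using degree_mult_le add_mono order.trans by blast
  qed simp
  also have "\<dots> \<le> (m + 1) * l + J * l"
  proof -
    have "h \<le> l" using h f by simp
    then show ?thesis by (intro add_mono mult_le_mono) auto
  qed
  finally have "2 * card ?S \<le> 2 * ((m + 1) * l + J * l)" by simp
  also have "\<dots> = (2 * h) * l + (4 * m + 2) * l" unfolding J_def by (simp add: algebra_simps)
  also have "\<dots> = l * l + (4 * m + 3) * l" unfolding h(1) by (simp add: algebra_simps)
  finally show ?thesis .
qed

text \<open>The points with character value \<open>1\<close>, those with value \<open>-1\<close> and
  at most \<open>m\<close> zeros exhaust the field. An upper bound near one half for each of the two
  classes therefore also bounds each from below, and their difference is small.\<close>

lemma Lam_bound:
  assumes nu: "\<nu> > 0"
  shows "\<bar>Lam f (2 * \<nu>)\<bar> \<le> (5 * int m + 3) * int l"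
proof -
  let ?F = "fixed_field (2 * \<nu>) :: 'a alg_closure set" and ?e = "(CARD('a) ^ (2 * \<nu>) - 1) div 2"
  define N where "N a = {x \<in> ?F. ev f x ^ ?e = a}" for a
  define Z where "Z = {x \<in> ?F. ev f x = 0}"
  have finF: "finite ?F" using card_fixed_field[of "2 * \<nu>"] nu by simp
  have fin: "finite (N a)" "finite Z" for a using finF by (auto simp: N_def Z_def)
  have e0: "?e > 0"
  proof -
    have "l > 1" using l(3) f(4) by simp
    then have "l * l > 1" by (intro less_1_mult)
    moreover have "even (l + 1)" using h(1) by (metis dvd_triv_left)
    then have "odd (l * l)" by simp
    ultimately show ?thesis unfolding half_card(2) by (elim oddE) simp
  qed
  have two_e: "2 * ?e + 1 = CARD('a) ^ (2 * \<nu>)" using q by simp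
  note m1 = minus_one_neq_one_alg_closure[OF q]
  have F: "?F = N 1 \<union> (N (- 1) \<union> Z)"
  proof
    show "?F \<subseteq> N 1 \<union> (N (- 1) \<union> Z)"
    proof
      fix x assume x: "x \<in> ?F"
      show "x \<in> N 1 \<union> (N (- 1) \<union> Z)"
      proof (cases "ev f x = 0")
        case False
        define y where "y = ev f x"
        have "y ^ (2 * ?e + 1) = y" using fixed_field_ev[OF x, of f] unfolding two_e by (simp add: fixed_field_def y_def)
        then have "y ^ (2 * ?e) * y = 1 * y" by simp
        then have "y ^ (2 * ?e) = 1" using False by (subst (asm) mult_right_cancel) (simp_all add: y_def)
        then have "(y ^ ?e) ^ 2 = 1" by (simp add: mult.commute flip: power_mult)
        then show ?thesis using x by (auto simp: power2_eq_1_iff N_def y_def)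
      qed (use x in \<open>simp add: Z_def\<close>)
    qed
  qed (auto simp: N_def Z_def)
  have disj: "N 1 \<inter> (N (- 1) \<union> Z) = {}" "N (- 1) \<inter> Z = {}"
    using m1 e0 by (auto simp: N_def Z_def zero_power)
  have total: "l * l = card (N 1) + (card (N (- 1)) + card Z)"
    using card_fixed_field(2)[of "2 * \<nu>", where 'a = 'a] nu half_card(2) F disj fin
    by (simp add: card_Un_disjoint)
  have f0: "f \<noteq> 0" using f by auto
  have "card Z \<le> card {x. ev f x = 0}"
    by (intro card_mono card_ev_roots(1)[OF f0]) (auto simp: Z_def)
  then have Zm: "card Z \<le> m" using card_ev_roots(2)[OF f0] f(3) by simp
  have N1: "2 * card (N 1) \<le> l * l + (4 * m + 3) * l" using card_le[OF nu, of 1] by (simp add: N_def)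
  have N2: "2 * card (N (- 1)) \<le> l * l + (4 * m + 3) * l" using card_le[OF nu, of "- 1"] by (simp add: N_def)
  have "Lam f (2 * \<nu>) = (\<Sum>x\<in>?F. eta TYPE('a) (2 * \<nu>) (ev f x))"
    using Lam_eq_sum_eta[OF q] nu by simp
  also have "\<dots> = (\<Sum>x\<in>N 1. eta TYPE('a) (2 * \<nu>) (ev f x)) +
      ((\<Sum>x\<in>N (- 1). eta TYPE('a) (2 * \<nu>) (ev f x)) + (\<Sum>x\<in>Z. eta TYPE('a) (2 * \<nu>) (ev f x)))"
    using F disj fin by (simp add: sum.union_disjoint)
  also have "(\<Sum>x\<in>N 1. eta TYPE('a) (2 * \<nu>) (ev f x)) = (\<Sum>x\<in>N 1. 1)"
    by (rule sum.cong) (auto simp: N_def eta_def)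
  also have "(\<Sum>x\<in>N (- 1). eta TYPE('a) (2 * \<nu>) (ev f x)) = (\<Sum>x\<in>N (- 1). - 1)"
    using m1 by (intro sum.cong) (auto simp: N_def eta_def)
  also have "(\<Sum>x\<in>Z. eta TYPE('a) (2 * \<nu>) (ev f x)) = 0"
    using e0 by (intro sum.neutral) (auto simp: Z_def eta_def zero_power)
  finally have L: "Lam f (2 * \<nu>) = int (card (N 1)) - int (card (N (- 1)))" by simp
  have "int m \<le> int m * int l" using l(3) f(4) by simp
  moreover have "int (l * l) = int (card (N 1)) + (int (card (N (- 1))) + int (card Z))" using total by simp
  moreover have "2 * int (card (N 1)) \<le> int (l * l) + (4 * int m + 3) * int l"
    using of_nat_mono[OF N1, where 'a = int] by (simp add: algebra_simps)
  moreover have "2 * int (card (N (- 1))) \<le> int (l * l) + (4 * int m + 3) * int l"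
    using of_nat_mono[OF N2, where 'a = int] by (simp add: algebra_simps)
  moreover have "int (card Z) \<le> int m" using Zm by simp
  ultimately show ?thesis unfolding L abs_le_iff by (simp add: algebra_simps)
qed

end

theorem Lam_even_bound:
  fixes D :: "'a::finite_field poly"
  assumes q: "odd CARD('a)" and D: "lead_coeff D = 1" "squarefree D" "degree D \<ge> 1"
    and nu: "\<nu> > 0" "CARD('a) ^ \<nu> \<ge> 2 * degree D + 1"
  shows "\<bar>Lam D (2 * \<nu>)\<bar> \<le> (5 * int (degree D) + 3) * int (CARD('a) ^ \<nu>)"
proof -
  interpret stepanov D \<nu> "CARD('a) ^ \<nu>" "(CARD('a) ^ \<nu> + 1) div 2" "degree D"
    using assms by unfold_locales auto
  show ?thesis using Lam_bound[OF nu(1)] by simp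
qed

section \<open>The Riemann hypothesis for the L-function\<close>

text \<open>
  Applying the difference operator whose characteristic polynomial vanishes at all other terms
  isolates a single geometric sequence.
\<close>

lemma power_sums_bounded_imp_norm_le:
  fixes B :: "complex multiset"
  assumes bnd: "\<And>n. n \<ge> n0 \<Longrightarrow> norm (\<Sum>\<beta>\<in>#B. \<beta> ^ n) \<le> C * \<rho> ^ n" and \<rho>: "\<rho> > 0" and \<beta>: "\<beta> \<in># B"
  shows "norm \<beta> \<le> \<rho>"
proof (rule ccontr)
  assume "\<not> norm \<beta> \<le> \<rho>"
  then have gt: "norm \<beta> / \<rho> > 1" using \<rho> by simp
  define T where "T = (\<Prod>\<gamma>\<in>set_mset B - {\<beta>}. [:- \<gamma>, 1:])"
  have T0: "poly T \<gamma> = 0" if "\<gamma> \<in># B" "\<gamma> \<noteq> \<beta>" for \<gamma>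
    using that unfolding T_def poly_prod by (intro prod_zero) (auto intro!: bexI[of _ \<gamma>])
  have T\<beta>: "poly T \<beta> \<noteq> 0" unfolding T_def poly_prod by (simp add: prod_zero_iff)
  have sum0: "(\<Sum>\<gamma>\<in>#B'. \<gamma> ^ n * poly T \<gamma>) = of_nat (count B' \<beta>) * \<beta> ^ n * poly T \<beta>"
    if "set_mset B' \<subseteq> set_mset B" for B' n
    using that
  proof (induction B')
    case (add x B')
    then show ?case using T0[of x] by (cases "x = \<beta>") (auto simp: algebra_simps)
  qed simp
  have expand: "(\<Sum>i\<le>degree T. coeff T i * (\<Sum>\<gamma>\<in>#B'. \<gamma> ^ (n + i))) = (\<Sum>\<gamma>\<in>#B'. \<gamma> ^ n * poly T \<gamma>)" for B' n
  proof (induction B')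
    case (add x B')
    have "(\<Sum>i\<le>degree T. coeff T i * x ^ (n + i)) = x ^ n * poly T x"
      by (simp add: poly_altdef sum_distrib_left power_add mult_ac)
    then show ?case using add by (simp add: distrib_left sum.distrib)
  qed simp
  define K where "K = (\<Sum>i\<le>degree T. norm (coeff T i) * (C * \<rho> ^ i))"
  have "norm \<beta> ^ n * norm (poly T \<beta>) \<le> K * \<rho> ^ n" if n: "n \<ge> n0" for n
  proof -
    have cnt: "real (count B \<beta>) \<ge> 1" using \<beta> by (simp add: Suc_le_eq)
    have "norm \<beta> ^ n * norm (poly T \<beta>) \<le> real (count B \<beta>) * (norm \<beta> ^ n * norm (poly T \<beta>))"
      using mult_right_mono[OF cnt, of "norm \<beta> ^ n * norm (poly T \<beta>)"] by simp
    also have "\<dots> = norm (\<Sum>\<gamma>\<in>#B. \<gamma> ^ n * poly T \<gamma>)"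
      unfolding sum0[OF order_refl] by (simp add: norm_mult norm_power mult.assoc)
    also have "\<dots> \<le> (\<Sum>i\<le>degree T. norm (coeff T i) * norm (\<Sum>\<gamma>\<in>#B. \<gamma> ^ (n + i)))"
      unfolding expand[symmetric] by (rule order.trans[OF norm_sum]) (simp add: norm_mult)
    also have "\<dots> \<le> (\<Sum>i\<le>degree T. norm (coeff T i) * (C * \<rho> ^ (n + i)))"
      using n by (intro sum_mono mult_left_mono bnd) auto
    also have "\<dots> = K * \<rho> ^ n" by (simp add: K_def sum_distrib_left sum_distrib_right power_add mult_ac)
    finally show ?thesis .
  qed
  then have le: "(norm \<beta> / \<rho>) ^ n \<le> K / norm (poly T \<beta>)" if "n \<ge> n0" for n
    using that \<rho> T\<beta> by (simp add: power_divide field_simps)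
  obtain k where "K / norm (poly T \<beta>) < (norm \<beta> / \<rho>) ^ k" using real_arch_pow[OF gt] by blast
  also have "\<dots> \<le> (norm \<beta> / \<rho>) ^ max k n0" using gt by (intro power_increasing) auto
  finally show False using le[of "max k n0"] by simp
qed

text \<open>Even-degree extensions control the power sums of the squares
  \<open>\<alpha> ^ 2\<close>, which grow at most like a constant times \<open>CARD('a) ^ n\<close>.
  That bounds \<open>norm (\<alpha> ^ 2)\<close> by \<open>CARD('a)\<close>, and the size of the
  constant has no influence.\<close>

theorem L_poly_RH:
  fixes D :: "'a::finite_field poly"
  assumes q: "odd CARD('a)" and D: "lead_coeff D = 1" "squarefree D" "degree D \<ge> 1"
  obtains A :: "complex multiset" where "size A < degree D" "L_poly D = (\<Prod>\<alpha>\<in>#A. [:1, - \<alpha>:])"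
    "\<And>n. n > 0 \<Longrightarrow> of_int (Lam D n) = - (\<Sum>\<alpha>\<in>#A. \<alpha> ^ n)"
    "\<And>\<alpha>. \<alpha> \<in># A \<Longrightarrow> norm \<alpha> \<le> sqrt (real CARD('a))"
proof -
  obtain A :: "complex multiset" where A: "size A < degree D" "L_poly D = (\<Prod>\<alpha>\<in>#A. [:1, - \<alpha>:])"
    "\<And>n. n > 0 \<Longrightarrow> of_int (Lam D n) = - (\<Sum>\<alpha>\<in>#A. \<alpha> ^ n)"
    using L_poly_factorization[OF q D] by blast
  have "norm \<alpha> \<le> sqrt (real CARD('a))" if \<alpha>: "\<alpha> \<in># A" for \<alpha>
  proof -
    have "norm (\<alpha> ^ 2) \<le> real CARD('a)"
    proof (rule power_sums_bounded_imp_norm_le)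
      show "\<alpha> ^ 2 \<in># image_mset (\<lambda>x. x ^ 2) A" using \<alpha> by simp
      fix n assume n: "n \<ge> 2 * degree D + 1"
      have "2 * degree D + 1 \<le> 2 ^ n" using n less_exp[of n] by linarith
      also have "\<dots> \<le> CARD('a) ^ n" using CARD_ge_2[where 'a='a] by (intro power_mono) auto
      finally have big: "CARD('a) ^ n \<ge> 2 * degree D + 1" .
      have "(\<Sum>\<beta>\<in>#image_mset (\<lambda>x. x ^ 2) A. \<beta> ^ n) = (\<Sum>\<alpha>\<in>#A. \<alpha> ^ (2 * n))"
        by (simp add: image_mset.compositionality comp_def power_mult)
      also have "\<dots> = - of_int (Lam D (2 * n))" using A(3)[of "2 * n"] n by simp
      finally have "norm (\<Sum>\<beta>\<in>#image_mset (\<lambda>x. x ^ 2) A. \<beta> ^ n) = real_of_int \<bar>Lam D (2 * n)\<bar>"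
        by (simp add: norm_of_int)
      also have "\<dots> \<le> real_of_int ((5 * int (degree D) + 3) * int (CARD('a) ^ n))"
        using Lam_even_bound[OF q D _ big] n by (simp only: of_int_le_iff)
      also have "\<dots> = (5 * real (degree D) + 3) * real CARD('a) ^ n" by simp
      finally show "norm (\<Sum>\<beta>\<in>#image_mset (\<lambda>x. x ^ 2) A. \<beta> ^ n) \<le> (5 * real (degree D) + 3) * real CARD('a) ^ n" .
    qed simp
    then show ?thesis by (simp add: norm_power real_le_rsqrt)
  qed
  then show ?thesis using that A by blast
qed

section \<open>A trigonometric majorant\<close>

text \<open>Half of the analytic form of the Fejer kernel: on the unit circle twice its real part is
  \<open>norm (\<Sum>n<m. z ^ n) ^ 2\<close>.\<close>

definition fejer :: "nat \<Rightarrow> complex \<Rightarrow> complex" where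
  "fejer m z = of_nat m / 2 + (\<Sum>n\<in>{1..<m}. of_nat (m - n) * z ^ n)"

lemma fejer_Suc: "fejer (Suc m) z = fejer m z + 1 / 2 + (\<Sum>n\<in>{1..m}. z ^ n)"
proof -
  have "(\<Sum>n\<in>{1..<Suc m}. of_nat (Suc m - n) * z ^ n) = (\<Sum>n\<in>{1..m}. of_nat (m - n) * z ^ n + z ^ n)"
    by (intro sum.cong) (auto simp: Suc_diff_le algebra_simps)
  also have "\<dots> = (\<Sum>n\<in>{1..m}. of_nat (m - n) * z ^ n) + (\<Sum>n\<in>{1..m}. z ^ n)" by (rule sum.distrib)
  also have "(\<Sum>n\<in>{1..m}. of_nat (m - n) * z ^ n) = (\<Sum>n\<in>{1..<m}. of_nat (m - n) * z ^ n)"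
    by (rule sum.mono_neutral_right) auto
  finally show ?thesis unfolding fejer_def by (simp add: add_divide_distrib)
qed

text \<open>Equality holds on the circle. Inside the disc the induction step replaces
  \<open>norm (z * s)\<close> by the larger \<open>norm s\<close>, which acts in the right
  direction.\<close>

lemma fejer_nonneg:
  assumes z: "norm z \<le> 1"
  shows "2 * Re (fejer m z) \<ge> norm (\<Sum>n<m. z ^ n) ^ 2"
proof (induction m)
  case (Suc m)
  let ?s = "\<Sum>n<m. z ^ n"
  have shift: "(\<Sum>n\<in>{1..m}. z ^ n) = z * ?s"
    by (simp add: sum_distrib_left sum.atLeast1_atMost_eq)
  have s: "(\<Sum>n<Suc m. z ^ n) = 1 + z * ?s"
    by (subst sum.lessThan_Suc_shift) (simp add: sum_distrib_left)
  have "norm (1 + z * ?s) ^ 2 = 1 + 2 * Re (z * ?s) + norm (z * ?s) ^ 2"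
    unfolding cmod_power2 by (simp add: power2_eq_square algebra_simps)
  also have "norm (z * ?s) ^ 2 \<le> norm ?s ^ 2"
    using z by (intro power_mono) (auto simp: norm_mult mult_left_le_one_le)
  finally show ?case using Suc unfolding s fejer_Suc shift by simp
qed (simp add: fejer_def)

text \<open>The product of two triangular weights is chosen so that passing from \<open>N\<close> to
  \<open>N + 1\<close> changes \<open>maj_coeff N n / n\<close> by a multiple of
  \<open>N + 1 - n\<close>, the coefficient of a Fejer kernel, with a factor independent of
  \<open>n\<close>.\<close>

definition maj_coeff :: "nat \<Rightarrow> nat \<Rightarrow> real" where
  "maj_coeff N n = (1 - real n / real N) * (1 - real n / real (N + 1))"

lemma maj_coeff_bounds:
  assumes "n \<le> N"
  shows "0 \<le> maj_coeff N n" "maj_coeff N n \<le> 1"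
proof -
  have "real n / real N \<le> 1" "real n / real (N + 1) \<le> 1" using assms by (auto simp: divide_le_eq_1)
  then show "0 \<le> maj_coeff N n" "maj_coeff N n \<le> 1"
    unfolding maj_coeff_def by (auto intro: mult_le_one)
qed

text \<open>
  The defect in the majorant \<open>norm (1 - z) \<le> exp (defect)\<close>; its increments in \<open>N\<close> are multiples of
  Fejer kernels.
\<close>

definition maj_defect :: "nat \<Rightarrow> complex \<Rightarrow> real" where
  "maj_defect N z = (2 * real N + 1) / (2 * real N * (real N + 1)) - ln (norm (1 - z))
     - Re (\<Sum>n\<in>{1..N}. of_real (maj_coeff N n / real n) * z ^ n)"

lemma maj_coeff_step:
  fixes x y :: real
  assumes "x > 0" "y > 0"
  shows "(1 - y / (x + 1)) * (1 - y / (x + 1 + 1)) / y =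
    (1 - y / x) * (1 - y / (x + 1)) / y + 2 / (x * (x + 1) * (x + 2)) * (x + 1 - y)"
proof -
  have e: "(1 - y / a) * (1 - y / b) / y = 1 / y - 1 / a - 1 / b + y / (a * b)" if "a > 0" "b > 0" for a b
    using assms(2) that by (simp add: field_simps)
  have "y / ((x + 1) * (x + 2)) - 1 / (x + 2) = y / (x * (x + 1)) - 1 / x + 2 / (x * (x + 1) * (x + 2)) * (x + 1 - y)"
  proof -
    have nz: "x \<noteq> 0" "x + 1 \<noteq> 0" "x + 2 \<noteq> 0" using assms by auto
    show ?thesis by (simp add: nz divide_simps) (simp add: algebra_simps)
  qed
  then show ?thesis using assms(1) e[of "x + 1" "x + 2"] e[of x "x + 1"] by (simp add: add.assoc)
qed

lemma maj_defect_step: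
  fixes x :: real
  assumes "x > 0"
  shows "(2 * x + 1) / (2 * x * (x + 1)) =
    (2 * (x + 1) + 1) / (2 * (x + 1) * (x + 1 + 1)) + 2 / (x * (x + 1) * (x + 2)) * ((x + 1) / 2)"
proof -
  have halves: "(a + b) / (2 * a * b) = 1 / (2 * a) + 1 / (2 * b)" if "a > 0" "b > 0" for a b :: real
    using that by (simp add: field_simps)
  have "(2 * x + 1) / (2 * x * (x + 1)) = 1 / (2 * x) + 1 / (2 * (x + 1))"
    using halves[of x "x + 1"] assms by (simp only: add.assoc[symmetric] mult_2[symmetric])
  moreover have "(2 * (x + 1) + 1) / (2 * (x + 1) * (x + 1 + 1)) = 1 / (2 * (x + 1)) + 1 / (2 * (x + 2))"
    using halves[of "x + 1" "x + 1 + 1"] assms by (simp add: add.assoc)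
  moreover have "2 / (x * (x + 1) * (x + 2)) * ((x + 1) / 2) = 1 / (x * (x + 2))"
    using assms by (simp add: divide_simps, simp add: algebra_simps)
  moreover have "1 / (2 * x) - 1 / (2 * (x + 2)) = 1 / (x * (x + 2))" using assms by (simp add: divide_simps)
  ultimately show ?thesis by linarith
qed

lemma Re_of_real_mult: "Re (of_real c * w) = c * Re w"
  by simp

lemma maj_defect_Suc:
  assumes N: "N \<ge> 1"
  shows "maj_defect N z = maj_defect (Suc N) z
     + 2 / (real N * (real N + 1) * (real N + 2)) * Re (fejer (Suc N) z)"
proof -
  let ?x = "real N"
  define d where "d = 2 / (?x * (?x + 1) * (?x + 2))"
  have x: "?x > 0" using N by simp
  \<comment> \<open>This zero lets the sums for \<open>N\<close> and \<open>N + 1\<close> run over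
    the same range.\<close>
  have "maj_coeff N (Suc N) = 0" by (simp add: maj_coeff_def)
  then have 1: "(\<Sum>n\<in>{1..N}. of_real (maj_coeff N n / real n) * z ^ n) =
      (\<Sum>n\<in>{1..Suc N}. of_real (maj_coeff N n / real n) * z ^ n)" by simp
  have 2: "of_real (maj_coeff (Suc N) n / real n) * z ^ n =
      of_real (maj_coeff N n / real n) * z ^ n + of_real d * (of_nat (Suc N - n) * z ^ n)"
    if n: "n \<in> {1..Suc N}" for n
  proof -
    have "real n > 0" using n by simp
    then have "maj_coeff (Suc N) n / real n = maj_coeff N n / real n + d * (?x + 1 - real n)"
      using maj_coeff_step[OF x, of "real n"] unfolding maj_coeff_def d_def by (simp add: add.commute)
    also have "?x + 1 - real n = real (Suc N - n)" using n by (simp add: of_nat_diff)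
    finally show ?thesis by (simp only: of_real_add of_real_mult of_real_of_nat_eq distrib_right mult.assoc)
  qed
  have "(\<Sum>n\<in>{1..Suc N}. of_real (maj_coeff (Suc N) n / real n) * z ^ n) =
      (\<Sum>n\<in>{1..Suc N}. of_real (maj_coeff N n / real n) * z ^ n) +
      of_real d * (\<Sum>n\<in>{1..Suc N}. of_nat (Suc N - n) * z ^ n)"
    unfolding sum_distrib_left sum.distrib[symmetric] by (rule sum.cong[OF refl 2])
  also have "(\<Sum>n\<in>{1..Suc N}. of_nat (Suc N - n) * z ^ n) = fejer (Suc N) z - of_nat (Suc N) / 2"
    unfolding fejer_def by (simp add: atLeastLessThanSuc_atLeastAtMost)
  finally have 3: "(\<Sum>n\<in>{1..Suc N}. of_real (maj_coeff (Suc N) n / real n) * z ^ n) =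
      (\<Sum>n\<in>{1..Suc N}. of_real (maj_coeff N n / real n) * z ^ n) +
      of_real d * (fejer (Suc N) z - of_nat (Suc N) / 2)" .
  have r: "Re (of_nat (Suc N) / 2) = (?x + 1) / 2" by simp
  have 3: "Re (\<Sum>n\<in>{1..Suc N}. of_real (maj_coeff (Suc N) n / real n) * z ^ n) =
      Re (\<Sum>n\<in>{1..Suc N}. of_real (maj_coeff N n / real n) * z ^ n) +
      d * (Re (fejer (Suc N) z) - (?x + 1) / 2)" by (simp only: 3 r plus_complex.sel Re_of_real_mult minus_complex.sel)
  have 4: "(2 * ?x + 1) / (2 * ?x * (?x + 1)) =
      (2 * real (Suc N) + 1) / (2 * real (Suc N) * (real (Suc N) + 1)) + d * ((?x + 1) / 2)"
    using maj_defect_step[OF x] unfolding d_def by (simp add: add.commute)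
  show ?thesis unfolding maj_defect_def 1 3 4 d_def[symmetric] by (simp only: right_diff_distrib)
qed

text \<open>The defect decreases as \<open>N\<close> grows, since its increments are negative
  multiples of nonnegative kernels. For fixed \<open>z\<close> inside the disc it is bounded below
  by a quantity tending to zero, so it is nonnegative from the start.\<close>

lemma maj_defect_nonneg_open:
  assumes z: "norm z < 1" and N: "N \<ge> 1"
  shows "maj_defect N z \<ge> 0"
proof -
  have mono: "maj_defect (Suc M) z \<le> maj_defect M z" if "M \<ge> 1" for M
  proof -
    have "norm (\<Sum>n<Suc M. z ^ n) ^ 2 \<le> 2 * Re (fejer (Suc M) z)" using z by (intro fejer_nonneg) simp
    then have "Re (fejer (Suc M) z) \<ge> 0" by (smt (verit) zero_le_power2)
    then show ?thesis using maj_defect_Suc[OF that, of z] that by simp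
  qed
  have mono': "maj_defect M z \<le> maj_defect N z" if "M \<ge> N" for M
    using that by (induction M rule: dec_induct) (use mono N in \<open>auto intro: order.trans\<close>)
  have lower: "maj_defect M z \<ge> - (2 / real M * (1 / (1 - norm z)))" if M: "M \<ge> 1" for M
  proof -
    have x: "real M > 0" using M by simp
    define a where "a n = (if n \<in> {1..M} then maj_coeff M n else 0)" for n
    have "(\<lambda>n. (- 1) ^ Suc n / of_nat n * (- z) ^ n) sums ln (1 + (- z))"
      using z by (intro Ln_series) simp
    then have "(\<lambda>n. - ((- 1) ^ Suc n / of_nat n * (- z) ^ n)) sums - ln (1 - z)"
      unfolding diff_conv_add_uminus by (rule sums_minus)
    moreover have "- ((- 1) ^ Suc n / of_nat n * (- z) ^ n) = z ^ n / of_nat n" for n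
      by (cases "even n") simp_all
    ultimately have s1: "(\<lambda>n. z ^ n / of_nat n) sums - ln (1 - z)" by (simp only:)
    have s2: "(\<lambda>n. of_real (a n / real n) * z ^ n) sums (\<Sum>n\<in>{1..M}. of_real (a n / real n) * z ^ n)"
      by (rule sums_finite) (auto simp: a_def)
    have s3: "(\<lambda>n. of_real ((1 - a n) / real n) * z ^ n) sums
        (- ln (1 - z) - (\<Sum>n\<in>{1..M}. of_real (a n / real n) * z ^ n))"
      using sums_diff[OF s1 s2] by (simp add: diff_divide_distrib algebra_simps)
    \<comment> \<open>Compared with the logarithm series every coefficient is off by at most
      \<open>2 / M\<close>, uniformly in \<open>n\<close>; for \<open>n > M\<close> the whole
      coefficient \<open>1 / n\<close> is missing.\<close>
    have c: "norm (of_real ((1 - a n) / real n) * z ^ n) \<le> 2 / real M * norm z ^ n" for n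
    proof -
      have "\<bar>(1 - a n) / real n\<bar> \<le> 2 / real M"
      proof (cases "n \<in> {1..M}")
        case True
        then have n: "real n > 0" "real n \<le> real M" by auto
        have "(1 - a n) / real n = (2 * real M + 1 - real n) / (real M * (real M + 1))"
          using True n x by (simp add: a_def maj_coeff_def divide_simps) (simp add: algebra_simps)
        moreover have "(2 * real M + 1 - real n) / (real M * (real M + 1)) \<le> 2 / real M"
          using x n by (simp add: divide_simps)
        moreover have "(2 * real M + 1 - real n) / (real M * (real M + 1)) \<ge> 0" using x n by simp
        ultimately show ?thesis by simp
      next
        case False
        show ?thesis
        proof (cases "n = 0")
          case False
          then have "real n > real M" using \<open>n \<notin> _\<close> by simp
          then show ?thesis using \<open>n \<notin> _\<close> x by (simp add: a_def divide_simps)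
        qed simp
      qed
      then show ?thesis unfolding norm_mult norm_power norm_of_real by (intro mult_right_mono) auto
    qed
    have geo: "(\<lambda>n. 2 / real M * norm z ^ n) sums (2 / real M * (1 / (1 - norm z)))"
      using z by (intro sums_mult geometric_sums) simp
    define S where "S = (\<Sum>n\<in>{1..M}. of_real (maj_coeff M n / real n) * z ^ n)"
    have S: "(\<Sum>n\<in>{1..M}. of_real (a n / real n) * z ^ n) = S"
      unfolding S_def by (intro sum.cong) (auto simp: a_def)
    have "norm (- ln (1 - z) - S) \<le> 2 / real M * (1 / (1 - norm z))"
      using norm_suminf_le[OF c sums_summable[OF geo]]
      unfolding sums_unique[OF s3, symmetric] sums_unique[OF geo, symmetric] S .
    moreover have "Re (ln (1 - z)) = ln (norm (1 - z))" using z by (intro Re_Ln) auto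
    then have "Re (- ln (1 - z) - S) = - ln (norm (1 - z)) - Re S"
      by (simp only: minus_complex.sel uminus_complex.sel)
    moreover have "(2 * real M + 1) / (2 * real M * (real M + 1)) \<ge> 0" by simp
    moreover have "\<bar>Re (- ln (1 - z) - S)\<bar> \<le> norm (- ln (1 - z) - S)" by (rule abs_Re_le_cmod)
    ultimately show ?thesis
      unfolding maj_defect_def S_def[symmetric] by linarith
  qed
  have "(\<lambda>M. - (2 / real M * (1 / (1 - norm z)))) \<longlonglongrightarrow> - (0 * (1 / (1 - norm z)))"
    by (intro tendsto_intros lim_const_over_n)
  moreover have "eventually (\<lambda>M. - (2 / real M * (1 / (1 - norm z))) \<le> maj_defect N z) sequentially"
  proof (rule eventually_mono[OF eventually_ge_at_top[of N]])
    fix M assume "N \<le> M"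
    then show "- (2 / real M * (1 / (1 - norm z))) \<le> maj_defect N z"
      using lower[of M] mono'[of M] N by linarith
  qed
  ultimately have "- (0 * (1 / (1 - norm z))) \<le> maj_defect N z"
    by (rule tendsto_upperbound) simp
  then show ?thesis by simp
qed

text \<open>The boundary of the disc is reached by a radial limit. The exponential form stays
  meaningful at \<open>z = 1\<close>, where the logarithm does not, and both sides are
  continuous.\<close>

lemma norm_one_minus_le_exp:
  assumes z: "norm z \<le> 1" and N: "N \<ge> 1"
  shows "norm (1 - z) \<le> exp (1 / real N - Re (\<Sum>n\<in>{1..N}. of_real (maj_coeff N n / real n) * z ^ n))"
proof -
  define h where "h w = exp (1 / real N - Re (\<Sum>n\<in>{1..N}. of_real (maj_coeff N n / real n) * w ^ n)) - norm (1 - w)" for w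
  have open_case: "h w \<ge> 0" if w: "norm w < 1" for w
  proof -
    have "1 - w \<noteq> 0" using w by auto
    then have pos: "norm (1 - w) > 0" by simp
    have "(2 * real N + 1) / (2 * real N * (real N + 1)) \<le> 1 / real N"
      using N by (simp add: divide_simps)
    then have "ln (norm (1 - w)) \<le> 1 / real N - Re (\<Sum>n\<in>{1..N}. of_real (maj_coeff N n / real n) * w ^ n)"
      using maj_defect_nonneg_open[OF w N] unfolding maj_defect_def by linarith
    then have "norm (1 - w) \<le> exp (1 / real N - Re (\<Sum>n\<in>{1..N}. of_real (maj_coeff N n / real n) * w ^ n))"
      using pos by (metis exp_le_cancel_iff exp_ln)
    then show ?thesis by (simp add: h_def)
  qed
  have cont: "continuous_on UNIV h" unfolding h_def by (intro continuous_intros)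
  define w where "w k = of_real (1 - 1 / real (Suc k)) * z" for k
  have "w \<longlonglongrightarrow> of_real (1 - 0) * z"
    unfolding w_def by (intro tendsto_intros LIMSEQ_Suc lim_const_over_n)
  then have "(\<lambda>k. h (w k)) \<longlonglongrightarrow> h z"
    using cont by (intro isCont_tendsto_compose[of z h]) (auto simp: continuous_on_eq_continuous_at)
  moreover have "h (w k) \<ge> 0" for k
  proof (rule open_case)
    have "norm (w k) = (1 - 1 / real (Suc k)) * norm z"
      unfolding w_def norm_mult norm_of_real by (simp add: divide_le_eq_1)
    also have "\<dots> \<le> (1 - 1 / real (Suc k)) * 1" using z by (intro mult_left_mono) (auto simp: divide_le_eq_1)
    also have "\<dots> < 1" by simp
    finally show "norm (w k) < 1" .
  qed
  ultimately have "h z \<ge> 0" by (intro LIMSEQ_le_const) auto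
  then show ?thesis by (simp add: h_def)
qed

text \<open>Under the Riemann hypothesis each \<open>\<alpha> * u\<close> lies in the closed unit
  disc, so every linear factor has the majorant. There are fewer than \<open>degree D\<close>
  factors, each costing \<open>1 / N\<close>, and the power sums assemble to
  \<open>Lam\<close>.\<close>

theorem norm_L_poly_le:
  fixes D :: "'a::finite_field poly"
  assumes q: "odd CARD('a)" and D: "lead_coeff D = 1" "squarefree D" "degree D \<ge> 1"
    and u: "norm u \<le> 1 / sqrt (real CARD('a))" and N: "N \<ge> 1"
  shows "norm (poly (L_poly D) u) \<le> exp (real (degree D) / real N +
    Re (\<Sum>n\<in>{1..N}. of_real (maj_coeff N n / real n) * (of_int (Lam D n) * u ^ n)))"
proof -
  obtain A :: "complex multiset" where A: "size A < degree D" "L_poly D = (\<Prod>\<alpha>\<in>#A. [:1, - \<alpha>:])"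
    "\<And>n. n > 0 \<Longrightarrow> of_int (Lam D n) = - (\<Sum>\<alpha>\<in>#A. \<alpha> ^ n)"
    "\<And>\<alpha>. \<alpha> \<in># A \<Longrightarrow> norm \<alpha> \<le> sqrt (real CARD('a))"
    using L_poly_RH[OF q D] by blast
  have small: "norm (\<alpha> * u) \<le> 1" if "\<alpha> \<in># A" for \<alpha>
  proof -
    have "norm (\<alpha> * u) \<le> sqrt (real CARD('a)) * (1 / sqrt (real CARD('a)))"
      unfolding norm_mult using A(4)[OF that] u by (intro mult_mono) auto
    then show ?thesis by simp
  qed
  let ?t = "\<lambda>n. of_real (maj_coeff N n / real n) :: complex"
  have gen: "norm (poly (\<Prod>\<alpha>\<in>#B. [:1, - \<alpha>:]) u) \<le> exp (real (size B) / real N -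
      Re (\<Sum>n\<in>{1..N}. ?t n * ((\<Sum>\<alpha>\<in>#B. \<alpha> ^ n) * u ^ n)))" if "set_mset B \<subseteq> set_mset A" for B
    using that
  proof (induction B)
    case (add \<alpha> B)
    have "norm (poly [:1, - \<alpha>:] u) = norm (1 - \<alpha> * u)" by (simp add: mult.commute)
    also have "\<dots> \<le> exp (1 / real N - Re (\<Sum>n\<in>{1..N}. ?t n * (\<alpha> * u) ^ n))"
      using add.prems small N by (intro norm_one_minus_le_exp) auto
    finally have 1: "norm (poly [:1, - \<alpha>:] u) \<le> exp (1 / real N - Re (\<Sum>n\<in>{1..N}. ?t n * (\<alpha> * u) ^ n))" .
    have "norm (poly (\<Prod>\<alpha>\<in>#add_mset \<alpha> B. [:1, - \<alpha>:]) u) = norm (poly [:1, - \<alpha>:] u) * norm (poly (\<Prod>\<alpha>\<in>#B. [:1, - \<alpha>:]) u)"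
      by (simp only: image_mset_add_mset prod_mset.add_mset poly_mult norm_mult)
    also have "\<dots> \<le> exp (1 / real N - Re (\<Sum>n\<in>{1..N}. ?t n * (\<alpha> * u) ^ n)) *
        exp (real (size B) / real N - Re (\<Sum>n\<in>{1..N}. ?t n * ((\<Sum>\<alpha>\<in>#B. \<alpha> ^ n) * u ^ n)))"
      using add by (intro mult_mono 1) auto
    also have "\<dots> = exp (real (size (add_mset \<alpha> B)) / real N -
        Re (\<Sum>n\<in>{1..N}. ?t n * ((\<Sum>\<alpha>\<in>#add_mset \<alpha> B. \<alpha> ^ n) * u ^ n)))"
    proof -
      have "(\<Sum>n\<in>{1..N}. ?t n * ((\<Sum>\<alpha>\<in>#add_mset \<alpha> B. \<alpha> ^ n) * u ^ n)) =
          (\<Sum>n\<in>{1..N}. ?t n * (\<alpha> * u) ^ n) + (\<Sum>n\<in>{1..N}. ?t n * ((\<Sum>\<alpha>\<in>#B. \<alpha> ^ n) * u ^ n))"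
        unfolding sum.distrib[symmetric] by (intro sum.cong refl) (simp add: power_mult_distrib distrib_left distrib_right)
      then have eq: "Re (\<Sum>n\<in>{1..N}. ?t n * ((\<Sum>\<alpha>\<in>#add_mset \<alpha> B. \<alpha> ^ n) * u ^ n)) =
          Re (\<Sum>n\<in>{1..N}. ?t n * (\<alpha> * u) ^ n) + Re (\<Sum>n\<in>{1..N}. ?t n * ((\<Sum>\<alpha>\<in>#B. \<alpha> ^ n) * u ^ n))"
        by (simp only: plus_complex.sel)
      show ?thesis unfolding eq exp_add[symmetric] by (simp only: size_add_mset of_nat_Suc add_divide_distrib) simp
    qed
    finally show ?case .
  qed simp
  define S where "S = (\<Sum>n\<in>{1..N}. ?t n * (of_int (Lam D n) * u ^ n))"
  have "norm (poly (L_poly D) u) \<le> exp (real (size A) / real N -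
      Re (\<Sum>n\<in>{1..N}. ?t n * ((\<Sum>\<alpha>\<in>#A. \<alpha> ^ n) * u ^ n)))"
    unfolding A(2) by (rule gen) simp
  also have "(\<Sum>n\<in>{1..N}. ?t n * ((\<Sum>\<alpha>\<in>#A. \<alpha> ^ n) * u ^ n)) = - S"
    unfolding S_def sum_negf[symmetric] by (intro sum.cong refl) (simp add: A(3))
  also have "exp (real (size A) / real N - Re (- S)) \<le> exp (real (degree D) / real N + Re S)"
    using A(1) by (simp add: divide_right_mono)
  finally show ?thesis unfolding S_def .
qed

section \<open>Separating primes from prime powers\<close>

definition irred_polys :: "nat \<Rightarrow> 'a::field poly set" where
  "irred_polys d = {P. monic_irreducible P \<and> degree P = d}"

definition irred_polys_upto :: "nat \<Rightarrow> nat \<Rightarrow> 'a::field poly set" where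
  "irred_polys_upto z N = {P. monic_irreducible P \<and> z < degree P \<and> degree P \<le> N}"

lemma finite_irred_polys: "finite (irred_polys d :: 'a::finite_field poly set)"
  by (rule finite_subset[OF _ monic_polys_finite_card(1)[of d]])
     (auto simp: irred_polys_def monic_irreducible_def monic_polys_def)

lemma irred_polys_upto_eq: "irred_polys_upto z N = (\<Union>d\<in>{z<..N}. irred_polys d)"
  by (auto simp: irred_polys_upto_def irred_polys_def)

lemma finite_irred_polys_upto: "finite (irred_polys_upto z N :: 'a::finite_field poly set)"
  by (simp add: irred_polys_upto_eq finite_irred_polys)

lemma sum_irred_polys_upto:
  "(\<Sum>P\<in>(irred_polys_upto z N :: 'a::finite_field poly set). f P) = (\<Sum>d\<in>{z<..N}. \<Sum>P\<in>irred_polys d. f P)"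
  unfolding irred_polys_upto_eq
  by (rule sum.UNION_disjoint) (auto simp: finite_irred_polys, auto simp: irred_polys_def)

lemma card_irred_polys_le:
  assumes "d > 0"
  shows "d * card (irred_polys d :: 'a::finite_field poly set) \<le> CARD('a) ^ d"
proof -
  have "d * card (irred_polys d :: 'a poly set) = (\<Sum>P\<in>(irred_polys d :: 'a poly set). degree P)"
    by (simp add: irred_polys_def)
  also have "\<dots> = (\<Sum>(P, k)\<in>(\<lambda>P. (P, 1 :: nat)) ` (irred_polys d :: 'a poly set). degree P)"
    by (subst sum.reindex) (auto simp: inj_on_def)
  also have "\<dots> \<le> (\<Sum>(P, k)\<in>(prime_powers d :: ('a poly \<times> nat) set). degree P)"
    by (rule sum_mono2[OF finite_prime_powers]) (auto simp: irred_polys_def prime_powers_def)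
  finally show ?thesis using sum_degree_prime_powers[OF assms, where 'a = 'a] by simp
qed

lemma Lam_eq_primes_plus:
  fixes D :: "'a::finite_field poly"
  assumes n: "n > 0"
  shows "Lam D n = int n * (\<Sum>P\<in>irred_polys n. poly_legendre D P) +
    (\<Sum>(P, k)\<in>{(P, k) \<in> prime_powers n. k \<ge> 2}. int (degree P) * poly_legendre D P ^ k)"
proof -
  let ?A = "(\<lambda>P. (P, 1 :: nat)) ` (irred_polys n :: 'a poly set)"
  let ?B = "{(P, k) \<in> (prime_powers n :: ('a poly \<times> nat) set). k \<ge> 2}"
  have AB: "prime_powers n = ?A \<union> ?B"
    by (force simp: prime_powers_def irred_polys_def image_iff)
  have disj: "?A \<inter> ?B = {}" by auto
  have finA: "finite ?A" using finite_irred_polys by blast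
  have finB: "finite ?B" by (rule finite_subset[OF _ finite_prime_powers]) auto
  have "Lam D n = (\<Sum>(P, k)\<in>?A. int (degree P) * poly_legendre D P ^ k) +
      (\<Sum>(P, k)\<in>?B. int (degree P) * poly_legendre D P ^ k)"
    unfolding Lam_def by (rule trans[OF sum.cong[OF AB refl] sum.union_disjoint[OF finA finB disj]])
  also have "(\<Sum>(P, k)\<in>?A. int (degree P) * poly_legendre D P ^ k) = (\<Sum>P\<in>irred_polys n. int n * poly_legendre D P)"
    by (subst sum.reindex) (auto simp: inj_on_def irred_polys_def intro!: sum.cong)
  finally show ?thesis by (simp add: sum_distrib_left)
qed

lemma abs_sum_higher_prime_powers_le:
  fixes D :: "'a::finite_field poly"
  assumes n: "n > 0"
  shows "\<bar>\<Sum>(P, k)\<in>{(P, k) \<in> prime_powers n. k \<ge> 2}. int (degree P) * poly_legendre D P ^ k\<bar>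
    \<le> int (\<Sum>k\<in>{k \<in> {2..n}. k dvd n}. CARD('a) ^ (n div k))"
proof -
  let ?B = "{(P, k) \<in> (prime_powers n :: ('a poly \<times> nat) set). k \<ge> 2}"
  let ?K = "{k \<in> {2..n}. k dvd n}"
  have "\<bar>\<Sum>(P, k)\<in>?B. int (degree P) * poly_legendre D P ^ k\<bar> \<le> (\<Sum>(P, k)\<in>?B. int (degree P))"
  proof (rule order.trans[OF sum_abs], rule sum_mono, clarify)
    fix P :: "'a poly" and k :: nat
    show "\<bar>int (degree P) * poly_legendre D P ^ k\<bar> \<le> int (degree P)"
      using abs_poly_legendre_le_1[of D P] by (simp add: abs_mult power_abs mult_left_le power_le_one)
  qed
  also have "\<dots> \<le> (\<Sum>(P, k)\<in>(\<Union>k\<in>?K. (irred_polys (n div k) :: 'a poly set) \<times> {k}). int (degree P))"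
  proof (rule sum_mono2)
    show "?B \<subseteq> (\<Union>k\<in>?K. (irred_polys (n div k) :: 'a poly set) \<times> {k})"
    proof clarify
      fix P :: "'a poly" and k :: nat assume A: "(P, k) \<in> prime_powers n" "2 \<le> k"
      then have "k * degree P = n" "monic_irreducible P" by (auto simp: prime_powers_def)
      moreover from this have "k \<le> n" using n by (metis dvd_imp_le dvd_triv_left)
      ultimately show "(P, k) \<in> (\<Union>k\<in>?K. (irred_polys (n div k) :: 'a poly set) \<times> {k})"
        using A by (auto simp: irred_polys_def)
    qed
  qed (auto simp: finite_irred_polys)
  also have "\<dots> = (\<Sum>k\<in>?K. \<Sum>(P, k)\<in>(irred_polys (n div k) :: 'a poly set) \<times> {k}. int (degree P))"
    by (rule sum.UNION_disjoint) (auto simp: finite_irred_polys)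
  also have "\<dots> \<le> (\<Sum>k\<in>?K. int (CARD('a) ^ (n div k)))"
  proof (rule sum_mono)
    fix k assume k: "k \<in> ?K"
    have "(\<Sum>(P, k)\<in>(irred_polys (n div k) :: 'a poly set) \<times> {k}. int (degree P)) = (\<Sum>P\<in>(irred_polys (n div k) :: 'a poly set). int (degree P))"
      by (subst sum.cartesian_product[symmetric]) simp
    also have "\<dots> = int ((n div k) * card (irred_polys (n div k) :: 'a poly set))"
      by (simp add: irred_polys_def)
    also have "\<dots> \<le> int (CARD('a) ^ (n div k))"
      using k n by (intro of_nat_mono card_irred_polys_le) (auto simp: div_greater_zero_iff)
    finally show "(\<Sum>(P, k)\<in>(irred_polys (n div k) :: 'a poly set) \<times> {k}. int (degree (P :: 'a poly))) \<le> int (CARD('a) ^ (n div k))" .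
  qed
  finally show ?thesis by simp
qed

text \<open>Of the proper prime powers only the squares matter: after normalisation they give at
  most \<open>1 / n\<close> for even \<open>n\<close>, while exponents from three on decay
  geometrically. Summed over \<open>n\<close> the squares produce the term
  \<open>ln N / 2\<close>.\<close>

lemma higher_prime_powers_normalized:
  fixes q :: nat
  assumes q: "q \<ge> 2" and n: "n > 0"
  shows "(1 / sqrt (real q)) ^ n * real (\<Sum>k\<in>{k \<in> {2..n}. k dvd n}. q ^ (n div k)) / real n
    \<le> (if even n then 1 / real n else 0) + (real q powr (- 1 / 6)) ^ n"
proof -
  let ?K = "{k \<in> {2..n}. k dvd n}"
  have q1: "real q > 1" using q by simp
  have pw: "(1 / sqrt (real q)) ^ n = real q powr (- real n / 2)"
  proof -
    have "1 / sqrt (real q) = real q powr (- (1 / 2))"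
      using q1 by (simp add: powr_minus_divide powr_half_sqrt)
    then show ?thesis using q1 by (simp add: powr_powr flip: powr_realpow)
  qed
  have tm: "real (q ^ (n div k)) \<le> (if k = 2 then real q powr (real n / 2) else real q powr (real n / 3))" if k: "k \<in> ?K" for k
  proof -
    obtain j where j: "n = k * j" using k by auto
    have "real (q ^ (n div k)) = real q powr (real n / real k)"
      using k q1 by (simp add: j powr_realpow)
    moreover have "real n / real k \<le> real n / 3" if "k \<noteq> 2"
      using k that by (intro divide_left_mono) auto
    ultimately show ?thesis using q1 by (auto intro!: powr_mono)
  qed
  have "real (\<Sum>k\<in>?K. q ^ (n div k)) \<le> (\<Sum>k\<in>?K. (if k = 2 then real q powr (real n / 2) else real q powr (real n / 3)))"
    unfolding of_nat_sum by (rule sum_mono[OF tm])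
  also have "\<dots> \<le> (\<Sum>k\<in>?K. (if k = 2 then real q powr (real n / 2) else 0) + real q powr (real n / 3))"
    by (rule sum_mono) auto
  also have "\<dots> = (if 2 \<in> ?K then real q powr (real n / 2) else 0) + real (card ?K) * real q powr (real n / 3)"
    by (simp add: sum.distrib)
  also have "\<dots> \<le> (if even n then real q powr (real n / 2) else 0) + real n * real q powr (real n / 3)"
  proof (intro add_mono mult_right_mono)
    have "card ?K \<le> card {2..n}" by (intro card_mono) auto
    then show "real (card ?K) \<le> real n" using n by simp
  qed auto
  finally have S: "real (\<Sum>k\<in>?K. q ^ (n div k)) \<le> (if even n then real q powr (real n / 2) else 0) + real n * real q powr (real n / 3)" .
  define a b c where "a = real q powr (- real n / 2)" and "b = real q powr (real n / 2)" and "c = real q powr (real n / 3)"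
  have ab: "a * b = 1" unfolding a_def b_def using q1 by (simp flip: powr_add)
  have "- real n / 2 + real n / 3 = - 1 / 6 * real n" by simp
  then have ac: "a * c = (real q powr (- 1 / 6)) ^ n"
    unfolding a_def c_def powr_add[symmetric] using q1 by (simp add: powr_powr flip: powr_realpow)
  have "(1 / sqrt (real q)) ^ n * real (\<Sum>k\<in>?K. q ^ (n div k)) / real n \<le>
      a * ((if even n then b else 0) + real n * c) / real n"
    unfolding pw a_def[symmetric]
    by (intro divide_right_mono mult_left_mono S[folded b_def c_def]) (simp_all add: a_def)
  also have "\<dots> = (if even n then (a * b) / real n else 0) + a * c"
    using n by (simp add: distrib_left add_divide_distrib)
  finally show ?thesis unfolding ab ac .
qed

section \<open>Harmonic sums, the variance of the prime sum, and the resulting bound for the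
  L-function\<close>

lemma harm_le_ln_plus_1:
  assumes "n \<ge> 1"
  shows "harm n \<le> ln (real n) + (1 :: real)"
proof -
  obtain m where m: "n = Suc m" using assms by (cases n) auto
  have "harm (Suc m) - ln (Suc m) \<le> (harm (Suc 0) - ln (Suc 0) :: real)"
    using decseq_harm_diff_ln by (rule decseqD) simp
  then show ?thesis by (simp add: m harm_Suc harm_def)
qed

lemma sum_inverse_interval_le:
  assumes "N \<ge> 1"
  shows "(\<Sum>j\<in>{1..N}. 1 / real j) \<le> ln (real N) + 1"
  using harm_le_ln_plus_1[OF assms] by (simp add: harm_def inverse_eq_divide)

lemma sum_even_inverse_le:
  assumes "N \<ge> 1"
  shows "(\<Sum>n\<in>{1..N}. if even n then 1 / real n else 0) \<le> (ln (real N) + 1) / 2"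
proof -
  have "(\<Sum>n\<in>{1..N}. if even n then 1 / real n else 0) = (\<Sum>n\<in>{n \<in> {1..N}. even n}. 1 / real n)"
    by (rule sum.inter_filter[symmetric]) simp
  also have "\<dots> = (\<Sum>j\<in>{1..N div 2}. 1 / real (2 * j))"
    by (rule sum.reindex_bij_witness[of _ "\<lambda>j. 2 * j" "\<lambda>n. n div 2"]) auto
  also have "\<dots> \<le> (\<Sum>j\<in>{1..N}. 1 / real (2 * j))" by (intro sum_mono2) auto
  also have "\<dots> = (\<Sum>j\<in>{1..N}. 1 / real j) / 2" by (simp add: sum_divide_distrib mult.commute)
  finally show ?thesis using sum_inverse_interval_le[OF assms] by simp
qed

definition prime_sum :: "('a::finite_field poly \<Rightarrow> real) \<Rightarrow> nat \<Rightarrow> nat \<Rightarrow> 'a poly \<Rightarrow> real" where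
  "prime_sum c z N D = (\<Sum>P\<in>irred_polys_upto z N. c P * real_of_int (poly_legendre D P))"

definition maj_weight :: "nat \<Rightarrow> complex \<Rightarrow> 'a::field poly \<Rightarrow> real" where
  "maj_weight N u P = maj_coeff N (degree P) * Re (u ^ degree P)"

text \<open>The bounded part of the contribution of proper prime powers: \<open>1 / 2\<close> is
  left over from the harmonic sum over even \<open>n\<close>, and the fraction is the geometric
  series of the cubes and higher powers.\<close>

definition tail_const :: "nat \<Rightarrow> real" where
  "tail_const q = 1 / 2 + 1 / (1 - real q powr (- 1 / 6))"

lemma maj_weight_square_le:
  fixes P :: "'a::finite_field poly"
  assumes u: "norm u \<le> 1 / sqrt (real CARD('a))" and P: "degree P \<le> N"
  shows "maj_weight N u P ^ 2 \<le> 1 / real CARD('a) ^ degree P"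
proof -
  have "\<bar>maj_weight N u P\<bar> \<le> 1 * norm (u ^ degree P)"
    unfolding maj_weight_def abs_mult using maj_coeff_bounds[OF P]
    by (intro mult_mono abs_Re_le_cmod) auto
  then have "\<bar>maj_weight N u P\<bar> ^ 2 \<le> (norm u ^ degree P) ^ 2"
    by (intro power_mono) (auto simp: norm_power)
  also have "\<dots> \<le> ((1 / sqrt (real CARD('a))) ^ degree P) ^ 2"
    by (intro power_mono u) auto
  also have "\<dots> = 1 / real CARD('a) ^ degree P"
  proof -
    have "(sqrt (real CARD('a)) ^ degree P) ^ 2 = (sqrt (real CARD('a)) ^ 2) ^ degree P"
      by (simp only: power_mult[symmetric] mult.commute)
    then show ?thesis by (simp add: power_divide)
  qed
  finally show ?thesis by simp
qed

text \<open>There are at most \<open>q^d / d\<close> primes of degree \<open>d\<close>, each with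
  squared weight at most \<open>q^(-d)\<close>. So the variance is bounded by a harmonic sum,
  uniformly in \<open>u\<close>.\<close>

lemma sum_maj_weight_square_le:
  assumes u: "norm u \<le> 1 / sqrt (real CARD('a::finite_field))" and N: "N \<le> N'"
  shows "(\<Sum>P\<in>(irred_polys_upto z N :: 'a poly set). maj_weight N' u P ^ 2) \<le> (\<Sum>d\<in>{z<..N}. 1 / real d)"
  unfolding sum_irred_polys_upto
proof (rule sum_mono)
  fix d assume d: "d \<in> {z<..N}"
  let ?q = "real CARD('a)"
  have "(\<Sum>P\<in>(irred_polys d :: 'a poly set). maj_weight N' u P ^ 2) \<le> (\<Sum>P\<in>(irred_polys d :: 'a poly set). 1 / ?q ^ d)"
    by (rule sum_mono) (use maj_weight_square_le[OF u] d N in \<open>force simp: irred_polys_def\<close>)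
  also have "\<dots> = real (card (irred_polys d :: 'a poly set)) / ?q ^ d" by simp
  also have "\<dots> \<le> 1 / real d"
  proof -
    have "real (d * card (irred_polys d :: 'a poly set)) \<le> real (CARD('a) ^ d)"
      using d by (intro of_nat_mono card_irred_polys_le) auto
    then show ?thesis using d by (simp add: field_simps)
  qed
  finally show "(\<Sum>P\<in>(irred_polys d :: 'a poly set). maj_weight N' u P ^ 2) \<le> 1 / real d" .
qed

theorem norm_L_poly_le_prime_sum:
  fixes D :: "'a::finite_field poly"
  assumes q: "odd CARD('a)" and D: "lead_coeff D = 1" "squarefree D" "degree D \<ge> 1"
    and u: "norm u \<le> 1 / sqrt (real CARD('a))" and N: "N \<ge> 1"
  shows "norm (poly (L_poly D) u) \<le> exp (real (degree D) / real N + prime_sum (maj_weight N u) 0 N D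
    + ln (real N) / 2 + tail_const CARD('a))"
proof -
  let ?q = "CARD('a)"
  define E where "E n = (\<Sum>(P, k)\<in>{(P, k) \<in> prime_powers n. k \<ge> 2}. int (degree P) * poly_legendre D P ^ k)" for n
  let ?t = "\<lambda>n. maj_coeff N n / real n"
  define y where "y = real ?q powr (- 1 / 6)"
  have y: "0 \<le> y" "y < 1" using CARD_ge_2[where 'a='a] by (auto simp: y_def powr_less_one)
  have split: "Re (of_real (?t n) * (of_int (Lam D n) * u ^ n)) \<le>
      (\<Sum>P\<in>irred_polys n. maj_weight N u P * real_of_int (poly_legendre D P)) + ((if even n then 1 / real n else 0) + y ^ n)"
    if n: "n \<in> {1..N}" for n
  proof -
    have n0: "n > 0" "n \<le> N" using n by auto
    have "Re (of_real (?t n) * (of_int (Lam D n) * u ^ n)) = ?t n * (real_of_int (Lam D n) * Re (u ^ n))"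
      by simp
    also have "real_of_int (Lam D n) = real n * (\<Sum>P\<in>irred_polys n. real_of_int (poly_legendre D P)) + real_of_int (E n)"
      unfolding Lam_eq_primes_plus[OF n0(1)] E_def by simp
    also have "?t n * ((real n * (\<Sum>P\<in>irred_polys n. real_of_int (poly_legendre D P)) + real_of_int (E n)) * Re (u ^ n)) =
        maj_coeff N n * Re (u ^ n) * (\<Sum>P\<in>irred_polys n. real_of_int (poly_legendre D P)) + ?t n * (real_of_int (E n) * Re (u ^ n))"
    proof -
      have alg: "a / x * ((x * s + e) * r) = a * r * s + a / x * (e * r)" if "x \<noteq> 0" for a x s e r :: real
        using that by (simp add: field_simps)
      show ?thesis by (rule alg) (use n0 in simp)
    qed
    also have "maj_coeff N n * Re (u ^ n) * (\<Sum>P\<in>irred_polys n. real_of_int (poly_legendre D P)) =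
        (\<Sum>P\<in>irred_polys n. maj_weight N u P * real_of_int (poly_legendre D P))"
      unfolding sum_distrib_left by (intro sum.cong) (auto simp: maj_weight_def irred_polys_def)
    also have "?t n * (real_of_int (E n) * Re (u ^ n)) \<le> (if even n then 1 / real n else 0) + y ^ n"
    proof -
      let ?R = "real (\<Sum>k\<in>{k \<in> {2..n}. k dvd n}. ?q ^ (n div k))"
      have "\<bar>E n\<bar> \<le> int (\<Sum>k\<in>{k \<in> {2..n}. k dvd n}. ?q ^ (n div k))"
        unfolding E_def by (rule abs_sum_higher_prime_powers_le[OF n0(1)])
      then have "real_of_int \<bar>E n\<bar> \<le> real_of_int (int (\<Sum>k\<in>{k \<in> {2..n}. k dvd n}. ?q ^ (n div k)))"
        by (simp only: of_int_le_iff)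
      then have ER: "\<bar>real_of_int (E n)\<bar> \<le> ?R" by (simp only: of_int_abs of_int_of_nat_eq)
      have un: "\<bar>Re (u ^ n)\<bar> \<le> (1 / sqrt (real ?q)) ^ n"
        using abs_Re_le_cmod[of "u ^ n"] power_mono[OF u, of n] by (simp add: norm_power)
      have "?t n * (real_of_int (E n) * Re (u ^ n)) \<le> \<bar>?t n\<bar> * (\<bar>real_of_int (E n)\<bar> * \<bar>Re (u ^ n)\<bar>)"
        unfolding abs_mult[symmetric] by (rule abs_ge_self)
      also have "\<dots> \<le> (1 / real n) * (?R * (1 / sqrt (real ?q)) ^ n)"
        using maj_coeff_bounds[OF n0(2)] n0 by (intro mult_mono ER un) (auto simp: divide_right_mono intro!: sum_nonneg)
      also have "\<dots> = (1 / sqrt (real ?q)) ^ n * ?R / real n" by simp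
      also have "\<dots> \<le> (if even n then 1 / real n else 0) + y ^ n"
        unfolding y_def by (rule higher_prime_powers_normalized[OF CARD_ge_2 n0(1)])
      finally show ?thesis .
    qed
    finally show ?thesis by simp
  qed
  have "Re (\<Sum>n\<in>{1..N}. of_real (?t n) * (of_int (Lam D n) * u ^ n)) \<le>
      (\<Sum>n\<in>{1..N}. (\<Sum>P\<in>irred_polys n. maj_weight N u P * real_of_int (poly_legendre D P)) + ((if even n then 1 / real n else 0) + y ^ n))"
    unfolding Re_sum by (rule sum_mono[OF split])
  also have "\<dots> = prime_sum (maj_weight N u) 0 N D + ((\<Sum>n\<in>{1..N}. if even n then 1 / real n else 0) + (\<Sum>n\<in>{1..N}. y ^ n))"
  proof -
    have "{0<..N} = {1..N}" by auto
    then show ?thesis unfolding prime_sum_def sum_irred_polys_upto by (simp only: sum.distrib)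
  qed
  also have "(\<Sum>n\<in>{1..N}. if even n then 1 / real n else 0) \<le> (ln (real N) + 1) / 2"
    by (rule sum_even_inverse_le[OF N])
  also have "(\<Sum>n\<in>{1..N}. y ^ n) \<le> 1 / (1 - y)"
  proof -
    have "(\<Sum>n\<in>{1..N}. y ^ n) \<le> (\<Sum>n. y ^ n)"
      using y by (intro sum_le_suminf summable_geometric) auto
    then show ?thesis using y by (simp add: suminf_geometric)
  qed
  finally have "Re (\<Sum>n\<in>{1..N}. of_real (?t n) * (of_int (Lam D n) * u ^ n)) \<le>
      prime_sum (maj_weight N u) 0 N D + ((ln (real N) + 1) / 2 + 1 / (1 - y))" by simp
  then have "real (degree D) / real N + Re (\<Sum>n\<in>{1..N}. of_real (?t n) * (of_int (Lam D n) * u ^ n)) \<le>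
      real (degree D) / real N + prime_sum (maj_weight N u) 0 N D + ln (real N) / 2 + tail_const ?q"
    by (simp add: tail_const_def y_def add_divide_distrib)
  then show ?thesis using norm_L_poly_le[OF q D u N] by (meson exp_le_cancel_iff order.trans)
qed

section \<open>Moments of sums over primes\<close>

lemma power_sum_eq_sum_lists:
  fixes x :: "'b \<Rightarrow> 'c::comm_semiring_1"
  assumes "finite T"
  shows "(\<Sum>P\<in>T. x P) ^ j = (\<Sum>xs\<in>{xs. set xs \<subseteq> T \<and> length xs = j}. \<Prod>P\<leftarrow>xs. x P)"
proof (induction j)
  case 0
  have "{xs. set xs \<subseteq> T \<and> length xs = 0} = {[]}" by auto
  then show ?case by simp
next
  case (Suc j)
  let ?L = "\<lambda>j. {xs. set xs \<subseteq> T \<and> length xs = j}"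
  have "(\<Sum>xs\<in>?L (Suc j). \<Prod>P\<leftarrow>xs. x P) = (\<Sum>(P, xs)\<in>T \<times> ?L j. x P * (\<Prod>P\<leftarrow>xs. x P))"
    by (rule sum.reindex_bij_witness[of _ "\<lambda>(P, xs). P # xs" "\<lambda>xs. (hd xs, tl xs)"])
       (auto simp: length_Suc_conv)
  also have "\<dots> = (\<Sum>P\<in>T. x P) * (\<Sum>xs\<in>?L j. \<Prod>P\<leftarrow>xs. x P)"
    by (simp add: sum_product sum.cartesian_product)
  finally show ?case using Suc by simp
qed

definition even_lists :: "'b set \<Rightarrow> nat \<Rightarrow> 'b list set" where
  "even_lists T j = {xs. set xs \<subseteq> T \<and> length xs = j \<and> (\<forall>P. even (count_list xs P))}"

lemma finite_even_lists: "finite T \<Longrightarrow> finite (even_lists T j)"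
  by (rule finite_subset[OF _ finite_lists_length_eq[of T j]]) (auto simp: even_lists_def)

text \<open>Counts the perfect matchings of the \<open>2m\<close> factors into equal pairs, with multiplicity.\<close>

lemma sum_even_lists_le:
  fixes w :: "'b \<Rightarrow> real"
  assumes T: "finite T" and w: "\<And>P. w P \<ge> 0"
  shows "(\<Sum>xs\<in>even_lists T (2 * m). \<Prod>P\<leftarrow>xs. w P) \<le> fact (2 * m) / (2 ^ m * fact m) * (\<Sum>P\<in>T. w P ^ 2) ^ m"
proof (induction m)
  case 0
  have "even_lists T 0 = {[]}" by (auto simp: even_lists_def)
  then show ?case by simp
next
  case (Suc m)
  let ?\<sigma> = "\<Sum>P\<in>T. w P ^ 2"
  let ?dom = "{..2 * m} \<times> T \<times> even_lists T (2 * m)"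
  \<comment> \<open>The head of an even list occurs again later; deleting both occurrences leaves an
    even list. Conversely \<open>\<phi>\<close> puts \<open>P\<close> at the head and at one of
    \<open>2 * m + 1\<close> further positions, so the bound picks up the factor
    \<open>2 * m + 1\<close> and the constants are the odd double factorials.\<close>
  define \<phi> where "\<phi> = (\<lambda>(i :: nat, P :: 'b, ys). P # (take i ys @ P # drop i ys))"
  have nonneg: "(\<Prod>P\<leftarrow>xs. w P) \<ge> 0" for xs using w by (induction xs) auto
  have sub: "even_lists T (2 * Suc m) \<subseteq> \<phi> ` ?dom"
  proof
    fix xs assume xs: "xs \<in> even_lists T (2 * Suc m)"
    then obtain P zs where xs': "xs = P # zs" by (cases xs) (auto simp: even_lists_def)
    have "even (count_list xs P)" using xs by (simp add: even_lists_def)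
    then have "odd (count_list zs P)" by (simp add: xs')
    then have "P \<in> set zs" by (metis count_list_0_iff even_zero)
    then obtain as bs where zs: "zs = as @ P # bs" by (meson split_list)
    define ys where "ys = as @ bs"
    have "even (count_list ys R)" for R
    proof -
      have "even (count_list xs R)" using xs by (simp add: even_lists_def)
      then show ?thesis by (simp add: xs' zs ys_def count_list_append split: if_splits)
    qed
    then have "ys \<in> even_lists T (2 * m)" using xs by (auto simp: even_lists_def xs' zs ys_def)
    moreover have "P \<in> T" "length as \<le> 2 * m" using xs by (auto simp: even_lists_def xs' zs)
    moreover have "xs = \<phi> (length as, P, ys)" by (simp add: \<phi>_def xs' zs ys_def)
    ultimately show "xs \<in> \<phi> ` ?dom" by blast
  qed
  have fin: "finite ?dom" using T finite_even_lists by blast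
  have prodphi: "(\<Prod>P\<leftarrow>\<phi> (i, P, ys). w P) = w P ^ 2 * (\<Prod>P\<leftarrow>ys. w P)" for i P ys
  proof -
    have "(\<Prod>P\<leftarrow>ys. w P) = (\<Prod>P\<leftarrow>take i ys. w P) * (\<Prod>P\<leftarrow>drop i ys. w P)"
      by (metis append_take_drop_id map_append prod_list.append)
    then show ?thesis by (simp add: \<phi>_def power2_eq_square)
  qed
  have "(\<Sum>xs\<in>even_lists T (2 * Suc m). \<Prod>P\<leftarrow>xs. w P) \<le> (\<Sum>xs\<in>\<phi> ` ?dom. \<Prod>P\<leftarrow>xs. w P)"
    using fin sub nonneg by (intro sum_mono2) auto
  also have "\<dots> \<le> (\<Sum>x\<in>?dom. \<Prod>P\<leftarrow>\<phi> x. w P)"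
    using sum_image_le[OF fin, of "\<lambda>xs. \<Prod>P\<leftarrow>xs. w P" \<phi>] nonneg by (simp add: comp_def)
  also have "\<dots> = (\<Sum>(i, P, ys)\<in>?dom. w P ^ 2 * (\<Prod>P\<leftarrow>ys. w P))"
    by (intro sum.cong refl) (auto simp: prodphi)
  also have "\<dots> = real (2 * m + 1) * (?\<sigma> * (\<Sum>ys\<in>even_lists T (2 * m). \<Prod>P\<leftarrow>ys. w P))"
    by (simp add: sum.cartesian_product[symmetric] sum_product)
  also have "\<dots> \<le> real (2 * m + 1) * (?\<sigma> * (fact (2 * m) / (2 ^ m * fact m) * ?\<sigma> ^ m))"
    by (intro mult_left_mono Suc) (auto intro: sum_nonneg)
  also have "\<dots> = fact (2 * Suc m) / (2 ^ Suc m * fact (Suc m)) * ?\<sigma> ^ Suc m"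
  proof -
    have f1: "(fact (2 * Suc m) :: real) = real (2 * m + 2) * (real (2 * m + 1) * fact (2 * m))"
      by (simp add: algebra_simps)
    have f2: "(2 ^ Suc m * fact (Suc m) :: real) = real (2 * m + 2) * (2 ^ m * fact m)" by (simp add: algebra_simps)
    have "fact (2 * Suc m) / (2 ^ Suc m * fact (Suc m) :: real) = real (2 * m + 1) * fact (2 * m) / (2 ^ m * fact m)"
      unfolding f1 f2 by (rule mult_divide_mult_cancel_left) simp
    then show ?thesis by simp
  qed
  finally show ?case .
qed

text \<open>In the expanded power every list has total degree at most
  \<open>2 * m * N \<le> n\<close>, so lists with an odd multiplicity cancel exactly and the others
  are estimated trivially. The result is the moment of a centred Gaussian of variance
  \<open>\<sigma>\<close>.\<close>

theorem moment_prime_sum_le: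
  fixes c :: "'a::finite_field poly \<Rightarrow> real"
  assumes q: "odd CARD('a)" and n: "2 * m * N \<le> n" and \<sigma>: "(\<Sum>P\<in>irred_polys_upto z N. c P ^ 2) \<le> \<sigma>"
  shows "(\<Sum>D\<in>monic_polys n. prime_sum c z N D ^ (2 * m)) \<le> real CARD('a) ^ n * (fact (2 * m) / (2 ^ m * fact m) * \<sigma> ^ m)"
proof -
  let ?T = "irred_polys_upto z N :: 'a poly set"
  let ?L = "{xs. set xs \<subseteq> ?T \<and> length xs = 2 * m}"
  have T: "finite ?T" by (rule finite_irred_polys_upto)
  have "(\<Sum>D\<in>monic_polys n. prime_sum c z N D ^ (2 * m)) =
      (\<Sum>D\<in>monic_polys n. \<Sum>xs\<in>?L. (\<Prod>P\<leftarrow>xs. c P) * real_of_int (\<Prod>P\<leftarrow>xs. poly_legendre D P))"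
  proof (intro sum.cong refl)
    fix D :: "'a poly"
    have "(\<Prod>P\<leftarrow>xs. c P * real_of_int (poly_legendre D P)) = (\<Prod>P\<leftarrow>xs. c P) * real_of_int (\<Prod>P\<leftarrow>xs. poly_legendre D P)" for xs
      by (induction xs) auto
    then show "prime_sum c z N D ^ (2 * m) = (\<Sum>xs\<in>?L. (\<Prod>P\<leftarrow>xs. c P) * real_of_int (\<Prod>P\<leftarrow>xs. poly_legendre D P))"
      unfolding prime_sum_def power_sum_eq_sum_lists[OF T] by simp
  qed
  also have "\<dots> = (\<Sum>xs\<in>?L. (\<Prod>P\<leftarrow>xs. c P) * real_of_int (\<Sum>D\<in>monic_polys n. \<Prod>P\<leftarrow>xs. poly_legendre D P))"
    by (subst sum.swap) (simp add: sum_distrib_left)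
  also have "\<dots> = (\<Sum>xs\<in>even_lists ?T (2 * m). (\<Prod>P\<leftarrow>xs. c P) * real_of_int (\<Sum>D\<in>monic_polys n. \<Prod>P\<leftarrow>xs. poly_legendre D P))"
  proof (rule sum.mono_neutral_right)
    show "finite ?L" using T by (rule finite_lists_length_eq)
    show "even_lists ?T (2 * m) \<subseteq> ?L" by (auto simp: even_lists_def)
    show "\<forall>xs\<in>?L - even_lists ?T (2 * m).
        (\<Prod>P\<leftarrow>xs. c P) * real_of_int (\<Sum>D\<in>monic_polys n. \<Prod>P\<leftarrow>xs. poly_legendre D P) = 0"
    proof
      fix xs assume xs: "xs \<in> ?L - even_lists ?T (2 * m)"
      then obtain P0 where P0: "odd (count_list xs P0)" by (auto simp: even_lists_def)
      have irr: "monic_irreducible P" "degree P \<le> N" if "P \<in> set xs" for P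
        using xs that by (auto simp: irred_polys_upto_def)
      have "(\<Sum>P\<leftarrow>xs. degree P) \<le> (\<Sum>P\<leftarrow>xs. N)" using irr(2) by (intro sum_list_mono)
      also have "\<dots> \<le> n" using xs n by (simp add: sum_list_triv mult.assoc)
      finally have "(\<Sum>D\<in>monic_polys n. \<Prod>P\<leftarrow>xs. poly_legendre D P) = 0"
        using sum_prod_legendre_eq_0[OF q irr(1) _ P0] by blast
      then show "(\<Prod>P\<leftarrow>xs. c P) * real_of_int (\<Sum>D\<in>monic_polys n. \<Prod>P\<leftarrow>xs. poly_legendre D P) = 0" by simp
    qed
  qed
  also have "\<dots> \<le> (\<Sum>xs\<in>even_lists ?T (2 * m). (\<Prod>P\<leftarrow>xs. \<bar>c P\<bar>) * real CARD('a) ^ n)"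
  proof (rule sum_mono)
    fix xs :: "'a poly list"
    have "\<bar>\<Prod>P\<leftarrow>xs. poly_legendre D P\<bar> \<le> 1" for D :: "'a poly"
    proof (induction xs)
      case (Cons P xs)
      then show ?case using abs_poly_legendre_le_1[of D P] by (simp add: abs_mult mult_le_one)
    qed simp
    then have "\<bar>\<Sum>D\<in>monic_polys n. \<Prod>P\<leftarrow>xs. poly_legendre D P\<bar> \<le> (\<Sum>D\<in>(monic_polys n :: 'a poly set). 1)"
      by (intro order.trans[OF sum_abs] sum_mono)
    then have "\<bar>real_of_int (\<Sum>D\<in>monic_polys n. \<Prod>P\<leftarrow>xs. poly_legendre D P)\<bar> \<le> real_of_int (int (CARD('a) ^ n))"
      unfolding of_int_abs[symmetric] of_int_le_iff by (simp add: card_monic_polys)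
    moreover have "\<bar>\<Prod>P\<leftarrow>xs. c P\<bar> = (\<Prod>P\<leftarrow>xs. \<bar>c P\<bar>)" by (induction xs) (auto simp: abs_mult)
    ultimately have "\<bar>(\<Prod>P\<leftarrow>xs. c P) * real_of_int (\<Sum>D\<in>monic_polys n. \<Prod>P\<leftarrow>xs. poly_legendre D P)\<bar> \<le> (\<Prod>P\<leftarrow>xs. \<bar>c P\<bar>) * real CARD('a) ^ n"
      unfolding abs_mult by (metis abs_ge_zero mult_left_mono of_int_of_nat_eq of_nat_power)
    then show "(\<Prod>P\<leftarrow>xs. c P) * real_of_int (\<Sum>D\<in>monic_polys n. \<Prod>P\<leftarrow>xs. poly_legendre D P) \<le> (\<Prod>P\<leftarrow>xs. \<bar>c P\<bar>) * real CARD('a) ^ n"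
      by (rule order.trans[OF abs_ge_self])
  qed
  also have "\<dots> = real CARD('a) ^ n * (\<Sum>xs\<in>even_lists ?T (2 * m). \<Prod>P\<leftarrow>xs. \<bar>c P\<bar>)"
    by (simp add: sum_distrib_left mult.commute)
  also have "\<dots> \<le> real CARD('a) ^ n * (fact (2 * m) / (2 ^ m * fact m) * (\<Sum>P\<in>?T. \<bar>c P\<bar> ^ 2) ^ m)"
    by (intro mult_left_mono sum_even_lists_le T) auto
  also have "\<dots> \<le> real CARD('a) ^ n * (fact (2 * m) / (2 ^ m * fact m) * \<sigma> ^ m)"
    using \<sigma> by (intro mult_left_mono power_mono) (auto intro: sum_nonneg)
  finally show ?thesis .
qed

section \<open>Large values and moments of the L-function\<close>

lemma fact_double_quotient_le: "fact (2 * m) / (2 ^ m * fact m) \<le> (real m ^ m :: real)"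
proof -
  have "fact (2 * m) div fact (2 * m - m) \<le> (2 * m) ^ m" by (rule fact_div_fact_le_pow) simp
  then have "real (fact (2 * m) div fact m) \<le> real ((2 * m) ^ m)" by (subst of_nat_le_iff) simp
  moreover have "real (fact (2 * m) div fact m) = fact (2 * m) / fact m"
    by (subst real_of_nat_div) (auto intro: fact_dvd)
  ultimately have "fact (2 * m) / fact m \<le> (2 ^ m * real m ^ m :: real)" by (simp add: power_mult_distrib)
  then have "fact (2 * m) / fact m / 2 ^ m \<le> (2 ^ m * real m ^ m / 2 ^ m :: real)" by (rule divide_right_mono) simp
  then show ?thesis by (simp add: mult.commute)
qed

lemma monic_squarefree_subset: "monic_squarefree_polys n \<subseteq> monic_polys n"
  by (auto simp: monic_squarefree_polys_def monic_polys_def)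

lemma finite_monic_squarefree: "finite (monic_squarefree_polys n :: 'a::finite_field poly set)"
  using monic_squarefree_subset monic_polys_finite_card(1) by (rule finite_subset)

lemma card_monic_squarefree_le: "real (card (monic_squarefree_polys n :: 'a::finite_field poly set)) \<le> real CARD('a) ^ n"
proof -
  have "card (monic_squarefree_polys n :: 'a poly set) \<le> card (monic_polys n :: 'a poly set)"
    by (intro card_mono monic_polys_finite_card monic_squarefree_subset)
  then show ?thesis unfolding card_monic_polys by (simp flip: of_nat_power)
qed

lemma card_large_prime_sum_le:
  fixes c :: "'a::finite_field poly \<Rightarrow> real"
  assumes q: "odd CARD('a)" and n: "2 * m * N \<le> n" and \<sigma>: "(\<Sum>P\<in>irred_polys_upto z N. c P ^ 2) \<le> \<sigma>"
    and T: "T > 0"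
  shows "real (card {D \<in> monic_polys n. T \<le> \<bar>prime_sum c z N D\<bar>}) \<le> real CARD('a) ^ n * (real m * \<sigma> / T ^ 2) ^ m"
proof -
  let ?A = "{D \<in> monic_polys n. T \<le> \<bar>prime_sum c z N D\<bar>}"
  have \<sigma>0: "\<sigma> \<ge> 0" by (rule order.trans[OF sum_nonneg \<sigma>]) simp
  have "real (card ?A) * T ^ (2 * m) = (\<Sum>D\<in>?A. T ^ (2 * m))" by simp
  also have "\<dots> \<le> (\<Sum>D\<in>?A. prime_sum c z N D ^ (2 * m))"
  proof (rule sum_mono)
    fix D assume "D \<in> ?A"
    then have "T ^ (2 * m) \<le> \<bar>prime_sum c z N D\<bar> ^ (2 * m)" using T by (intro power_mono) auto
    then show "T ^ (2 * m) \<le> prime_sum c z N D ^ (2 * m)" by (simp add: power_even_abs)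
  qed
  also have "\<dots> \<le> (\<Sum>D\<in>monic_polys n. prime_sum c z N D ^ (2 * m))"
    by (intro sum_mono2 monic_polys_finite_card) auto
  also have "\<dots> \<le> real CARD('a) ^ n * (fact (2 * m) / (2 ^ m * fact m) * \<sigma> ^ m)"
    by (rule moment_prime_sum_le[OF q n \<sigma>])
  also have "\<dots> \<le> real CARD('a) ^ n * (real m ^ m * \<sigma> ^ m)"
    using \<sigma>0 by (intro mult_left_mono mult_right_mono fact_double_quotient_le) auto
  finally have "real (card ?A) \<le> real CARD('a) ^ n * (real m ^ m * \<sigma> ^ m) / T ^ (2 * m)"
    using T by (simp add: field_simps)
  also have "\<dots> = real CARD('a) ^ n * (real m * \<sigma> / T ^ 2) ^ m"
    by (simp add: power_mult_distrib power_divide power_mult)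
  finally show ?thesis .
qed

lemma sum_maj_weight_square_le_ln:
  assumes u: "norm u \<le> 1 / sqrt (real CARD('a::finite_field))" and N: "N \<le> N'" "N \<le> n" "ln (real n) \<ge> 1"
  shows "(\<Sum>P\<in>(irred_polys_upto 0 N :: 'a poly set). maj_weight N' u P ^ 2) \<le> ln (real n) + 1"
proof -
  have eq: "{0<..N} = {1..N}" by auto
  have "(\<Sum>P\<in>(irred_polys_upto 0 N :: 'a poly set). maj_weight N' u P ^ 2) \<le> (\<Sum>d\<in>{0<..N}. 1 / real d)"
    by (rule sum_maj_weight_square_le[OF u N(1)])
  also have "\<dots> \<le> ln (real n) + 1"
  proof (cases "N = 0")
    case False
    then have "(\<Sum>d\<in>{1..N}. 1 / real d) \<le> ln (real N) + 1" by (intro sum_inverse_interval_le) simp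
    also have "ln (real N) \<le> ln (real n)" using False N(2) by simp
    finally show ?thesis by (simp add: eq)
  qed (use N in simp)
  finally show ?thesis .
qed

text \<open>The decay in \<open>V\<close> has to beat the factor \<open>exp (k * V)\<close> of a
  \<open>k\<close>-th moment; this holds as soon as \<open>V\<close> exceeds a sufficiently large
  multiple of \<open>ln n\<close>, and \<open>K\<close> is that multiple.\<close>

lemma card_large_values_le:
  fixes u :: complex and n V k :: nat
  defines "K \<equiv> exp (24 * (real k + 1))"
  assumes q: "odd CARD('a::finite_field)" and u: "norm u \<le> 1 / sqrt (real CARD('a))"
    and n: "ln (real n) \<ge> 1" "tail_const CARD('a) \<le> ln (real n)"
    and V: "K * ln (real n) \<le> real V" "V \<le> 2 * n"
  shows "real (card {D \<in> (monic_squarefree_polys n :: 'a poly set). exp (real V) \<le> norm (poly (L_poly D) u)})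
    \<le> real CARD('a) ^ n * exp (- (real k + 1) * real V)"
proof -
  have n0: "n \<ge> 1" using n by (cases n) auto
  have "24 + 1 \<le> 1 + 24 * (real k + 1)" by simp
  also have "\<dots> \<le> K" unfolding K_def by (rule exp_ge_add_one_self)
  finally have K: "K \<ge> 25" by simp
  have V25: "25 * ln (real n) \<le> real V" using V(1) K n(1) mult_right_mono[of 25 K "ln (real n)"] by linarith
  then have V24: "real V \<ge> 25" using n(1) by linarith
  \<comment> \<open>\<open>N\<close> near \<open>4 * n / V\<close> makes the loss
    \<open>n / N\<close> at most \<open>V / 4\<close>, and the logarithmic terms take at most
    another quarter, which leaves \<open>V / 2\<close> to the prime sum. As
    \<open>N \<le> 6 * n / V\<close>, the choice \<open>m = V div 12\<close> respects
    \<open>2 * m * N \<le> n\<close>; and \<open>m \<ge> V / 24\<close> explains the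
    \<open>24\<close> in \<open>K\<close>.\<close>
  define N where "N = nat \<lceil>4 * real n / real V\<rceil>"
  define m where "m = V div 12"
  have Nge: "4 * real n / real V \<le> real N" unfolding N_def by (rule real_nat_ceiling_ge)
  have "real N \<le> 4 * real n / real V + 1" unfolding N_def using V24 n0 by (simp add: ceiling_correct less_imp_le)
  moreover have "1 \<le> 2 * real n / real V" using V(2) V24 by simp
  ultimately have Nle: "real N \<le> 6 * real n / real V" by (simp add: add_divide_distrib)
  have N1: "N \<ge> 1" using Nge V24 n0 by (cases N) (auto simp: field_simps)
  have "6 * real n / real V \<le> real n" using V24 n0 by (simp add: field_simps)
  then have Nn: "N \<le> n" using Nle by linarith
  have m12: "12 * real m \<le> real V" unfolding m_def by linarith
  have m24: "real V \<le> 24 * real m" using V24 unfolding m_def by linarith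
  have mN: "2 * m * N \<le> n"
  proof -
    have "real (2 * m * N) = 2 * real m * real N" by simp
    also have "\<dots> \<le> 2 * (real V / 12) * (6 * real n / real V)"
      using m12 Nle by (intro mult_mono) auto
    also have "\<dots> = real n" using V24 by simp
    finally show ?thesis by linarith
  qed
  let ?c = "maj_weight N u :: 'a poly \<Rightarrow> real"
  have sub: "{D \<in> (monic_squarefree_polys n :: 'a poly set). exp (real V) \<le> norm (poly (L_poly D) u)}
      \<subseteq> {D \<in> monic_polys n. real V / 2 \<le> \<bar>prime_sum ?c 0 N D\<bar>}"
  proof clarify
    fix D :: "'a poly" assume D: "D \<in> monic_squarefree_polys n" "exp (real V) \<le> norm (poly (L_poly D) u)"
    have D': "lead_coeff D = 1" "squarefree D" "degree D = n" using D(1) by (auto simp: monic_squarefree_polys_def)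
    have dD: "degree D \<ge> 1" using D'(3) n0 by simp
    have "exp (real V) \<le> exp (real n / real N + prime_sum ?c 0 N D + ln (real N) / 2 + tail_const CARD('a))"
      using order.trans[OF D(2) norm_L_poly_le_prime_sum[OF q D'(1,2) dD u N1]] unfolding D'(3) .
    then have le: "real V \<le> real n / real N + prime_sum ?c 0 N D + ln (real N) / 2 + tail_const CARD('a)" by simp
    have "4 * real n \<le> real N * real V" using Nge V24 by (simp add: pos_divide_le_eq)
    then have "real n / real N \<le> real V / 4" using N1 by (simp add: pos_divide_le_eq mult.commute)
    moreover have "ln (real N) \<le> ln (real n)" using Nn N1 by simp
    ultimately have "real V / 2 \<le> prime_sum ?c 0 N D" using le n V25 by linarith
    then show "D \<in> monic_polys n \<and> real V / 2 \<le> \<bar>prime_sum ?c 0 N D\<bar>"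
      using D(1) monic_squarefree_subset by auto
  qed
  have "real (card {D \<in> (monic_squarefree_polys n :: 'a poly set). exp (real V) \<le> norm (poly (L_poly D) u)})
      \<le> real (card {D \<in> monic_polys n. real V / 2 \<le> \<bar>prime_sum ?c 0 N D\<bar>})"
    by (intro of_nat_mono card_mono sub) (simp add: monic_polys_finite_card)
  also have "\<dots> \<le> real CARD('a) ^ n * (real m * (ln (real n) + 1) / (real V / 2) ^ 2) ^ m"
    using V24 by (intro card_large_prime_sum_le q mN sum_maj_weight_square_le_ln u Nn n(1)) auto
  also have "\<dots> \<le> real CARD('a) ^ n * (1 / K) ^ m"
  proof (intro mult_left_mono power_mono)
    have "real m * (ln (real n) + 1) / (real V / 2) ^ 2 \<le> (real V / 12) * (2 * ln (real n)) / (real V / 2) ^ 2"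
      using m12 n by (intro divide_right_mono mult_mono) auto
    also have "\<dots> = 2 / 3 * ln (real n) / real V"
    proof -
      have alg: "v / 12 * (2 * x) / (v / 2) ^ 2 = 2 / 3 * x / v" if "v > 0" for v x :: real
        using that by (simp add: power2_eq_square field_simps)
      show ?thesis by (rule alg) (use V24 in simp)
    qed
    also have "\<dots> \<le> 1 / K"
    proof -
      have "0 \<le> K * ln (real n)" using K n(1) by simp
      then have "2 / 3 * ln (real n) * K \<le> 1 * real V" using V(1) by (simp add: mult.commute)
      then show ?thesis using V24 K by (simp only: pos_divide_le_eq pos_le_divide_eq times_divide_eq_left)
    qed
    finally show "real m * (ln (real n) + 1) / (real V / 2) ^ 2 \<le> 1 / K" .
  qed (use n in auto)
  also have "(1 / K) ^ m = exp (- (24 * (real k + 1) * real m))"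
    by (simp add: K_def power_divide exp_minus exp_of_nat_mult[symmetric] inverse_eq_divide mult_ac)
  also have "real CARD('a) ^ n * \<dots> \<le> real CARD('a) ^ n * exp (- (real k + 1) * real V)"
  proof (intro mult_left_mono)
    have "(real k + 1) * real V \<le> (real k + 1) * (24 * real m)" using m24 by (intro mult_left_mono) auto
    then show "exp (- (24 * (real k + 1) * real m)) \<le> exp (- (real k + 1) * real V)" by (simp add: algebra_simps)
  qed auto
  finally show ?thesis .
qed

text \<open>The majorant of length one has vanishing coefficient, so only the loss
  \<open>n / N = n\<close> remains. This caps the range of large values to be summed over.\<close>

lemma norm_L_poly_le_trivial:
  fixes D :: "'a::finite_field poly"
  assumes q: "odd CARD('a)" and D: "lead_coeff D = 1" "squarefree D" "degree D \<ge> 1"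
    and u: "norm u \<le> 1 / sqrt (real CARD('a))"
  shows "norm (poly (L_poly D) u) \<le> exp (real (degree D) + tail_const CARD('a))"
proof -
  have "prime_sum (maj_weight 1 u) 0 1 D = 0"
    unfolding prime_sum_def
  proof (rule sum.neutral, clarify)
    fix P :: "'a poly" assume "P \<in> irred_polys_upto 0 1"
    then have "degree P = 1" by (auto simp: irred_polys_upto_def)
    then show "maj_weight 1 u P * real_of_int (poly_legendre D P) = 0" by (simp add: maj_weight_def maj_coeff_def)
  qed
  then show ?thesis using norm_L_poly_le_prime_sum[OF q D u, of 1] by simp
qed

text \<open>The values are sorted by the integer part \<open>V\<close> of their logarithm. Below the
  threshold \<open>V0\<close> of the large-value estimate the trivial count costs a power of
  \<open>n\<close>; above it the levels form a geometric series. Any exponent \<open>B\<close>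
  independent of \<open>n\<close> and \<open>u\<close> is good enough, since the bound will only be
  used on rare sets.\<close>

lemma crude_moment_bound:
  fixes k :: nat
  assumes q: "odd CARD('a::finite_field)"
  obtains B where "eventually (\<lambda>n. \<forall>u. norm u \<le> 1 / sqrt (real CARD('a)) \<longrightarrow>
    (\<Sum>D\<in>(monic_squarefree_polys n :: 'a poly set). norm (poly (L_poly D) u) ^ k) \<le> real CARD('a) ^ n * real n powr B) sequentially"
proof -
  let ?q = "real CARD('a)"
  define K where "K = exp (24 * (real k + 1))"
  have K0: "K > 0" by (simp add: K_def)
  have ev: "eventually (\<lambda>n. ln (real n) \<ge> 1 \<and> tail_const CARD('a) \<le> ln (real n) \<and> 3 * exp (real k) \<le> real n) sequentially"
    by (intro eventually_conj) real_asymp+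
  have "eventually (\<lambda>n. \<forall>u. norm u \<le> 1 / sqrt ?q \<longrightarrow>
    (\<Sum>D\<in>(monic_squarefree_polys n :: 'a poly set). norm (poly (L_poly D) u) ^ k) \<le> ?q ^ n * real n powr (real k * K + 1)) sequentially"
    using ev
  proof (rule eventually_mono, intro allI impI)
    fix n :: nat and u :: complex
    assume n: "ln (real n) \<ge> 1 \<and> tail_const CARD('a) \<le> ln (real n) \<and> 3 * exp (real k) \<le> real n"
      and u: "norm u \<le> 1 / sqrt ?q"
    have n0: "n \<ge> 1" using n by (cases n) auto
    let ?H = "monic_squarefree_polys n :: 'a poly set"
    let ?L = "\<lambda>D. norm (poly (L_poly D) u)"
    define V0 where "V0 = nat \<lceil>K * ln (real n)\<rceil>"
    have V0: "K * ln (real n) \<le> real V0" "real V0 \<le> K * ln (real n) + 1"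
      unfolding V0_def using n K0 by (auto intro: real_nat_ceiling_ge simp: ceiling_correct less_imp_le)
    have pt: "?L D ^ k \<le> exp (real k * real V0) +
        (\<Sum>V\<in>{V0..2 * n}. if exp (real V) \<le> ?L D then exp (real k * (real V + 1)) else 0)" if D: "D \<in> ?H" for D
    proof (cases "?L D \<le> exp (real V0)")
      case True
      then have "?L D ^ k \<le> exp (real V0) ^ k" by (intro power_mono) auto
      also have "\<dots> = exp (real k * real V0)" by (simp add: exp_of_nat_mult)
      finally show ?thesis by (smt (verit) exp_ge_zero sum_nonneg)
    next
      case False
      then have pos: "?L D > 0" by (smt (verit) exp_gt_zero)
      have D': "lead_coeff D = 1" "squarefree D" "degree D = n" using D by (auto simp: monic_squarefree_polys_def)
      define V where "V = nat \<lfloor>ln (?L D)\<rfloor>"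
      note el = exp_ln[OF pos]
      have "exp (real V0) < exp (ln (?L D))" unfolding el using False by simp
      then have lnV0: "ln (?L D) > real V0" by (simp only: exp_less_cancel_iff)
      then have V: "real V \<le> ln (?L D)" "ln (?L D) < real V + 1" unfolding V_def by linarith+
      have "real V0 < real V + 1" using V lnV0 by linarith
      then have "V0 \<le> V" by linarith
      have dD: "degree D \<ge> 1" using D'(3) n0 by simp
      have "exp (ln (?L D)) \<le> exp (real n + tail_const CARD('a))"
        using norm_L_poly_le_trivial[OF q D'(1,2) dD u] unfolding el D'(3) .
      then have "ln (?L D) \<le> real n + tail_const CARD('a)" by (simp only: exp_le_cancel_iff)
      also have "tail_const CARD('a) \<le> ln (real n)" using n by blast
      also have "ln (real n) \<le> real n" using n0 ln_le_minus_one[of "real n"] by simp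
      finally have "V \<le> 2 * n" using V(1) by linarith
      have "exp (real V) \<le> exp (ln (?L D))" using V(1) by (simp only: exp_le_cancel_iff)
      then have eV: "exp (real V) \<le> ?L D" unfolding el .
      have "exp (ln (?L D)) \<le> exp (real V + 1)" using V(2) by (simp only: exp_le_cancel_iff)
      then have "?L D \<le> exp (real V + 1)" unfolding el .
      then have "?L D ^ k \<le> exp (real V + 1) ^ k" by (intro power_mono) auto
      also have "\<dots> = (if exp (real V) \<le> ?L D then exp (real k * (real V + 1)) else 0)"
        using eV exp_of_nat_mult[of k "real V + 1"] by simp
      also have "\<dots> \<le> (\<Sum>V\<in>{V0..2 * n}. if exp (real V) \<le> ?L D then exp (real k * (real V + 1)) else 0)"
        using \<open>V0 \<le> V\<close> \<open>V \<le> 2 * n\<close> by (intro member_le_sum) auto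
      finally show ?thesis using exp_ge_zero[of "real k * real V0"] by linarith
    qed
    have "(\<Sum>D\<in>?H. ?L D ^ k) \<le> (\<Sum>D\<in>?H. exp (real k * real V0) +
        (\<Sum>V\<in>{V0..2 * n}. if exp (real V) \<le> ?L D then exp (real k * (real V + 1)) else 0))"
      by (rule sum_mono[OF pt])
    also have "\<dots> = real (card ?H) * exp (real k * real V0) +
        (\<Sum>V\<in>{V0..2 * n}. exp (real k * (real V + 1)) * real (card {D \<in> ?H. exp (real V) \<le> ?L D}))"
    proof -
      have "(\<Sum>D\<in>?H. if exp (real V) \<le> ?L D then exp (real k * (real V + 1)) else 0) =
          exp (real k * (real V + 1)) * real (card {D \<in> ?H. exp (real V) \<le> ?L D})" for V
        by (subst sum.inter_filter[symmetric]) (auto simp: finite_monic_squarefree)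
      then show ?thesis by (simp only: sum.distrib sum.swap[of _ _ ?H] sum_constant)
    qed
    also have "\<dots> \<le> ?q ^ n * exp (real k * real V0) + (\<Sum>V\<in>{V0..2 * n}. ?q ^ n * (exp (real k) * exp (- 1) ^ V))"
    proof (intro add_mono mult_right_mono card_monic_squarefree_le sum_mono)
      fix V assume V: "V \<in> {V0..2 * n}"
      have "real (card {D \<in> ?H. exp (real V) \<le> ?L D}) \<le> ?q ^ n * exp (- (real k + 1) * real V)"
        using n V V0 by (intro card_large_values_le q u) (auto simp: K_def)
      then have "exp (real k * (real V + 1)) * real (card {D \<in> ?H. exp (real V) \<le> ?L D}) \<le>
          exp (real k * (real V + 1)) * (?q ^ n * exp (- (real k + 1) * real V))" by (rule mult_left_mono) simp
      also have "\<dots> = ?q ^ n * (exp (real k * (real V + 1)) * exp (- (real k + 1) * real V))" by simp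
      also have "exp (real k * (real V + 1)) * exp (- (real k + 1) * real V) = exp (real k) * exp (- 1) ^ V"
      proof -
        have "real k * (real V + 1) + - (real k + 1) * real V = real k + real V * (- 1)" by (simp add: algebra_simps)
        then show ?thesis by (simp only: exp_add[symmetric] exp_of_nat_mult[symmetric])
      qed
      finally show "exp (real k * (real V + 1)) * real (card {D \<in> ?H. exp (real V) \<le> ?L D}) \<le> ?q ^ n * (exp (real k) * exp (- 1) ^ V)" .
    qed auto
    also have "\<dots> = ?q ^ n * (exp (real k * real V0) + exp (real k) * (\<Sum>V\<in>{V0..2 * n}. exp (- 1) ^ V))"
      by (simp add: sum_distrib_left distrib_left)
    also have "\<dots> \<le> ?q ^ n * (real n powr (real k * K) * exp (real k) + exp (real k) * 2)"
    proof (intro mult_left_mono add_mono)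
      have "real k * real V0 \<le> real k * (K * ln (real n) + 1)" using V0 by (intro mult_left_mono) auto
      then have "exp (real k * real V0) \<le> exp (real k * K * ln (real n) + real k)" by (simp add: algebra_simps)
      then show "exp (real k * real V0) \<le> real n powr (real k * K) * exp (real k)"
        using n0 by (simp add: powr_def exp_add)
      have e: "exp (- 1 :: real) \<le> 1 / 2" using exp_ge_add_one_self[of "1::real"] by (simp add: exp_minus field_simps)
      have "(\<Sum>V\<in>{V0..2 * n}. exp (- 1 :: real) ^ V) \<le> (\<Sum>V. exp (- 1) ^ V)"
        by (intro sum_le_suminf summable_geometric) auto
      also have "\<dots> = 1 / (1 - exp (- 1))" by (rule suminf_geometric) simp
      also have "\<dots> \<le> 2" using e by (simp add: field_simps)
      finally show "(\<Sum>V\<in>{V0..2 * n}. exp (- 1 :: real) ^ V) \<le> 2" .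
    qed auto
    also have "\<dots> \<le> ?q ^ n * (real n powr (real k * K) * real n)"
    proof (intro mult_left_mono)
      have "real n powr 0 \<le> real n powr (real k * K)" using n0 K0 by (intro powr_mono) auto
      then have "1 \<le> real n powr (real k * K)" using n0 by simp
      then have "real n powr (real k * K) * exp (real k) + exp (real k) * 2 \<le> real n powr (real k * K) * (3 * exp (real k))"
        by simp
      also have "\<dots> \<le> real n powr (real k * K) * real n" using n by (intro mult_left_mono) auto
      finally show "real n powr (real k * K) * exp (real k) + exp (real k) * 2 \<le> real n powr (real k * K) * real n" .
    qed auto
    also have "real n powr (real k * K) * real n = real n powr (real k * K + 1)" using n0 by (simp add: powr_add)
    finally show "(\<Sum>D\<in>?H. ?L D ^ k) \<le> ?q ^ n * real n powr (real k * K + 1)" .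
  qed
  then show ?thesis by (rule that)
qed

section \<open>Exponential moments through even Taylor polynomials\<close>

lemma power_div_fact_le_exp:
  fixes x :: real
  assumes "x \<ge> 0"
  shows "x ^ n / fact n \<le> exp x"
proof -
  have "(\<lambda>n. x ^ n / fact n) sums exp x" using exp_converges[of x] by (simp add: field_simps)
  then show ?thesis using assms sum_le_suminf[of "\<lambda>n. x ^ n / fact n" "{n}"] by (auto simp: sums_iff)
qed

lemma power_div_fact_small:
  fixes y :: real
  assumes y: "0 \<le> y" "exp 2 * y \<le> real i"
  shows "y ^ i / fact i \<le> exp (- 1) ^ i"
proof -
  have "real i ^ i / fact i \<le> exp (real i)" by (rule power_div_fact_le_exp) simp
  also have "\<dots> = exp 1 ^ i" by (simp add: exp_of_nat_mult[symmetric])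
  finally have f: "real i ^ i / fact i \<le> exp 1 ^ i" .
  have "(exp 2 * y) ^ i \<le> real i ^ i" using y by (intro power_mono) auto
  then have "exp 2 ^ i * (y ^ i / fact i) \<le> real i ^ i / fact i"
    by (simp add: power_mult_distrib divide_right_mono)
  also note f
  finally have "exp 2 ^ i * (y ^ i / fact i) \<le> exp 1 ^ i" .
  then have "exp (- 2) ^ i * (exp 2 ^ i * (y ^ i / fact i)) \<le> exp (- 2) ^ i * exp 1 ^ i"
    by (rule mult_left_mono) simp
  moreover have "exp (- 2) ^ i * exp 2 ^ i = (1 :: real)"
    by (simp add: power_mult_distrib[symmetric] exp_add[symmetric])
  moreover have "exp (- 2) ^ i * exp 1 ^ i = (exp (- 1) ^ i :: real)"
    by (simp add: power_mult_distrib[symmetric] exp_add[symmetric])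
  ultimately show ?thesis by (simp add: mult.assoc[symmetric])
qed

text \<open>Adding \<open>exp (- \<bar>x\<bar>)\<close> to \<open>exp \<bar>x\<bar>\<close> removes
  the odd powers. What is left is a polynomial in even moments with nonnegative terms, so its sum
  may be enlarged from square-free to all monic \<open>D\<close>. A truncation beyond
  \<open>exp 2 * \<bar>x\<bar>\<close> leaves a bounded remainder.\<close>

lemma exp_le_even_poly:
  fixes x :: real
  assumes l: "exp 2 * \<bar>x\<bar> \<le> real l"
  shows "exp x \<le> 2 * (\<Sum>j\<le>l. x ^ (2 * j) / fact (2 * j)) + 4"
proof -
  define y where "y = \<bar>x\<bar>"
  have y: "y \<ge> 0" by (simp add: y_def)
  define g where "g i = (1 + (- 1) ^ i) * (y ^ i / fact i)" for i :: nat
  have "(\<lambda>n. y ^ n / fact n) sums exp y" "(\<lambda>n. (- y) ^ n / fact n) sums exp (- y)"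
    using exp_converges[of y] exp_converges[of "- y"] by (simp_all add: field_simps)
  then have "(\<lambda>n. y ^ n / fact n + (- y) ^ n / fact n) sums (exp y + exp (- y))" by (rule sums_add)
  moreover have "y ^ n / fact n + (- y) ^ n / fact n = g n" for n
    by (simp add: g_def power_minus[of y] distrib_right add_divide_distrib)
  ultimately have g: "g sums (exp y + exp (- y))" by simp
  \<comment> \<open>With this cut the even indices below \<open>M\<close> are exactly
    \<open>2 * j\<close> with \<open>j \<le> l\<close>. The remainder is dominated by
    \<open>2 * (1 / 2) ^ i\<close>, whose sum is the additive constant \<open>4\<close>.\<close>
  define M where "M = 2 * l + 1"
  have tail: "norm (g r) \<le> 2 * exp (- 1) ^ r" if r: "r \<ge> l" for r
  proof -
    have "exp 2 * y \<le> real l" unfolding y_def by (rule l)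
    then have "exp 2 * y \<le> real r" using r by linarith
    then have "y ^ r / fact r \<le> exp (- 1) ^ r" by (rule power_div_fact_small[OF y])
    moreover have "\<bar>1 + (- 1) ^ r\<bar> \<le> (2 :: real)" by (simp add: minus_one_power_iff)
    moreover have "y ^ r / fact r \<ge> 0" using y by simp
    ultimately have "\<bar>1 + (- 1) ^ r\<bar> * \<bar>y ^ r / fact r\<bar> \<le> 2 * exp (- 1) ^ r"
      by (intro mult_mono) (auto simp only: abs_of_nonneg)
    then show ?thesis unfolding g_def real_norm_def abs_mult .
  qed
  have e: "exp (- 1 :: real) \<le> 1 / 2" using exp_ge_add_one_self[of "1::real"] by (simp add: exp_minus field_simps)
  have tail': "norm (g (i + M)) \<le> 2 * (1 / 2) ^ i" for i
  proof -
    have "norm (g (i + M)) \<le> 2 * exp (- 1) ^ (i + M)" by (rule tail) (simp add: M_def)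
    also have "exp (- 1 :: real) ^ (i + M) \<le> exp (- 1) ^ i" by (rule power_decreasing) auto
    also have "exp (- 1 :: real) ^ i \<le> (1 / 2) ^ i" by (rule power_mono[OF e]) simp
    finally show ?thesis by simp
  qed
  have geo: "(\<lambda>i. 2 * (1 / 2 :: real) ^ i) sums (2 * (1 / (1 - 1 / 2)))"
    by (intro sums_mult geometric_sums) simp
  have "(\<Sum>i. g (i + M)) \<le> 4"
  proof -
    have "norm (\<Sum>i. g (i + M)) \<le> (\<Sum>i. 2 * (1 / 2) ^ i)"
      by (rule norm_suminf_le[OF tail' sums_summable[OF geo]])
    then show ?thesis using sums_unique[OF geo] by simp
  qed
  moreover have "exp y + exp (- y) = (\<Sum>i. g (i + M)) + (\<Sum>i<M. g i)"
    using suminf_split_initial_segment[OF sums_summable[OF g], of M] sums_unique[OF g] by simp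
  moreover have "(\<Sum>i<M. g i) = 2 * (\<Sum>j\<le>l. x ^ (2 * j) / fact (2 * j))"
  proof -
    have "(\<Sum>i<M. g i) = (\<Sum>i\<in>{i \<in> {..<M}. even i}. g i)"
      by (rule sum.mono_neutral_right) (auto simp: g_def)
    also have "\<dots> = (\<Sum>j\<le>l. g (2 * j))"
      by (rule sum.reindex_bij_witness[of _ "\<lambda>j. 2 * j" "\<lambda>i. i div 2"]) (auto simp: M_def)
    also have "\<dots> = (\<Sum>j\<le>l. 2 * (x ^ (2 * j) / fact (2 * j)))"
      by (intro sum.cong refl) (simp add: g_def y_def power_even_abs)
    finally show ?thesis by (simp add: sum_distrib_left)
  qed
  moreover have "exp x \<le> exp y" by (simp add: y_def)
  ultimately show ?thesis using exp_ge_zero[of "- y"] by linarith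
qed

text \<open>The factorial \<open>(2 * j)!\<close> of the Taylor polynomial cancels against the
  Gaussian moment, and the exponential series of \<open>t^2 * \<sigma> / 2\<close> remains. With
  \<open>t = k\<close> and \<open>\<sigma>\<close> about \<open>ln n\<close> this is the power
  \<open>n^(k^2 / 2)\<close>.\<close>

lemma sum_exp_prime_sum_le:
  fixes c :: "'a::finite_field poly \<Rightarrow> real"
  assumes q: "odd CARD('a)" and n: "2 * l * N \<le> n" and \<sigma>: "(\<Sum>P\<in>irred_polys_upto z N. c P ^ 2) \<le> \<sigma>"
  shows "(\<Sum>D\<in>monic_polys n. 2 * (\<Sum>j\<le>l. (t * prime_sum c z N D) ^ (2 * j) / fact (2 * j)) + 4)
    \<le> real CARD('a) ^ n * (2 * exp (t ^ 2 * \<sigma> / 2) + 4)"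
proof -
  let ?q = "real CARD('a)"
  have \<sigma>0: "\<sigma> \<ge> 0" by (rule order.trans[OF sum_nonneg \<sigma>]) simp
  have "(\<Sum>D\<in>monic_polys n. \<Sum>j\<le>l. (t * prime_sum c z N D) ^ (2 * j) / fact (2 * j)) =
      (\<Sum>j\<le>l. t ^ (2 * j) / fact (2 * j) * (\<Sum>D\<in>monic_polys n. prime_sum c z N D ^ (2 * j)))"
    by (subst sum.swap) (simp add: power_mult_distrib sum_distrib_left)
  also have "\<dots> \<le> (\<Sum>j\<le>l. t ^ (2 * j) / fact (2 * j) * (?q ^ n * (fact (2 * j) / (2 ^ j * fact j) * \<sigma> ^ j)))"
  proof (intro sum_mono mult_left_mono moment_prime_sum_le[OF q _ \<sigma>])
    fix j assume "j \<in> {..l}"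
    then have "2 * j * N \<le> 2 * l * N" by simp
    then show "2 * j * N \<le> n" using n by linarith
  qed auto
  also have "\<dots> = ?q ^ n * (\<Sum>j\<le>l. (t ^ 2 * \<sigma> / 2) ^ j / fact j)"
    unfolding sum_distrib_left
    by (intro sum.cong refl) (simp add: power_mult_distrib power_divide power_mult)
  also have "\<dots> \<le> ?q ^ n * exp (t ^ 2 * \<sigma> / 2)"
  proof (intro mult_left_mono)
    have "(\<lambda>n. (t ^ 2 * \<sigma> / 2) ^ n / fact n) sums exp (t ^ 2 * \<sigma> / 2)"
      using exp_converges[of "t ^ 2 * \<sigma> / 2"] by (simp add: field_simps)
    then show "(\<Sum>j\<le>l. (t ^ 2 * \<sigma> / 2) ^ j / fact j) \<le> exp (t ^ 2 * \<sigma> / 2)"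
      using sum_le_suminf[of "\<lambda>j. (t ^ 2 * \<sigma> / 2) ^ j / fact j" "{..l}"] \<sigma>0 by (auto simp: sums_iff)
  qed auto
  finally have *: "(\<Sum>D\<in>monic_polys n. \<Sum>j\<le>l. (t * prime_sum c z N D) ^ (2 * j) / fact (2 * j)) \<le> ?q ^ n * exp (t ^ 2 * \<sigma> / 2)" .
  have "(\<Sum>D\<in>monic_polys n. 2 * (\<Sum>j\<le>l. (t * prime_sum c z N D) ^ (2 * j) / fact (2 * j)) + 4) =
      2 * (\<Sum>D\<in>monic_polys n. \<Sum>j\<le>l. (t * prime_sum c z N D) ^ (2 * j) / fact (2 * j)) + 4 * ?q ^ n"
    by (simp only: sum.distrib sum_distrib_left[symmetric] sum_constant card_monic_polys) simp
  then show ?thesis using * by (simp add: distrib_left)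
qed

lemma prime_sum_split:
  assumes "z \<le> N"
  shows "prime_sum c 0 N D = prime_sum c 0 z D + prime_sum c z N D"
proof -
  have "{0<..N} = {0<..z} \<union> {z<..N}" using assms by auto
  then show ?thesis unfolding prime_sum_def sum_irred_polys_upto by (simp add: sum.union_disjoint)
qed

lemma powr_le_1_of_powr_mult: "(x :: real) > 0 \<Longrightarrow> x powr (- b) * x powr b = 1"
  by (simp flip: powr_add)

text \<open>
  The parameters: \<open>N\<close> is the length of the prime sum, \<open>z\<close> splits it into a long part of variance
  \<open>log n\<close>, treated by exponential moments, and a short tail of bounded variance.
\<close>

locale moment_params =
  fixes k n N z l m1 m2 :: nat and \<eta> B \<sigma>2 :: real and ty :: "'a::finite_field itself"
  assumes q: "odd CARD('a)" and \<eta>: "\<eta> > 0" and B: "B \<ge> 1" and n: "ln (real n) \<ge> 1"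
    and N: "N \<ge> 1" "N \<le> n" "real n / real N \<le> \<eta> * ln (real n)" "z \<le> N"
    and z: "2 * l * z \<le> n" "(\<Sum>d\<in>{z<..N}. 1 / real d) \<le> \<sigma>2"
    and l: "exp 2 * (real k * (4 * B * ln (real n))) \<le> real l" "m1 \<le> l"
    and m1: "B * ln (real n) \<le> real m1" "real m1 \<le> 2 * B * ln (real n)"
    and m2: "2 * m2 * N \<le> n" "(real m2 * \<sigma>2 / (\<eta> * ln (real n)) ^ 2) ^ m2 \<le> real n powr (- B)"
begin

lemma n0: "real n > 0" using n by (cases n) auto

text \<open>Outside two exceptional sets the short sum is within the range of the Taylor polynomial
  and the tail is below \<open>\<eta> * ln n\<close>. Both sets have relative size at most
  \<open>n^(-B)\<close>, matching the crude bound \<open>n^B\<close>, so together with it they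
  contribute only the constant \<open>3\<close>.\<close>

lemma moment_bound:
  assumes u: "norm u \<le> 1 / sqrt (real CARD('a))"
    and crude: "(\<Sum>D\<in>(monic_squarefree_polys n :: 'a poly set). norm (poly (L_poly D) u) ^ (2 * k)) \<le> real CARD('a) ^ n * real n powr B"
  shows "(\<Sum>D\<in>(monic_squarefree_polys n :: 'a poly set). norm (poly (L_poly D) u) ^ k) \<le>
    real CARD('a) ^ n * (real n powr (real k * (2 * \<eta> + 1 / 2)) * exp (real k * tail_const CARD('a)) *
      (2 * exp ((real k)\<^sup>2 * (ln (real n) + 1) / 2) + 4) + 3)"
proof -
  let ?q = "real CARD('a)"
  let ?H = "monic_squarefree_polys n :: 'a poly set"
  let ?L = "\<lambda>D. norm (poly (L_poly D) u)"
  let ?c = "maj_weight N u :: 'a poly \<Rightarrow> real"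
  let ?S1 = "prime_sum ?c 0 z" and ?S2 = "prime_sum ?c z N"
  \<comment> \<open>The deterministic losses: one \<eta> from \<open>n / N\<close>, one from the
    tail beyond \<open>z\<close>, and \<open>1 / 2\<close> from the squares of primes.\<close>
  define G where "G = real n powr (real k * (2 * \<eta> + 1 / 2)) * exp (real k * tail_const CARD('a))"
  define E where "E D = 2 * (\<Sum>j\<le>l. (real k * ?S1 D) ^ (2 * j) / fact (2 * j)) + 4" for D
  define A1 where "A1 = {D \<in> (monic_polys n :: 'a poly set). 4 * B * ln (real n) \<le> \<bar>?S1 D\<bar>}"
  define A2 where "A2 = {D \<in> (monic_polys n :: 'a poly set). \<eta> * ln (real n) \<le> \<bar>?S2 D\<bar>}"
  have G0: "G \<ge> 0" by (simp add: G_def)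
  have E0: "E D \<ge> 0" for D
  proof -
    have "(\<Sum>j\<le>l. (real k * ?S1 D) ^ (2 * j) / fact (2 * j)) \<ge> 0"
      by (intro sum_nonneg divide_nonneg_nonneg zero_le_even_power) auto
    then show ?thesis unfolding E_def by linarith
  qed
  have zn: "z \<le> n" using N by simp
  have \<sigma>1: "(\<Sum>P\<in>irred_polys_upto 0 z. ?c P ^ 2) \<le> ln (real n) + 1"
    by (rule sum_maj_weight_square_le_ln[OF u N(4) zn n])
  have \<sigma>2: "(\<Sum>P\<in>irred_polys_upto z N. ?c P ^ 2) \<le> \<sigma>2"
    by (rule order.trans[OF sum_maj_weight_square_le[OF u order_refl] z(2)])
  have card1: "real (card A1) \<le> ?q ^ n * real n powr (- B)"
  proof -
    have "2 * m1 * z \<le> 2 * l * z" using l(2) by simp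
    then have mz: "2 * m1 * z \<le> n" using z(1) by linarith
    have T: "4 * B * ln (real n) > 0" using B n by simp
    have "real (card A1) \<le> ?q ^ n * (real m1 * (ln (real n) + 1) / (4 * B * ln (real n)) ^ 2) ^ m1"
      unfolding A1_def by (rule card_large_prime_sum_le[OF q mz \<sigma>1 T])
    \<comment> \<open>The threshold \<open>4 * B * ln n\<close> is set so that the base is at most
      \<open>1 / (4 * B)\<close>, hence below \<open>exp (- 1)\<close>; then
      \<open>m1 \<ge> B * ln n\<close> moments give the factor \<open>n^(-B)\<close>.\<close>
    also have "\<dots> \<le> ?q ^ n * (exp (- 1)) ^ m1"
    proof (intro mult_left_mono power_mono)
      have "real m1 * (ln (real n) + 1) / (4 * B * ln (real n)) ^ 2 \<le>
          (2 * B * ln (real n)) * (2 * ln (real n)) / (4 * B * ln (real n)) ^ 2"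
        using m1 n by (intro divide_right_mono mult_mono) auto
      also have "\<dots> = 1 / (4 * B)"
      proof -
        have alg: "(2 * b * x) * (2 * x) / (4 * b * x) ^ 2 = 1 / (4 * b)" if "b > 0" "x > 0" for b x :: real
          using that by (simp add: power2_eq_square field_simps)
        show ?thesis by (rule alg) (use B n in auto)
      qed
      also have "\<dots> \<le> 1 / 4" using B by (simp add: field_simps)
      also have "\<dots> \<le> exp (- 1)" using exp_le by (simp add: exp_minus field_simps)
      finally show "real m1 * (ln (real n) + 1) / (4 * B * ln (real n)) ^ 2 \<le> exp (- 1)" .
    qed (use n in auto)
    also have "(exp (- 1)) ^ m1 = exp (- real m1)" by (simp add: exp_of_nat_mult[symmetric])
    also have "\<dots> \<le> exp (- B * ln (real n))" using m1(1) by simp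
    also have "\<dots> = real n powr (- B)" using n0 by (simp add: powr_def)
    finally show ?thesis by (simp add: mult_left_mono)
  qed
  have card2: "real (card A2) \<le> ?q ^ n * real n powr (- B)"
  proof -
    have T: "\<eta> * ln (real n) > 0" using \<eta> n by simp
    have "real (card A2) \<le> ?q ^ n * (real m2 * \<sigma>2 / (\<eta> * ln (real n)) ^ 2) ^ m2"
      unfolding A2_def by (rule card_large_prime_sum_le[OF q m2(1) \<sigma>2 T])
    also have "\<dots> \<le> ?q ^ n * real n powr (- B)" by (intro mult_left_mono m2(2)) simp
    finally show ?thesis .
  qed
  \<comment> \<open>On the exceptional sets a pointwise substitute for the Cauchy-Schwarz inequality
    is used: a value \<open>y\<close> is either at most \<open>n^B\<close> or at most
    \<open>n^(-B) * y^2\<close>.\<close>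
  have pt: "?L D ^ k \<le> G * E D + real n powr (- B) * ?L D ^ (2 * k) +
      real n powr B * ((if D \<in> A1 then 1 else 0) + (if D \<in> A2 then 1 else 0))" if D: "D \<in> ?H" for D
  proof (cases "D \<in> A1 \<or> D \<in> A2")
    case True
    have GE: "G * E D \<ge> 0" using G0 E0 by simp
    show ?thesis
    proof (cases "?L D ^ k \<le> real n powr B")
      case small: True
      have "real n powr B * 1 \<le> real n powr B * ((if D \<in> A1 then 1 else 0) + (if D \<in> A2 then 1 else 0))"
        using True by (intro mult_left_mono) auto
      moreover have "real n powr (- B) * ?L D ^ (2 * k) \<ge> 0" by simp
      ultimately show ?thesis using small GE by linarith
    next
      case False
      have "real n powr (- B) * real n powr B * ?L D ^ k \<le> real n powr (- B) * ?L D ^ k * ?L D ^ k"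
        using False by (simp add: mult_right_mono mult_left_mono mult.assoc)
      then have "?L D ^ k \<le> real n powr (- B) * ?L D ^ (2 * k)"
        unfolding powr_le_1_of_powr_mult[OF n0] by (simp add: mult_2 power_add mult.assoc)
      moreover have "real n powr B * ((if D \<in> A1 then 1 else 0) + (if D \<in> A2 then 1 else 0)) \<ge> 0" by simp
      ultimately show ?thesis using GE by linarith
    qed
  next
    case False
    have Dm: "D \<in> monic_polys n" using D monic_squarefree_subset by blast
    then have S1: "\<bar>?S1 D\<bar> \<le> 4 * B * ln (real n)" and S2: "\<bar>?S2 D\<bar> \<le> \<eta> * ln (real n)"
      using False by (auto simp: A1_def A2_def)
    have D': "lead_coeff D = 1" "squarefree D" "degree D = n" using D by (auto simp: monic_squarefree_polys_def)
    have dD: "degree D \<ge> 1" using D'(3) n0 by simp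
    have "ln (real N) \<le> ln (real n)" using N(1,2) by simp
    then have "real n / real N + prime_sum ?c 0 N D + ln (real N) / 2 + tail_const CARD('a) \<le>
        (2 * \<eta> + 1 / 2) * ln (real n) + tail_const CARD('a) + ?S1 D"
      unfolding prime_sum_split[OF N(4)] using N(3) S2 by (simp add: algebra_simps)
    then have "?L D \<le> exp ((2 * \<eta> + 1 / 2) * ln (real n) + tail_const CARD('a) + ?S1 D)"
      using norm_L_poly_le_prime_sum[OF q D'(1,2) dD u N(1)] unfolding D'(3) by (meson exp_le_cancel_iff order.trans)
    then have "?L D ^ k \<le> exp ((2 * \<eta> + 1 / 2) * ln (real n) + tail_const CARD('a) + ?S1 D) ^ k"
      by (intro power_mono) auto
    also have "\<dots> = exp (real k * (2 * \<eta> + 1 / 2) * ln (real n) + real k * tail_const CARD('a) + real k * ?S1 D)"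
      unfolding exp_of_nat_mult[symmetric] by (simp add: distrib_left mult.assoc)
    also have "\<dots> = G * exp (real k * ?S1 D)"
      using n0 by (simp add: G_def powr_def exp_add)
    also have "\<dots> \<le> G * E D"
      unfolding E_def
    proof (intro mult_left_mono exp_le_even_poly G0)
      have "exp 2 * \<bar>real k * ?S1 D\<bar> \<le> exp 2 * (real k * (4 * B * ln (real n)))"
        using S1 by (intro mult_left_mono) (auto simp: abs_mult intro!: mult_left_mono)
      then show "exp 2 * \<bar>real k * ?S1 D\<bar> \<le> real l" using l(1) by linarith
    qed
    finally have "?L D ^ k \<le> G * E D" .
    moreover have "real n powr (- B) * ?L D ^ (2 * k) \<ge> 0" by simp
    moreover have "real n powr B * ((if D \<in> A1 then 1 else 0) + (if D \<in> A2 then 1 else 0)) \<ge> 0" by simp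
    ultimately show ?thesis by linarith
  qed
  have fin: "finite ?H" by (rule finite_monic_squarefree)
  have cnt: "(\<Sum>D\<in>?H. if D \<in> A then 1 else 0) \<le> real (card A)" if "finite A" for A
  proof -
    have "(\<Sum>D\<in>?H. if D \<in> A then 1 else 0) = real (card (?H \<inter> A))" using fin by (simp add: sum.If_cases)
    also have "\<dots> \<le> real (card A)" using that by (intro of_nat_mono card_mono) auto
    finally show ?thesis .
  qed
  have finA: "finite A1" "finite A2" by (simp_all add: A1_def A2_def monic_polys_finite_card)
  have "(\<Sum>D\<in>?H. ?L D ^ k) \<le> (\<Sum>D\<in>?H. G * E D + real n powr (- B) * ?L D ^ (2 * k) +
      real n powr B * ((if D \<in> A1 then 1 else 0) + (if D \<in> A2 then 1 else 0)))"
    by (rule sum_mono[OF pt])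
  also have "\<dots> = G * (\<Sum>D\<in>?H. E D) + real n powr (- B) * (\<Sum>D\<in>?H. ?L D ^ (2 * k)) +
      real n powr B * ((\<Sum>D\<in>?H. if D \<in> A1 then 1 else 0) + (\<Sum>D\<in>?H. if D \<in> A2 then 1 else 0))"
    by (simp only: sum.distrib sum_distrib_left[symmetric])
  also have "\<dots> \<le> G * (?q ^ n * (2 * exp ((real k)\<^sup>2 * (ln (real n) + 1) / 2) + 4)) + real n powr (- B) * (?q ^ n * real n powr B) +
      real n powr B * (?q ^ n * real n powr (- B) + ?q ^ n * real n powr (- B))"
  proof (intro add_mono mult_left_mono crude G0)
    have "(\<Sum>D\<in>?H. E D) \<le> (\<Sum>D\<in>monic_polys n. E D)"
      using E0 by (intro sum_mono2 monic_polys_finite_card monic_squarefree_subset)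
    also have "\<dots> \<le> ?q ^ n * (2 * exp ((real k)\<^sup>2 * (ln (real n) + 1) / 2) + 4)"
      unfolding E_def by (rule sum_exp_prime_sum_le[OF q z(1) \<sigma>1])
    finally show "(\<Sum>D\<in>?H. E D) \<le> ?q ^ n * (2 * exp ((real k)\<^sup>2 * (ln (real n) + 1) / 2) + 4)" .
    show "(\<Sum>D\<in>?H. if D \<in> A1 then 1 else 0) \<le> ?q ^ n * real n powr (- B)"
      using cnt[OF finA(1)] card1 by linarith
    show "(\<Sum>D\<in>?H. if D \<in> A2 then 1 else 0) \<le> ?q ^ n * real n powr (- B)"
      using cnt[OF finA(2)] card2 by linarith
  qed auto
  also have "\<dots> = ?q ^ n * (G * (2 * exp ((real k)\<^sup>2 * (ln (real n) + 1) / 2) + 4) + 3 * (real n powr (- B) * real n powr B))"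
    by (simp add: algebra_simps)
  finally show ?thesis unfolding powr_le_1_of_powr_mult[OF n0] G_def by (simp add: mult.assoc)
qed

end

lemma sum_inverse_tail_le:
  "(\<Sum>d\<in>{z<..N}. 1 / real d) \<le> real N / (real z + 1)"
proof -
  have "(\<Sum>d\<in>{z<..N}. 1 / real d) \<le> (\<Sum>d\<in>{z<..N}. 1 / (real z + 1))"
    by (intro sum_mono divide_left_mono) auto
  also have "\<dots> = real (N - z) / (real z + 1)" by simp
  also have "\<dots> \<le> real N / (real z + 1)" by (intro divide_right_mono) auto
  finally show ?thesis .
qed

text \<open>The bound holds uniformly in \<open>u\<close> on the closed disc of radius
  \<open>1 / \<surd>q\<close>; this uniformity is what the averaging for derivatives relies on. The
  proof consists in fitting the parameters of the preceding locale.\<close>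

theorem L_poly_moment_bound:
  fixes k :: nat and \<epsilon> :: real
  assumes q: "odd CARD('a::finite_field)" and \<epsilon>: "\<epsilon> > 0"
  obtains C where "eventually (\<lambda>n. \<forall>u. norm u \<le> 1 / sqrt (real CARD('a)) \<longrightarrow>
    (\<Sum>D\<in>(monic_squarefree_polys n :: 'a poly set). norm (poly (L_poly D) u) ^ k) \<le>
      C * (real CARD('a) ^ n * real n powr (real k * (real k + 1) / 2 + \<epsilon>))) sequentially"
proof -
  let ?q = "real CARD('a)"
  obtain B0 where crude: "eventually (\<lambda>n. \<forall>u. norm u \<le> 1 / sqrt ?q \<longrightarrow>
    (\<Sum>D\<in>(monic_squarefree_polys n :: 'a poly set). norm (poly (L_poly D) u) ^ (2 * k)) \<le> ?q ^ n * real n powr B0) sequentially"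
    using crude_moment_bound[OF q] by blast
  define B where "B = max B0 1"
  \<comment> \<open>This makes \<open>2 * k * \<eta> \<le> \<epsilon>\<close>, also for
    \<open>k = 0\<close>.\<close>
  define \<eta> where "\<eta> = \<epsilon> / (2 * real k + 1)"
  define c where "c = max (exp 2 * (real k * (4 * B))) (max (2 * B) \<eta>)"
  define \<sigma>2 where "\<sigma>2 = 8 * c / \<eta>"
  \<comment> \<open>Since \<open>m2\<close> will be at least \<open>\<eta> * x / 8\<close>, a base
    of at most \<open>exp (- A)\<close> suffices for the exceptional factor
    \<open>n^(-B)\<close>.\<close>
  define A where "A = 8 * B / \<eta>"
  have B: "B \<ge> 1" "B0 \<le> B" by (auto simp: B_def)
  have \<eta>: "\<eta> > 0" using \<epsilon> by (simp add: \<eta>_def)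
  have c: "exp 2 * (real k * (4 * B)) \<le> c" "2 * B \<le> c" "\<eta> \<le> c" by (auto simp: c_def)
  have c2: "c \<ge> 2" using c(2) B by simp
  have \<sigma>2: "\<sigma>2 > 0" using c2 \<eta> by (simp add: \<sigma>2_def)
  \<comment> \<open>The entry \<open>8 / \<eta>\<close> keeps the rounding in \<open>m2\<close>
    harmless, and the last entry makes the base for the tail moments at most
    \<open>exp (- A)\<close>: the variance is bounded while the squared threshold grows.\<close>
  define x0 where "x0 = max 1 (max (8 / \<eta>) (\<sigma>2 * exp A / (4 * \<eta>)))"
  have ev: "eventually (\<lambda>n. x0 \<le> ln (real n)) sequentially" by real_asymp
  have ev': "eventually (\<lambda>n. \<eta> * ln (real n) \<le> real n) sequentially" using \<eta> by real_asymp
  define C where "C = exp (real k * tail_const CARD('a)) * (2 * exp ((real k)\<^sup>2 / 2) + 4) + 3"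
  have "eventually (\<lambda>n. \<forall>u. norm u \<le> 1 / sqrt ?q \<longrightarrow>
    (\<Sum>D\<in>(monic_squarefree_polys n :: 'a poly set). norm (poly (L_poly D) u) ^ k) \<le>
      C * (?q ^ n * real n powr (real k * (real k + 1) / 2 + \<epsilon>))) sequentially"
    using crude ev ev'
  proof eventually_elim
    case (elim n)
    define x where "x = ln (real n)"
    have x: "x \<ge> 1" "8 \<le> \<eta> * x" "\<sigma>2 * exp A \<le> 4 * \<eta> * x" "\<eta> * x \<le> real n"
      using elim(2,3) \<eta> by (auto simp: x_def x0_def field_simps)
    have n0: "real n \<ge> 1" using x(2,4) by linarith
    define N where "N = nat \<lceil>real n / (\<eta> * x)\<rceil>"
    define l where "l = nat \<lceil>c * x\<rceil>"
    \<comment> \<open>The greatest length for which moments up to order \<open>2 * l\<close> are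
      exact. As \<open>l\<close> is a multiple of \<open>ln n\<close>, the quotient of
      \<open>N\<close> by \<open>z + 1\<close> stays bounded, and hence so does the variance beyond
      \<open>z\<close>.\<close>
    define z where "z = n div (2 * l)"
    define m1 where "m1 = nat \<lceil>B * x\<rceil>"
    define m2 where "m2 = nat \<lfloor>\<eta> * x / 4\<rfloor>"
    have \<eta>x: "\<eta> * x > 0" using x by linarith
    have Nge: "real n / (\<eta> * x) \<le> real N" unfolding N_def by (rule real_nat_ceiling_ge)
    have "real n / (\<eta> * x) > 0" using \<eta>x n0 by simp
    then have "real N \<le> real n / (\<eta> * x) + 1" unfolding N_def by linarith
    moreover have "1 \<le> real n / (\<eta> * x)" using x(4) \<eta>x by simp
    ultimately have Nle: "real N \<le> 2 * real n / (\<eta> * x)" by (simp add: add_divide_distrib)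
    have N1: "N \<ge> 1" using Nge \<open>1 \<le> real n / (\<eta> * x)\<close> by linarith
    have "2 * real n / (\<eta> * x) \<le> 2 * real n / 2" using x(2) by (intro divide_left_mono) auto
    then have Nn: "N \<le> n" using Nle by simp
    have cx: "c * x \<ge> 2" using mult_mono[of 2 c 1 x] c2 x by simp
    have l: "c * x \<le> real l" "real l \<le> 2 * (c * x)" unfolding l_def using cx by linarith+
    have l0: "l > 0" using l(1) cx by linarith
    have Bx: "B * x \<ge> 1" using mult_mono[of 1 B 1 x] B x by simp
    have m1: "B * x \<le> real m1" "real m1 \<le> 2 * B * x" unfolding m1_def using Bx by linarith+
    have m2: "real m2 \<le> \<eta> * x / 4" "\<eta> * x / 8 \<le> real m2" unfolding m2_def using x(2) by linarith+
    have z2: "2 * l * z \<le> n" unfolding z_def by (rule times_div_less_eq_dividend)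
    have zlt: "real n \<le> 2 * real l * (real z + 1)"
    proof -
      have "n < 2 * l * (z + 1)" unfolding z_def using l0 by (metis Suc_eq_plus1 dividend_less_times_div mult_Suc_right add.commute nat_0_less_mult_iff zero_less_numeral)
      then have "real n < real (2 * l * (z + 1))" by (simp only: of_nat_less_iff)
      then show ?thesis by (simp add: algebra_simps)
    qed
    have zN: "z \<le> N"
    proof -
      have "2 * (c * x) * real z \<le> 2 * real l * real z" using l(1) by (intro mult_right_mono) auto
      also have "\<dots> \<le> real n" using of_nat_mono[OF z2, where 'a = real] by simp
      also have "\<dots> \<le> real N * (\<eta> * x)" using Nge \<eta>x by (simp add: pos_divide_le_eq)
      also have "\<dots> \<le> real N * (2 * (c * x))" using c(3) x \<eta> c2 by (intro mult_left_mono) (auto intro: order.trans[OF mult_right_mono[OF c(3)]])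
      finally have "2 * (c * x) * real z \<le> 2 * (c * x) * real N" by (simp add: mult.commute)
      then have "real z \<le> real N" by (rule mult_left_le_imp_le) (use cx in simp)
      then show ?thesis by simp
    qed
    have tail: "(\<Sum>d\<in>{z<..N}. 1 / real d) \<le> \<sigma>2"
    proof -
      have "(\<Sum>d\<in>{z<..N}. 1 / real d) \<le> real N / (real z + 1)" by (rule sum_inverse_tail_le)
      also have "\<dots> \<le> \<sigma>2"
      proof -
        have "real N * (\<eta> * x) \<le> 2 * real n" using Nle \<eta>x by (simp add: pos_le_divide_eq)
        also have "\<dots> \<le> 2 * (2 * real l * (real z + 1))" using zlt by simp
        also have "\<dots> \<le> 2 * (2 * (2 * (c * x)) * (real z + 1))" using l(2) by (intro mult_left_mono mult_right_mono) auto
        also have "\<dots> = \<sigma>2 * (real z + 1) * (\<eta> * x)" using \<eta> by (simp add: \<sigma>2_def)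
        finally have "real N \<le> \<sigma>2 * (real z + 1)" using \<eta>x by (rule mult_right_le_imp_le)
        then show ?thesis by (simp add: pos_divide_le_eq)
      qed
      finally show ?thesis .
    qed
    have m2N: "2 * m2 * N \<le> n"
    proof -
      have "real (2 * m2 * N) = 2 * real m2 * real N" by simp
      also have "\<dots> \<le> 2 * (\<eta> * x / 4) * (2 * real n / (\<eta> * x))"
        using m2(1) Nle \<eta>x by (intro mult_mono) auto
      also have "\<dots> = real n"
      proof -
        have alg: "2 * (e / 4) * (2 * r / e) = r" if "e \<noteq> 0" for e r :: real using that by simp
        show ?thesis by (rule alg) (use x(1) \<eta> in simp)
      qed
      finally show ?thesis by linarith
    qed
    have m2p: "(real m2 * \<sigma>2 / (\<eta> * x) ^ 2) ^ m2 \<le> real n powr (- B)"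
    proof -
      have "real m2 * \<sigma>2 / (\<eta> * x) ^ 2 \<le> (\<eta> * x / 4) * \<sigma>2 / (\<eta> * x) ^ 2"
        using m2(1) \<sigma>2 by (intro divide_right_mono mult_right_mono) auto
      also have "\<dots> = \<sigma>2 / (4 * \<eta> * x)"
        using \<eta>x by (simp add: power2_eq_square)
      also have "\<dots> \<le> exp (- A)"
      proof -
        have "\<sigma>2 * exp A * exp (- A) \<le> 4 * \<eta> * x * exp (- A)" using x(3) by (rule mult_right_mono) simp
        moreover have "\<sigma>2 * exp A * exp (- A) = \<sigma>2" by (simp add: exp_minus)
        ultimately have "\<sigma>2 \<le> exp (- A) * (4 * \<eta> * x)" by (simp only: mult.commute)
        then show ?thesis using \<eta>x by (simp add: pos_divide_le_eq mult.assoc)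
      qed
      finally have "(real m2 * \<sigma>2 / (\<eta> * x) ^ 2) ^ m2 \<le> exp (- A) ^ m2" using \<sigma>2 by (intro power_mono) auto
      also have "\<dots> = exp (- (A * real m2))" by (simp add: exp_of_nat_mult[symmetric] mult.commute)
      also have "\<dots> \<le> exp (- (B * x))"
      proof -
        have "A * (\<eta> * x / 8) \<le> A * real m2" using m2(2) B \<eta> by (intro mult_left_mono) (auto simp: A_def)
        moreover have "A * (\<eta> * x / 8) = B * x" using \<eta> by (simp add: A_def)
        ultimately have "B * x \<le> A * real m2" by (simp only:)
        then show ?thesis by (simp only: exp_le_cancel_iff neg_le_iff_le)
      qed
      also have "\<dots> = real n powr (- B)" using n0 by (simp add: powr_def x_def)
      finally show ?thesis .
    qed
    have m1l: "m1 \<le> l"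
    proof -
      have "2 * B * x \<le> c * x" using c(2) x by (intro mult_right_mono) auto
      then show ?thesis using m1(2) l(1) by linarith
    qed
    have lk: "exp 2 * (real k * (4 * B * x)) \<le> real l"
    proof -
      have "exp 2 * (real k * (4 * B)) * x \<le> c * x" using c(1) x by (intro mult_right_mono) auto
      then show ?thesis using l(1) by (simp add: mult.assoc)
    qed
    have nN: "real n / real N \<le> \<eta> * x"
      using Nge N1 \<eta>x by (simp add: pos_divide_le_eq mult.commute)
    interpret mp: moment_params k n N z l m1 m2 \<eta> B \<sigma>2 "TYPE('a)"
      using q \<eta> B x(1) N1 Nn nN zN z2 tail lk m1l m1 m2N m2p by unfold_locales (simp_all add: x_def)
    show ?case
    proof (intro allI impI)
      fix u :: complex assume u: "norm u \<le> 1 / sqrt ?q"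
      have "(\<Sum>D\<in>(monic_squarefree_polys n :: 'a poly set). norm (poly (L_poly D) u) ^ (2 * k)) \<le> ?q ^ n * real n powr B0"
        using elim(1) u by blast
      also have "\<dots> \<le> ?q ^ n * real n powr B" using n0 B by (intro mult_left_mono powr_mono) auto
      finally have cr: "(\<Sum>D\<in>(monic_squarefree_polys n :: 'a poly set). norm (poly (L_poly D) u) ^ (2 * k)) \<le> ?q ^ n * real n powr B" .
      define a where "a = real n powr (real k * (2 * \<eta> + 1 / 2))"
      define b where "b = real n powr ((real k)\<^sup>2 / 2)"
      define t where "t = exp (real k * tail_const CARD('a))"
      define s where "s = exp ((real k)\<^sup>2 / 2)"
      have a1: "a \<ge> 1" unfolding a_def using n0 \<eta> by (intro ge_one_powr_ge_zero) auto
      have b1: "b \<ge> 1" unfolding b_def using n0 by (intro ge_one_powr_ge_zero) auto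
      have ab1: "a * b \<ge> 1" using mult_mono[OF a1 b1] a1 by simp
      have st: "s > 0" "t > 0" by (simp_all add: s_def t_def)
      have e: "exp ((real k)\<^sup>2 * (ln (real n) + 1) / 2) = b * s"
        using n0 by (simp add: b_def s_def powr_def exp_add[symmetric] distrib_left add_divide_distrib)
      have "(\<Sum>D\<in>(monic_squarefree_polys n :: 'a poly set). norm (poly (L_poly D) u) ^ k) \<le>
          ?q ^ n * (a * t * (2 * (b * s) + 4) + 3)"
        using mp.moment_bound[OF u cr] unfolding e a_def[symmetric] t_def[symmetric] .
      also have "\<dots> \<le> ?q ^ n * (C * (a * b))"
      proof (intro mult_left_mono)
        have "a * t * (2 * (b * s) + 4) \<le> a * t * (2 * (b * s) + 4 * b)"
          using a1 b1 st by (intro mult_left_mono) auto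
        also have "\<dots> = (t * (2 * s + 4)) * (a * b)" by (simp add: algebra_simps)
        finally have "a * t * (2 * (b * s) + 4) + 3 \<le> (t * (2 * s + 4)) * (a * b) + 3 * (a * b)" using ab1 by simp
        then show "a * t * (2 * (b * s) + 4) + 3 \<le> C * (a * b)" by (simp add: C_def s_def t_def distrib_right)
      qed simp
      also have "a * b \<le> real n powr (real k * (real k + 1) / 2 + \<epsilon>)"
      proof -
        have "2 * real k * \<eta> \<le> \<epsilon>"
        proof -
          have "2 * real k * \<eta> = \<epsilon> * (2 * real k / (2 * real k + 1))" by (simp add: \<eta>_def)
          also have "\<dots> \<le> \<epsilon> * 1" using \<epsilon> by (intro mult_left_mono) auto
          finally show ?thesis by simp
        qed
        then have "real k * (2 * \<eta> + 1 / 2) + (real k)\<^sup>2 / 2 \<le> real k * (real k + 1) / 2 + \<epsilon>"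
          by (simp add: algebra_simps power2_eq_square add_divide_distrib)
        then show ?thesis unfolding a_def b_def powr_add[symmetric] using n0 by (intro powr_mono) auto
      qed
      then have "?q ^ n * (C * (a * b)) \<le> ?q ^ n * (C * real n powr (real k * (real k + 1) / 2 + \<epsilon>))"
        using st by (intro mult_left_mono) (auto simp: C_def s_def t_def intro!: add_nonneg_nonneg mult_nonneg_nonneg)
      finally show "(\<Sum>D\<in>(monic_squarefree_polys n :: 'a poly set). norm (poly (L_poly D) u) ^ k) \<le>
          C * (?q ^ n * real n powr (real k * (real k + 1) / 2 + \<epsilon>))" by (simp add: mult_ac)
    qed
  qed
  then show ?thesis by (rule that)
qed

section \<open>Derivatives\<close>

text \<open>For \<open>norm z \<le> 1 \<le> \<rho>\<close> one has
  \<open>norm (1 - \<rho> * z) \<le> norm (\<rho> - z)\<close>; with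
  \<open>z = \<alpha> * u / \<rho>\<close> this treats each linear factor. The location of the
  inverse zeros thus yields a one-sided substitute for a functional equation.\<close>

lemma norm_L_poly_reflect:
  fixes D :: "'a::finite_field poly"
  assumes q: "odd CARD('a)" and D: "lead_coeff D = 1" "squarefree D" "degree D \<ge> 1"
    and \<rho>: "\<rho> \<ge> 1" and u: "norm u = \<rho> / sqrt (real CARD('a))"
  shows "norm (poly (L_poly D) u) \<le> \<rho> ^ degree D * norm (poly (L_poly D) (u / of_real (\<rho> ^ 2)))"
proof -
  let ?u = "u / of_real (\<rho> ^ 2)"
  obtain A :: "complex multiset" where A: "size A < degree D" "L_poly D = (\<Prod>\<alpha>\<in>#A. [:1, - \<alpha>:])"
    "\<And>n. n > 0 \<Longrightarrow> of_int (Lam D n) = - (\<Sum>\<alpha>\<in>#A. \<alpha> ^ n)"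
    "\<And>\<alpha>. \<alpha> \<in># A \<Longrightarrow> norm \<alpha> \<le> sqrt (real CARD('a))"
    using L_poly_RH[OF q D] by blast
  have step: "norm (1 - \<alpha> * u) \<le> \<rho> * norm (1 - \<alpha> * ?u)" if \<alpha>: "norm \<alpha> \<le> sqrt (real CARD('a))" for \<alpha>
  proof -
    define z where "z = \<alpha> * u / of_real \<rho>"
    have "norm z = norm \<alpha> / sqrt (real CARD('a))" using \<rho> by (simp add: z_def norm_mult norm_divide u)
    also have "\<dots> \<le> 1" using \<alpha> by (simp add: divide_le_eq_1)
    finally have z: "norm z \<le> 1" .
    have alg: "((r - a)\<^sup>2 + b\<^sup>2) - ((1 - r * a)\<^sup>2 + (r * b)\<^sup>2) = (r\<^sup>2 - 1) * (1 - (a\<^sup>2 + b\<^sup>2))" for r a b :: real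
      by (simp add: power2_eq_square algebra_simps)
    have "norm (of_real \<rho> - z) ^ 2 - norm (1 - of_real \<rho> * z) ^ 2 = (\<rho> ^ 2 - 1) * (1 - norm z ^ 2)"
      using alg[of \<rho> "Re z" "Im z"] by (simp add: cmod_power2)
    also have "\<dots> \<ge> 0" using \<rho> z by (intro mult_nonneg_nonneg) (auto simp: one_le_power power_le_one)
    finally have "norm (1 - of_real \<rho> * z) ^ 2 \<le> norm (of_real \<rho> - z) ^ 2" by simp
    then have "norm (1 - of_real \<rho> * z) \<le> norm (of_real \<rho> - z)" by (rule power2_le_imp_le) simp
    also have "of_real \<rho> - z = of_real \<rho> * (1 - \<alpha> * ?u)"
    proof -
      have "r - \<alpha> * u / r = r * (1 - \<alpha> * (u / r ^ 2))" if "r \<noteq> 0" for r :: complex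
        using that by (simp add: power2_eq_square right_diff_distrib)
      from this[of "of_real \<rho>"] show ?thesis using \<rho> by (simp add: z_def)
    qed
    also have "norm \<dots> = \<rho> * norm (1 - \<alpha> * ?u)" using \<rho> by (simp add: norm_mult)
    also have "of_real \<rho> * z = \<alpha> * u" using \<rho> by (simp add: z_def)
    finally show ?thesis .
  qed
  have gen: "norm (poly (\<Prod>\<alpha>\<in>#B. [:1, - \<alpha>:]) u) \<le> \<rho> ^ size B * norm (poly (\<Prod>\<alpha>\<in>#B. [:1, - \<alpha>:]) ?u)"
    if "set_mset B \<subseteq> set_mset A" for B
    using that
  proof (induction B)
    case (add \<alpha> B)
    have "norm (poly (\<Prod>\<alpha>\<in>#add_mset \<alpha> B. [:1, - \<alpha>:]) u) = norm (1 - \<alpha> * u) * norm (poly (\<Prod>\<alpha>\<in>#B. [:1, - \<alpha>:]) u)"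
    proof -
      have "poly (\<Prod>\<alpha>\<in>#add_mset \<alpha> B. [:1, - \<alpha>:]) u = (1 - \<alpha> * u) * poly (\<Prod>\<alpha>\<in>#B. [:1, - \<alpha>:]) u"
        by (simp only: image_mset_add_mset prod_mset.add_mset poly_mult) (simp add: mult.commute)
      then show ?thesis by (simp only: norm_mult)
    qed
    also have "\<dots> \<le> (\<rho> * norm (1 - \<alpha> * ?u)) * (\<rho> ^ size B * norm (poly (\<Prod>\<alpha>\<in>#B. [:1, - \<alpha>:]) ?u))"
      using add A(4) \<rho> by (intro mult_mono step) auto
    also have "\<dots> = \<rho> ^ size (add_mset \<alpha> B) * norm ((1 - \<alpha> * ?u) * poly (\<Prod>\<alpha>\<in>#B. [:1, - \<alpha>:]) ?u)"
      by (simp only: norm_mult size_add_mset power_Suc mult_ac)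
    also have "(1 - \<alpha> * ?u) * poly (\<Prod>\<alpha>\<in>#B. [:1, - \<alpha>:]) ?u = poly (\<Prod>\<alpha>\<in>#add_mset \<alpha> B. [:1, - \<alpha>:]) ?u"
      by (simp only: image_mset_add_mset prod_mset.add_mset poly_mult) (simp add: mult.commute)
    finally show ?case .
  qed simp
  have "norm (poly (L_poly D) u) \<le> \<rho> ^ size A * norm (poly (L_poly D) ?u)"
    unfolding A(2) by (rule gen) simp
  also have "\<dots> \<le> \<rho> ^ degree D * norm (poly (L_poly D) ?u)"
    using A(1) \<rho> by (intro mult_right_mono power_increasing) auto
  finally show ?thesis .
qed

section \<open>A discrete Cauchy estimate for derivatives of polynomials\<close>

lemma sum_roots_of_unity_power:
  fixes n j :: nat
  assumes n: "n > 0"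
  defines "w \<equiv> exp (2 * of_real pi * \<i> / of_nat n)"
  shows "(\<Sum>m<n. w ^ (m * j)) = (if n dvd j then of_nat n else 0)"
proof -
  have wj: "w ^ j = exp (2 * of_real pi * \<i> * of_nat j / of_nat n)" for j
    by (simp add: w_def exp_of_nat_mult[symmetric] mult_ac)
  have one: "w ^ j = 1 \<longleftrightarrow> n dvd j" for j unfolding wj using n by (intro complex_root_unity_eq_1) simp
  have sum: "(\<Sum>m<n. w ^ (m * j)) = (\<Sum>m<n. (w ^ j) ^ m)"
    by (simp add: mult.commute flip: power_mult)
  show ?thesis
  proof (cases "n dvd j")
    case True
    then show ?thesis unfolding sum using one[of j] by simp
  next
    case False
    then have "w ^ j \<noteq> 1" using one by simp
    moreover have "(w ^ j) ^ n = 1" using one[of "j * n"] by (simp add: power_mult)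
    ultimately show ?thesis unfolding sum using False by (simp add: geometric_sum)
  qed
qed

text \<open>As \<open>n\<close> exceeds the degree, averaging over the \<open>n\<close>-th roots of
  unity isolates one coefficient exactly, so a finite sum replaces the contour integral.\<close>

lemma norm_coeff_le_average:
  fixes p :: "complex poly"
  assumes n: "degree p < n" "l < n" and R: "R > 0"
  defines "w \<equiv> exp (2 * of_real pi * \<i> / of_nat n)"
  shows "real n * norm (coeff p l) * R ^ l \<le> (\<Sum>m<n. norm (poly p (of_real R * w ^ m)))"
proof -
  have n0: "n > 0" using n by simp
  \<comment> \<open>The exponent \<open>n - l\<close> stands for \<open>- l\<close> and keeps all
    exponents natural; among the indices below \<open>n\<close> only \<open>l\<close>
    survives.\<close>
  have dvd: "n dvd i + (n - l) \<longleftrightarrow> i = l" if "i < n" for i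
  proof
    assume "n dvd i + (n - l)"
    then obtain c where c: "i + (n - l) = n * c" by auto
    have "0 < n * c" "n * c < n * 2" using c that n by linarith+
    then have "c = 1" by simp
    then show "i = l" using c n by simp
  qed (use n in simp)
  have "(\<Sum>m<n. poly p (of_real R * w ^ m) * w ^ (m * (n - l))) =
      (\<Sum>m<n. \<Sum>i<n. coeff p i * of_real R ^ i * w ^ (m * (i + (n - l))))"
  proof (rule sum.cong[OF refl])
    fix m
    have "poly p (of_real R * w ^ m) = (\<Sum>i\<le>degree p. coeff p i * (of_real R * w ^ m) ^ i)" by (rule poly_altdef)
    also have "\<dots> = (\<Sum>i<n. coeff p i * (of_real R * w ^ m) ^ i)"
      using n by (intro sum.mono_neutral_left) (auto simp: coeff_eq_0)
    finally show "poly p (of_real R * w ^ m) * w ^ (m * (n - l)) =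
        (\<Sum>i<n. coeff p i * of_real R ^ i * w ^ (m * (i + (n - l))))"
      by (simp add: sum_distrib_right power_mult_distrib power_add distrib_left mult.assoc power_mult)
  qed
  also have "\<dots> = (\<Sum>i<n. coeff p i * of_real R ^ i * (\<Sum>m<n. w ^ (m * (i + (n - l)))))"
    by (subst sum.swap) (simp add: sum_distrib_left)
  also have "\<dots> = (\<Sum>i<n. if i = l then coeff p i * of_real R ^ i * of_nat n else 0)"
    unfolding w_def sum_roots_of_unity_power[OF n0] using dvd by (intro sum.cong) auto
  also have "\<dots> = coeff p l * of_real R ^ l * of_nat n" using n by simp
  finally have "norm (coeff p l * of_real R ^ l * of_nat n) \<le> (\<Sum>m<n. norm (poly p (of_real R * w ^ m) * w ^ (m * (n - l))))"
    by (metis norm_sum)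
  also have "norm w = 1" unfolding w_def norm_exp_eq_Re by simp
  then have "(\<Sum>m<n. norm (poly p (of_real R * w ^ m) * w ^ (m * (n - l)))) = (\<Sum>m<n. norm (poly p (of_real R * w ^ m)))"
    by (simp add: norm_mult norm_power)
  finally show ?thesis using R by (simp add: norm_mult norm_power mult_ac)
qed

lemma higher_deriv_poly: "(deriv ^^ l) (poly p) = poly ((pderiv ^^ l) p)" for p :: "complex poly"
proof (induction l)
  case (Suc l)
  have "deriv (poly r) = poly (pderiv r)" for r :: "complex poly"
    by (rule ext) (intro DERIV_imp_deriv poly_DERIV)
  then show ?case using Suc by simp
qed simp

lemma norm_higher_deriv_le_average:
  fixes p :: "complex poly" and u0 :: complex
  assumes n: "degree p < n" "l < n" and R: "R > 0"
  defines "w \<equiv> exp (2 * of_real pi * \<i> / of_nat n)"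
  shows "norm ((deriv ^^ l) (poly p) u0) \<le> fact l / R ^ l * ((\<Sum>m<n. norm (poly p (u0 + of_real R * w ^ m))) / real n)"
proof -
  define r where "r = pcompose p [:u0, 1:]"
  have "(pderiv ^^ l) r = pcompose ((pderiv ^^ l) p) [:u0, 1:]"
    unfolding r_def by (induction l) (auto simp: pderiv_pcompose pderiv_pCons)
  then have "poly ((pderiv ^^ l) p) u0 = poly ((pderiv ^^ l) r) 0" by (simp add: poly_pcompose)
  also have "\<dots> = fact l * coeff r l"
    by (simp add: poly_0_coeff_0 coeff_higher_pderiv pochhammer_fact)
  finally have d: "norm ((deriv ^^ l) (poly p) u0) = fact l * norm (coeff r l)"
    unfolding higher_deriv_poly by (simp add: norm_mult)
  have "degree r < n" using n by (simp add: r_def degree_pcompose)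
  then have "real n * norm (coeff r l) * R ^ l \<le> (\<Sum>m<n. norm (poly r (of_real R * w ^ m)))"
    unfolding w_def by (rule norm_coeff_le_average[OF _ n(2) R])
  also have "\<dots> = (\<Sum>m<n. norm (poly p (u0 + of_real R * w ^ m)))" by (simp add: r_def poly_pcompose)
  finally have "norm (coeff r l) \<le> (\<Sum>m<n. norm (poly p (u0 + of_real R * w ^ m))) / real n / R ^ l"
    using n R by (simp add: field_simps)
  then have "fact l * norm (coeff r l) \<le> fact l * ((\<Sum>m<n. norm (poly p (u0 + of_real R * w ^ m))) / real n / R ^ l)"
    by (rule mult_left_mono) simp
  then show ?thesis unfolding d by (simp add: field_simps)
qed

lemma power_average_le:
  fixes a :: "nat \<Rightarrow> real"
  assumes n: "n > 0" and a: "\<And>m. a m \<ge> 0"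
  shows "((\<Sum>m<n. a m) / real n) ^ k \<le> (\<Sum>m<n. a m ^ k) / real n"
proof -
  have conv: "convex_on {0..} (\<lambda>x :: real. x ^ k)"
    using convex_power_odd[of k] convex_on_subset[OF convex_power_even[of k]] by (cases "even k") auto
  have "(\<Sum>m<n. (1 / real n) *\<^sub>R a m) ^ k \<le> (\<Sum>m<n. (1 / real n) * a m ^ k)"
    using n a by (intro convex_on_sum[OF _ _ conv]) auto
  then show ?thesis by (simp add: sum_divide_distrib)
qed

text \<open>The circle of radius \<open>1 / n\<close> gives a factor \<open>n^l\<close> for each
  derivative and hence \<open>n^(l * k)\<close> in the moment. A smaller circle would lose more, and
  on this one the reflection still costs only a bounded factor:
  \<open>\<rho> \<le> 1 + \<surd>q / n\<close> gives
  \<open>\<rho>^n \<le> exp (\<surd>q)\<close>.\<close>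

theorem derivative_moment_bound:
  fixes k l :: nat and \<epsilon> :: real
  assumes q: "odd CARD('a::finite_field)" and \<epsilon>: "\<epsilon> > 0"
  obtains C where "eventually (\<lambda>n. (\<Sum>D\<in>(monic_squarefree_polys n :: 'a poly set).
      cmod ((deriv ^^ l) (quad_L D) (of_real (real CARD('a) powr (-1/2)))) ^ k) \<le>
    C * (real CARD('a) ^ n * real n powr (real k * (real k + 1) / 2 + real l * real k + \<epsilon>))) sequentially"
proof -
  let ?q = "real CARD('a)"
  define e where "e = real k * (real k + 1) / 2 + \<epsilon>"
  define u0 where "u0 = (of_real (?q powr (-1/2)) :: complex)"
  have q0: "?q > 0" by simp
  have qs: "?q powr (-1/2) = 1 / sqrt ?q"
  proof -
    have "?q powr (-1/2) = ?q powr (- (1/2))" by simp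
    also have "\<dots> = 1 / sqrt ?q" unfolding powr_minus_divide using q0 by (simp add: powr_half_sqrt)
    finally show ?thesis .
  qed
  obtain C where C: "eventually (\<lambda>n. \<forall>u. norm u \<le> 1 / sqrt ?q \<longrightarrow>
    (\<Sum>D\<in>(monic_squarefree_polys n :: 'a poly set). norm (poly (L_poly D) u) ^ k) \<le> C * (?q ^ n * real n powr e)) sequentially"
    unfolding e_def using L_poly_moment_bound[OF q \<epsilon>] by blast
  define C' where "C' = (fact l * exp (sqrt ?q)) ^ k * C"
  have "eventually (\<lambda>n. (\<Sum>D\<in>(monic_squarefree_polys n :: 'a poly set).
      cmod ((deriv ^^ l) (quad_L D) u0) ^ k) \<le> C' * (?q ^ n * real n powr (e + real l * real k))) sequentially"
    using C eventually_gt_at_top[of l]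
  proof eventually_elim
    case (elim n)
    let ?H = "monic_squarefree_polys n :: 'a poly set"
    have n0: "n > 0" using elim(2) by simp
    define w where "w = exp (2 * of_real pi * \<i> / of_nat n :: complex)"
    define v where "v m = u0 + of_real (1 / real n) * w ^ m" for m
    \<comment> \<open>The reflected points depend on \<open>n\<close> and \<open>m\<close> but not
      on \<open>D\<close>, so after Jensen's inequality the sums over \<open>m\<close> and
      \<open>D\<close> can be exchanged and the uniform moment bound applied at each point.\<close>
    define v' where "v' m = (if norm (v m) \<le> 1 / sqrt ?q then v m else v m / of_real ((norm (v m) * sqrt ?q) ^ 2))" for m
    have nw: "norm w = 1" unfolding w_def norm_exp_eq_Re by simp
    have v_le: "norm (v m) \<le> 1 / sqrt ?q + 1 / real n" for m
    proof -
      have "norm (v m) \<le> norm u0 + norm (of_real (1 / real n) * w ^ m)" unfolding v_def by (rule norm_triangle_ineq)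
      also have "norm u0 = 1 / sqrt ?q" unfolding u0_def qs norm_of_real using q0 by simp
      also have "norm (of_real (1 / real n) * w ^ m) = 1 / real n" unfolding norm_mult norm_power nw norm_of_real by simp
      finally show ?thesis .
    qed
    have v': "norm (v' m) \<le> 1 / sqrt ?q" for m
    proof (cases "norm (v m) \<le> 1 / sqrt ?q")
      case False
      then have gt: "norm (v m) * sqrt ?q > 1" using q0 by (simp add: not_le divide_less_eq)
      then have pos: "norm (v m) > 0" by (auto simp: zero_less_mult_iff intro: ccontr)
      have "norm (v' m) = norm (v m) / (norm (v m) * sqrt ?q) ^ 2" using False by (simp add: v'_def norm_divide norm_power norm_mult)
      also have "\<dots> = (1 / sqrt ?q) / (norm (v m) * sqrt ?q)" using pos by (simp add: power2_eq_square)
      also have "\<dots> \<le> (1 / sqrt ?q) / 1" using gt by (intro divide_left_mono) auto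
      finally show ?thesis by simp
    qed (simp add: v'_def)
    have refl_bound: "norm (poly (L_poly D) (v m)) \<le> exp (sqrt ?q) * norm (poly (L_poly D) (v' m))" if D: "D \<in> ?H" for D m
    proof (cases "norm (v m) \<le> 1 / sqrt ?q")
      case True
      have "1 * norm (poly (L_poly D) (v m)) \<le> exp (sqrt ?q) * norm (poly (L_poly D) (v m))"
        by (intro mult_right_mono) auto
      then show ?thesis using True by (simp add: v'_def)
    next
      case False
      have D': "lead_coeff D = 1" "squarefree D" "degree D = n" using D by (auto simp: monic_squarefree_polys_def)
      have dD: "degree D \<ge> 1" using D'(3) n0 by simp
      define \<rho> where "\<rho> = norm (v m) * sqrt ?q"
      have \<rho>: "\<rho> \<ge> 1" "norm (v m) = \<rho> / sqrt ?q" using False q0 by (auto simp: \<rho>_def not_le divide_less_eq)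
      have "\<rho> \<le> (1 / sqrt ?q + 1 / real n) * sqrt ?q" unfolding \<rho>_def by (intro mult_right_mono v_le) simp
      also have "\<dots> = 1 + sqrt ?q / real n" using q0 by (simp add: distrib_right)
      also have "\<dots> \<le> exp (sqrt ?q / real n)" by (rule exp_ge_add_one_self)
      finally have "\<rho> ^ n \<le> exp (sqrt ?q / real n) ^ n" using \<rho> by (intro power_mono) auto
      also have "\<dots> = exp (sqrt ?q)" using n0 by (simp add: exp_of_nat_mult[symmetric])
      finally have \<rho>n: "\<rho> ^ n \<le> exp (sqrt ?q)" .
      have "norm (poly (L_poly D) (v m)) \<le> \<rho> ^ n * norm (poly (L_poly D) (v m / of_real (\<rho> ^ 2)))"
        using norm_L_poly_reflect[OF q D'(1,2) dD \<rho>] unfolding D'(3) .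
      also have "v m / of_real (\<rho> ^ 2) = v' m" unfolding v'_def \<rho>_def if_not_P[OF False] ..
      also have "\<rho> ^ n * norm (poly (L_poly D) (v' m)) \<le> exp (sqrt ?q) * norm (poly (L_poly D) (v' m))"
        by (intro mult_right_mono \<rho>n) simp
      finally show ?thesis .
    qed
    define F where "F = (fact l * exp (sqrt ?q)) ^ k * real n powr (real l * real k)"
    have F0: "F \<ge> 0" by (simp add: F_def)
    have pt: "cmod ((deriv ^^ l) (quad_L D) u0) ^ k \<le> F * ((\<Sum>m<n. norm (poly (L_poly D) (v' m)) ^ k) / real n)"
      if D: "D \<in> ?H" for D
    proof -
      have D': "lead_coeff D = 1" "squarefree D" "degree D = n" using D by (auto simp: monic_squarefree_polys_def)
      have dD: "degree D \<ge> 1" using D'(3) n0 by simp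
      have degL: "degree (L_poly D) < n" using degree_L_poly[OF dD] D'(3) by simp
      have R: "1 / real n > 0" using n0 by simp
      have "cmod ((deriv ^^ l) (quad_L D) u0) \<le> fact l / (1 / real n) ^ l * ((\<Sum>m<n. norm (poly (L_poly D) (v m))) / real n)"
        unfolding quad_L_eq_poly[OF q D'(1,2) dD] v_def w_def
        by (rule norm_higher_deriv_le_average[OF degL elim(2) R])
      also have "\<dots> \<le> fact l / (1 / real n) ^ l * ((\<Sum>m<n. exp (sqrt ?q) * norm (poly (L_poly D) (v' m))) / real n)"
        by (intro mult_left_mono divide_right_mono sum_mono refl_bound D) auto
      also have "\<dots> = fact l * exp (sqrt ?q) * real n ^ l * ((\<Sum>m<n. norm (poly (L_poly D) (v' m))) / real n)"
        by (simp add: sum_distrib_left[symmetric] power_divide)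
      finally have "cmod ((deriv ^^ l) (quad_L D) u0) ^ k \<le>
          (fact l * exp (sqrt ?q) * real n ^ l * ((\<Sum>m<n. norm (poly (L_poly D) (v' m))) / real n)) ^ k"
        by (intro power_mono) auto
      also have "\<dots> = F * ((\<Sum>m<n. norm (poly (L_poly D) (v' m))) / real n) ^ k"
      proof -
        have "real n powr (real l * real k) = (real n ^ l) ^ k"
          using n0 powr_realpow[of "real n" "l * k"] by (simp add: power_mult)
        then show ?thesis unfolding F_def by (simp only: power_mult_distrib)
      qed
      also have "\<dots> \<le> F * ((\<Sum>m<n. norm (poly (L_poly D) (v' m)) ^ k) / real n)"
        by (intro mult_left_mono power_average_le n0 F0) simp
      finally show ?thesis .
    qed
    have "(\<Sum>D\<in>?H. cmod ((deriv ^^ l) (quad_L D) u0) ^ k) \<le> (\<Sum>D\<in>?H. F * ((\<Sum>m<n. norm (poly (L_poly D) (v' m)) ^ k) / real n))"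
      by (rule sum_mono[OF pt])
    also have "\<dots> = F * ((\<Sum>m<n. \<Sum>D\<in>?H. norm (poly (L_poly D) (v' m)) ^ k) / real n)"
      unfolding sum_distrib_left[symmetric] sum_divide_distrib[symmetric] by (subst sum.swap) (rule refl)
    also have "\<dots> \<le> F * ((\<Sum>m<n. C * (?q ^ n * real n powr e)) / real n)"
      using elim(1) v' by (intro mult_left_mono divide_right_mono sum_mono F0) auto
    also have "\<dots> = F * (C * (?q ^ n * real n powr e))" using n0 by simp
    also have "\<dots> = C' * (?q ^ n * real n powr (e + real l * real k))"
      by (simp add: F_def C'_def powr_add mult_ac)
    finally show ?case .
  qed
  moreover have "e + real l * real k = real k * (real k + 1) / 2 + real l * real k + \<epsilon>" by (simp add: e_def)
  ultimately show ?thesis using that unfolding u0_def by simp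
qed

lemma bigo_of_moment_bound:
  fixes F :: "nat \<Rightarrow> real" and q e :: real and c :: nat
  assumes ev: "eventually (\<lambda>n. F n \<le> C * (q ^ n * real n powr e)) sequentially"
    and F: "\<And>n. F n \<ge> 0" and q: "q > 0" and e: "e \<ge> 0" and c: "c \<le> 2"
  shows "(\<lambda>g. F (2 * g + c)) \<in> O(\<lambda>g. q ^ (2 * g + c) * real g powr e)"
proof -
  have lim: "filterlim (\<lambda>g :: nat. 2 * g + c) sequentially sequentially"
    by (rule filterlim_subseq) (auto simp: strict_mono_def)
  have "eventually (\<lambda>g. F (2 * g + c) \<le> C * (q ^ (2 * g + c) * real (2 * g + c) powr e)) sequentially"
    using eventually_compose_filterlim[OF ev lim] .
  moreover have "eventually (\<lambda>g :: nat. g \<ge> 1) sequentially" by (rule eventually_ge_at_top)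
  ultimately have "eventually (\<lambda>g. norm (F (2 * g + c)) \<le> (\<bar>C\<bar> * 4 powr e) * norm (q ^ (2 * g + c) * real g powr e)) sequentially"
  proof eventually_elim
    case (elim g)
    have "real (2 * g + c) powr e \<le> (4 * real g) powr e"
      using elim(2) c e by (intro powr_mono2) auto
    also have "\<dots> = 4 powr e * real g powr e" by (simp add: powr_mult)
    finally have p: "real (2 * g + c) powr e \<le> 4 powr e * real g powr e" .
    have "F (2 * g + c) \<le> \<bar>C\<bar> * (q ^ (2 * g + c) * real (2 * g + c) powr e)"
      using elim(1) q by (intro order.trans[OF elim(1)] mult_right_mono) auto
    also have "\<dots> \<le> \<bar>C\<bar> * (q ^ (2 * g + c) * (4 powr e * real g powr e))"
      using q p by (intro mult_left_mono) auto
    finally show ?case using F[of "2 * g + c"] q by (simp add: abs_mult mult_ac)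
  qed
  then show ?thesis by (rule bigoI)
qed

theorem corollary1p8:
  fixes k l :: nat and \<epsilon> :: real
  assumes "odd CARD('a::finite_field)" and "\<epsilon> > 0"
  shows "(\<lambda>g::nat. \<Sum>D\<in>(monic_squarefree_polys (2 * g + 1) :: 'a poly set).
            cmod ((deriv ^^ l) (quad_L D) (of_real (real CARD('a) powr (-1/2)))) ^ k)
         \<in> O(\<lambda>g. real CARD('a) ^ (2 * g + 1) *
                real g powr (real k * (real k + 1) / 2 + real l * real k + \<epsilon>)) \<and>
         (\<lambda>g::nat. \<Sum>D\<in>(monic_squarefree_polys (2 * g + 2) :: 'a poly set).
            cmod ((deriv ^^ l) (quad_L D) (of_real (real CARD('a) powr (-1/2)))) ^ k)
         \<in> O(\<lambda>g. real CARD('a) ^ (2 * g + 2) *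
                real g powr (real k * (real k + 1) / 2 + real l * real k + \<epsilon>))"
proof -
  let ?F = "\<lambda>n. \<Sum>D\<in>(monic_squarefree_polys n :: 'a poly set).
    cmod ((deriv ^^ l) (quad_L D) (of_real (real CARD('a) powr (-1/2)))) ^ k"
  obtain C where C: "eventually (\<lambda>n. ?F n \<le> C * (real CARD('a) ^ n *
      real n powr (real k * (real k + 1) / 2 + real l * real k + \<epsilon>))) sequentially"
    using derivative_moment_bound[OF assms] by blast
  have F: "?F n \<ge> 0" for n by (intro sum_nonneg) simp
  have e: "real k * (real k + 1) / 2 + real l * real k + \<epsilon> \<ge> 0" using assms(2) by simp
  show ?thesis
    using bigo_of_moment_bound[OF C F _ e, of 1] bigo_of_moment_bound[OF C F _ e, of 2] by simp
qed

end
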